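(* Let $n>1$, let $q\in\Bbbk$ satisfy $q^n=1$ and have multiplicative order $d\ge 2$, and let $\mathcal{C}_q$ be the tensor category of finite dimensional right $\Bbbk\mathcal{Z}(q)$-comodules. Then the Green ring $\mathcal{GR}(\mathcal{C}_q)$ is isomorphic to $\mathbb{Z}[x,y,z]/J$, where $J$ is the ideal of $\mathbb{Z}[x,y,z]$ generated by $$\Big\{x^n-1,\ (y-x-1)\Big[\sum_{i=0}^{[\frac{d-1}{2}]}(-1)^i\binom{d-1-i}{i}x^iy^{d-1-2i}\Big]\Big\}.$$
   Context: $\Bbbk$ is an algebraically closed field of characteristic $0$; $n>1$ is an integer; $\mathbb{Z}_n$ denotes the integers modulo $n$; $[a]$ denotes the integer part of $a$ for a rational number $a$. For $q\in\Bbbk$ and integers $l,m\ge 0$ put $l_q=1+q+\cdots+q^{l-1}$, $l!_q=1_q\cdots l_q$, and let $\binom{l+m}{l}_q=\frac{(l+m)!_q}{l!_q\,m!_q}$ be the Gaussian binomial coefficient (a polynomial in $q$, evaluated at $q$). For $q\in\Bbbk$ with $q^n=1$, $\Bbbk\mathcal{Z}(q)$ is the Hopf algebra with $\Bbbk$-basis $\{p_i^l\mid i\in\mathbb{Z}_n,\ l\ge 0\}$ ($p_i^l$ is the path of length $l$ starting at vertex $i$ of the cyclic quiver with $n$ vertices), comultiplication $\Delta(p_i^l)=\sum_{j=0}^{l}p_{i+j}^{l-j}\otimes p_i^{j}$, counit $\varepsilon(p_i^l)=\delta_{l,0}$, multiplication $p_i^l\cdot p_j^m=q^{im}\binom{l+m}{l}_q\,p_{i+j}^{l+m}$,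 and unit $p_0^0$. $\mathcal{C}_q$ is the tensor category of finite dimensional right $\Bbbk\mathcal{Z}(q)$-comodules, where the comodule structure of $U\otimes V$ is $u\otimes v\mapsto u_0\otimes v_0\otimes u_1v_1$ (Sweedler notation). The Green ring $\mathcal{GR}(\mathcal{C})$ of a tensor category $\mathcal{C}$ is the abelian group generated by the isomorphism classes $[X]$ of objects of $\mathcal{C}$ modulo all split short exact sequences (i.e. $[X\oplus Y]=[X]+[Y]$), with multiplication $[X]\cdot[Y]=[X\otimes Y]$. *)

theory Defs
  imports
    "HOL-Library.Poly_Mapping"
    "HOL-Computational_Algebra.Polynomial"
    "HOL-Algebra.QuotRing"
    "HOL-Algebra.Generated_Groups"
    "HOL-Algebra.Algebraic_Closure_Type"
begin

section \<open>Free vector spaces\<close>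

text \<open>
  The type \<open>'a \<Rightarrow>\<^sub>0 'k\<close> is the vector space with basis \<open>'a\<close>. The tensor product of the spaces with
  bases \<open>'a\<close> and \<open>'b\<close> is the space with basis \<open>'a \<times> 'b\<close>.
\<close>

definition pscale :: "'k::field \<Rightarrow> ('a \<Rightarrow>\<^sub>0 'k) \<Rightarrow> ('a \<Rightarrow>\<^sub>0 'k)" where
  "pscale c v = Poly_Mapping.map ((*) c) v"

lemma lookup_pscale: "Poly_Mapping.lookup (pscale c v) a = c * Poly_Mapping.lookup v a"
  by (simp add: pscale_def Poly_Mapping.map.rep_eq when_def)

lemma vector_space_pscale: "vector_space (pscale :: 'k::field \<Rightarrow> ('a \<Rightarrow>\<^sub>0 'k) \<Rightarrow> _)"
  by unfold_locales (auto intro!: poly_mapping_eqI simp: lookup_pscale lookup_add algebra_simps)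

abbreviation bvec :: "'a \<Rightarrow> ('a \<Rightarrow>\<^sub>0 'k::field)" where
  "bvec a \<equiv> Poly_Mapping.single a 1"

definition span_on :: "'a set \<Rightarrow> ('a \<Rightarrow>\<^sub>0 'k::field) set" where
  "span_on B = {v. Poly_Mapping.keys v \<subseteq> B}"

definition lin_ext :: "('a \<Rightarrow> ('b \<Rightarrow>\<^sub>0 'k::field)) \<Rightarrow> ('a \<Rightarrow>\<^sub>0 'k) \<Rightarrow> ('b \<Rightarrow>\<^sub>0 'k)" where
  "lin_ext f v = (\<Sum>a\<in>Poly_Mapping.keys v. pscale (Poly_Mapping.lookup v a) (f a))"

definition tens :: "('a \<Rightarrow>\<^sub>0 'k::field) \<Rightarrow> ('b \<Rightarrow>\<^sub>0 'k) \<Rightarrow> ('a \<times> 'b \<Rightarrow>\<^sub>0 'k)" where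
  "tens u v = (\<Sum>a\<in>Poly_Mapping.keys u. \<Sum>b\<in>Poly_Mapping.keys v.
     Poly_Mapping.single (a, b) (Poly_Mapping.lookup u a * Poly_Mapping.lookup v b))"

definition tens_map :: "(('a \<Rightarrow>\<^sub>0 'k::field) \<Rightarrow> ('c \<Rightarrow>\<^sub>0 'k)) \<Rightarrow> (('b \<Rightarrow>\<^sub>0 'k) \<Rightarrow> ('d \<Rightarrow>\<^sub>0 'k)) \<Rightarrow>
    ('a \<times> 'b \<Rightarrow>\<^sub>0 'k) \<Rightarrow> ('c \<times> 'd \<Rightarrow>\<^sub>0 'k)" where
  "tens_map f g = lin_ext (\<lambda>(a, b). tens (f (bvec a)) (g (bvec b)))"

definition tens_assoc :: "(('a \<times> 'b) \<times> 'c \<Rightarrow>\<^sub>0 'k::field) \<Rightarrow> ('a \<times> 'b \<times> 'c \<Rightarrow>\<^sub>0 'k)" where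
  "tens_assoc = lin_ext (\<lambda>((a, b), c). bvec (a, b, c))"

abbreviation is_linear :: "(('a \<Rightarrow>\<^sub>0 'k::field) \<Rightarrow> ('b \<Rightarrow>\<^sub>0 'k)) \<Rightarrow> bool" where
  "is_linear f \<equiv> Vector_Spaces.linear pscale pscale f"


section \<open>The Hopf algebra of the cyclic quiver\<close>

definition q_int :: "nat \<Rightarrow> 'k::field poly" where
  "q_int l = (\<Sum>i<l. monom 1 i)"

definition q_fact :: "nat \<Rightarrow> 'k::field poly" where
  "q_fact l = (\<Prod>i=1..l. q_int i)"

text \<open>
  The Gaussian binomial coefficient \<open>(l+m choose l)\<close> at \<open>q\<close>. The (exact) division is one of
  polynomials, because the value of the denominator at a root of unity may be \<open>0\<close>.
\<close>

definition gauss_binom :: "nat \<Rightarrow> nat \<Rightarrow> 'k::field \<Rightarrow> 'k" where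
  "gauss_binom l m q = poly (q_fact (l + m) div (q_fact l * q_fact m)) q"

text \<open>
  The pair \<open>(i, l)\<close> with \<open>i < n\<close> stands for the path \<open>p\<^sub>i\<^sup>l\<close>; vertices, the elements of the integers
  modulo \<open>n\<close>, are represented by their remainders. Since only pairs with \<open>i < n\<close> are paths, the
  Hopf algebra is \<open>span_on (paths n)\<close>.
\<close>

type_synonym path = "nat \<times> nat"

definition paths :: "nat \<Rightarrow> path set" where
  "paths n = {..<n} \<times> UNIV"

definition comult :: "nat \<Rightarrow> (path \<Rightarrow>\<^sub>0 'k::field) \<Rightarrow> (path \<times> path \<Rightarrow>\<^sub>0 'k)" where
  "comult n = lin_ext (\<lambda>(i, l). \<Sum>j\<le>l. tens (bvec ((i + j) mod n, l - j)) (bvec (i, j)))"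

definition counit :: "(path \<Rightarrow>\<^sub>0 'k::field) \<Rightarrow> 'k" where
  "counit c = (\<Sum>(i, l)\<in>Poly_Mapping.keys c. Poly_Mapping.lookup c (i, l) * (if l = 0 then 1 else 0))"

definition hmult :: "nat \<Rightarrow> 'k::field \<Rightarrow> (path \<times> path \<Rightarrow>\<^sub>0 'k) \<Rightarrow> (path \<Rightarrow>\<^sub>0 'k)" where
  "hmult n q = lin_ext (\<lambda>((i, l), (j, m)).
     pscale (q ^ (i * m) * gauss_binom l m q) (bvec ((i + j) mod n, l + m)))"

definition hunit :: "path \<Rightarrow>\<^sub>0 'k::field" where
  "hunit = bvec (0, 0)"


section \<open>Finite dimensional right comodules\<close>

text \<open>
  Up to isomorphism every finite dimensional comodule lives on a coordinate space \<open>k\<^sup>m\<close>, which is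
  taken here as \<open>span_on {..<m}\<close> inside \<open>nat \<Rightarrow>\<^sub>0 'k\<close>. Linear maps out of \<open>k\<^sup>m\<close> are written as linear
  maps on all of \<open>nat \<Rightarrow>\<^sub>0 'k\<close>, of which only the restriction to \<open>k\<^sup>m\<close> matters.
\<close>

record (overloaded) 'k comodule =
  cdim :: nat
  coact :: "(nat \<Rightarrow>\<^sub>0 'k) \<Rightarrow> (nat \<times> path \<Rightarrow>\<^sub>0 'k)"

definition cspace :: "'k::field comodule \<Rightarrow> (nat \<Rightarrow>\<^sub>0 'k) set" where
  "cspace M = span_on {..<cdim M}"

definition id_tens_counit :: "(nat \<times> path \<Rightarrow>\<^sub>0 'k::field) \<Rightarrow> (nat \<Rightarrow>\<^sub>0 'k)" where
  "id_tens_counit = lin_ext (\<lambda>(a, p). pscale (counit (bvec p)) (bvec a))"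

definition is_comodule :: "nat \<Rightarrow> 'k::field comodule \<Rightarrow> bool" where
  "is_comodule n M \<longleftrightarrow>
     is_linear (coact M) \<and>
     (\<forall>v\<in>cspace M.
        coact M v \<in> span_on ({..<cdim M} \<times> paths n) \<and>
        tens_assoc (tens_map (coact M) id (coact M v)) = tens_map id (comult n) (coact M v) \<and>
        id_tens_counit (coact M v) = v)"

definition comodule_iso :: "'k::field comodule \<Rightarrow> 'k comodule \<Rightarrow> bool" where
  "comodule_iso M N \<longleftrightarrow>
     (\<exists>f. is_linear f \<and> bij_betw f (cspace M) (cspace N) \<and>
          (\<forall>v\<in>cspace M. tens_map f id (coact M v) = coact N (f v)))"

text \<open>The direct sum of \<open>k\<^sup>m\<close> and \<open>k\<^sup>m\<^sup>'\<close> is \<open>k\<^sup>m\<^sup>+\<^sup>m\<^sup>'\<close>, the second summand being shifted by \<open>m\<close>.\<close>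

definition csum :: "'k::field comodule \<Rightarrow> 'k comodule \<Rightarrow> 'k comodule" where
  "csum M N = \<lparr>cdim = cdim M + cdim N,
     coact = lin_ext (\<lambda>a.
       if a < cdim M then coact M (bvec a)
       else tens_map (lin_ext (\<lambda>b. bvec (cdim M + b))) id (coact N (bvec (a - cdim M))))\<rparr>"

text \<open>
  In the tensor product of \<open>k\<^sup>m\<close> and \<open>k\<^sup>m\<^sup>'\<close>, identified with \<open>k\<^sup>m\<^sup>m\<^sup>'\<close>, the basis vector with index
  \<open>i * m' + j\<close> is the tensor product of the \<open>i\<close>-th and the \<open>j\<close>-th one. The coaction sends \<open>u \<otimes> v\<close> to
  \<open>u\<^sub>0 \<otimes> v\<^sub>0 \<otimes> u\<^sub>1 v\<^sub>1\<close>.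
\<close>

definition ctensor :: "nat \<Rightarrow> 'k::field \<Rightarrow> 'k comodule \<Rightarrow> 'k comodule \<Rightarrow> 'k comodule" where
  "ctensor n q M N = \<lparr>cdim = cdim M * cdim N,
     coact = lin_ext (\<lambda>a.
       lin_ext (\<lambda>((i, c), (j, c')). tens (bvec (i * cdim N + j)) (hmult n q (bvec (c, c'))))
         (tens (coact M (bvec (a div cdim N))) (coact N (bvec (a mod cdim N)))))\<rparr>"

definition cunit :: "'k::field comodule" where
  "cunit = \<lparr>cdim = 1, coact = (\<lambda>v. tens v hunit)\<rparr>"


section \<open>The Green ring\<close>

definition iso_class :: "nat \<Rightarrow> 'k::field comodule \<Rightarrow> 'k comodule set" where
  "iso_class n M = {N. is_comodule n N \<and> comodule_iso M N}"

definition class_tensor ::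
  "nat \<Rightarrow> 'k::field \<Rightarrow> 'k comodule set \<Rightarrow> 'k comodule set \<Rightarrow> 'k comodule set" where
  "class_tensor n q A B = (\<Union>M\<in>A. \<Union>N\<in>B. iso_class n (ctensor n q M N))"

text \<open>
  The free abelian group on the isomorphism classes, with the biadditive multiplication
  determined by \<open>[X] \<cdot> [Y] = [X \<otimes> Y]\<close>.
\<close>

definition free_green :: "nat \<Rightarrow> 'k::field \<Rightarrow> ('k comodule set \<Rightarrow>\<^sub>0 int) ring" where
  "free_green n q = \<lparr>
     carrier = {f. Poly_Mapping.keys f \<subseteq> iso_class n ` {M. is_comodule n M}},
     monoid.mult = (\<lambda>f g. \<Sum>A\<in>Poly_Mapping.keys f. \<Sum>B\<in>Poly_Mapping.keys g.
       Poly_Mapping.single (class_tensor n q A B) (Poly_Mapping.lookup f A * Poly_Mapping.lookup g B)),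
     one = Poly_Mapping.single (iso_class n cunit) 1,
     zero = 0,
     add = (+)\<rparr>"

definition split_relations :: "nat \<Rightarrow> ('k::field comodule set \<Rightarrow>\<^sub>0 int) set" where
  "split_relations n =
     {Poly_Mapping.single (iso_class n (csum M N)) 1
        - Poly_Mapping.single (iso_class n M) 1 - Poly_Mapping.single (iso_class n N) 1 | M N.
      is_comodule n M \<and> is_comodule n N}"

definition green_ring :: "nat \<Rightarrow> 'k::field \<Rightarrow> ('k comodule set \<Rightarrow>\<^sub>0 int) set ring" where
  "green_ring n q =
     free_green n q Quot generate (add_monoid (free_green n q)) (split_relations n)"


section \<open>The polynomial ring\<close>

text \<open>
  \<open>'v \<Rightarrow>\<^sub>0 nat\<close> is the monoid of monomials (exponent vectors), and the ring structure
  of its monoid ring over the integers is the instance in \<open>Poly_Mapping\<close>.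
\<close>

datatype var3 = VarX | VarY | VarZ

type_synonym int_poly3 = "(var3 \<Rightarrow>\<^sub>0 nat) \<Rightarrow>\<^sub>0 int"

definition pvar :: "var3 \<Rightarrow> int_poly3" where
  "pvar v = Poly_Mapping.single (Poly_Mapping.single v 1) 1"

abbreviation int_poly3_ring :: "int_poly3 ring" where
  "int_poly3_ring \<equiv> ring_of_type_algebra"

definition green_ideal :: "nat \<Rightarrow> nat \<Rightarrow> int_poly3 set" where
  "green_ideal n d = (let x = pvar VarX; y = pvar VarY in
     Idl\<^bsub>int_poly3_ring\<^esub>
       {x ^ n - 1,
        (y - x - 1) *
          (\<Sum>i=0..(d - 1) div 2.
             (- 1) ^ i * of_nat ((d - 1 - i) choose i) * x ^ i * y ^ (d - 1 - 2 * i))})"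

end

theory Submission
  imports Defs
begin

text \<open>
  A comodule is a space graded by the integers modulo \<open>n\<close> together with a nilpotent operator \<open>X\<close> of
  degree \<open>1\<close>: the coefficient of \<open>p\<^sub>i\<^sup>l\<close> in the coaction is \<open>X\<^sup>l\<close> on the component of degree \<open>i\<close>. On a tensor
  product, \<open>X (u \<otimes> v) = X u \<otimes> v + q ^ deg u \<cdot> u \<otimes> X v\<close>. Let \<open>V(t, l)\<close> be the uniserial comodule with basis
  \<open>v, X v, \<dots>, X\<^sup>l v\<close>, where \<open>v\<close> has degree \<open>t\<close>, and put \<open>x = V(1, 0)\<close>, \<open>y = V(0, 1)\<close>, \<open>z = V(0, d)\<close>.

  Explicit decompositions give \<open>y V(0, l) = V(0, l + 1) + x V(0, l - 1)\<close> if \<open>(l + 1)\<^sub>q \<noteq> 0\<close>, whence \<open>V(0, l)\<close> is the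
  Chebyshev-like polynomial in \<open>x\<close> and \<open>y\<close> for \<open>l < d\<close>, and \<open>y V(0, d - 1) = V(0, d - 1) + x V(0, d - 1)\<close>,
  which is the second relation.

  The top power of \<open>X\<close> on a tensor product carries a Gaussian binomial coefficient. It does not vanish in
  the products building up \<open>x\<^sup>a y\<^sup>b z\<^sup>c\<close> with \<open>b < d\<close> (for the powers of \<open>z\<close> it equals \<open>c + 1\<close>, so that characteristic
  \<open>0\<close> is needed), and hence this monomial is \<open>V(a, b + c d)\<close> plus shorter comodules. A submodule generated by a
  homogeneous vector on which the largest nonzero power of \<open>X\<close> does not vanish is a direct summand, so by
  induction on the length the monomials span the Green ring; those with \<open>a < n\<close> and \<open>b < d\<close> are linearly
  independent, as is seen from the ranks of the powers of \<open>X\<close>. Modulo the two relations every polynomial is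
  a combination of the same monomials.
\<close>

section \<open>Linear algebra on free vector spaces, in coordinates\<close>

section \<open>Linear maps on free vector spaces\<close>

text \<open>No classification of indecomposables and no Krull-Schmidt theorem enters. Linear
  independence is tested by the rank of X^l on the part of degree i: this number is invariant under
  isomorphism and additive over direct sums, so it factors through the Green ring. Spanning needs
  only that a longest string v, Xv, X^2 v, ... splits off, for which an explicit retraction is
  built.

  It is enough that x, y and z commute, and this is seen by decomposing products in both orders. The
  products of y and z are the case l = d of the rule for y V(0, l), which applies because (d + 1)_q
  = 1.

  The sum in the second generator is the closed form of the recursion S_0 = 1, S_1 = y, S_{l+2} = y
  S_{l+1} - x S_l, followed until (l + 1)_q vanishes, that is, up to l = d - 1.\<close>

global_interpretation pm: vector_space "pscale :: 'k::field \<Rightarrow> ('a \<Rightarrow>\<^sub>0 'k) \<Rightarrow> _"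
  by (rule vector_space_pscale)

lemma pscale_1 [simp]: "pscale 1 v = v"
  and pscale_0 [simp]: "pscale 0 v = 0"
  and pscale_zero [simp]: "pscale c 0 = 0"
  and pscale_pscale [simp]: "pscale a (pscale b v) = pscale (a * b) v"
  by simp_all

lemma pscale_single [simp]: "pscale c (Poly_Mapping.single a x) = Poly_Mapping.single a (c * x)"
  by (auto intro!: poly_mapping_eqI simp: lookup_pscale lookup_single when_def)

lemma is_linear_iff:
  "is_linear f \<longleftrightarrow> (\<forall>u v. f (u + v) = f u + f v) \<and> (\<forall>c v. f (pscale c v) = pscale c (f v))"
  by (simp add: Vector_Spaces.linear_iff vector_space_pscale)

lemma is_linearI:
  assumes "\<And>u v. f (u + v) = f u + f v" "\<And>c v. f (pscale c v) = pscale c (f v)"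
  shows "is_linear f"
  using assms by (simp add: is_linear_iff)

lemma is_linear_addD: "is_linear f \<Longrightarrow> f (u + v) = f u + f v"
  and is_linear_scaleD: "is_linear f \<Longrightarrow> f (pscale c v) = pscale c (f v)"
  by (simp_all add: is_linear_iff)

lemma is_linear_zeroD: "is_linear f \<Longrightarrow> f 0 = 0"
  using is_linear_scaleD[of f 0 0] by simp

lemma is_linear_uminusD: "is_linear f \<Longrightarrow> f (- v) = - f v"
  using is_linear_scaleD[of f "-1" v] by simp

lemma is_linear_diffD: "is_linear f \<Longrightarrow> f (u - v) = f u - f v"
  using is_linear_addD[of f u "- v"] by (simp add: is_linear_uminusD)

lemma is_linear_sumD: "is_linear f \<Longrightarrow> f (\<Sum>i\<in>A. g i) = (\<Sum>i\<in>A. f (g i))"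
  by (induction A rule: infinite_finite_induct) (simp_all add: is_linear_zeroD is_linear_addD)

lemmas is_linearD = is_linear_addD is_linear_scaleD is_linear_zeroD is_linear_uminusD
  is_linear_diffD is_linear_sumD

lemma is_linear_id [simp]: "is_linear id" "is_linear (\<lambda>v. v)"
  by (simp_all add: is_linear_iff)

lemma is_linear_const_zero [simp]: "is_linear (\<lambda>v. 0)"
  by (simp add: is_linear_iff)

lemma is_linear_compose:
  "is_linear f \<Longrightarrow> is_linear g \<Longrightarrow> is_linear (\<lambda>v. f (g v))"
  by (simp add: is_linear_iff)

lemma is_linear_add: "is_linear f \<Longrightarrow> is_linear g \<Longrightarrow> is_linear (\<lambda>v. f v + g v)"
  by (simp add: is_linear_iff pm.scale_right_distrib algebra_simps)

lemma is_linear_scale: "is_linear f \<Longrightarrow> is_linear (\<lambda>v. pscale c (f v))"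
  by (simp add: is_linear_iff pm.scale_right_distrib mult.commute)

lemma is_linear_minus: "is_linear f \<Longrightarrow> is_linear g \<Longrightarrow> is_linear (\<lambda>v. f v - g v)"
  by (simp add: is_linear_iff pm.scale_right_diff_distrib algebra_simps)

lemma is_linear_sum: "(\<And>i. i \<in> A \<Longrightarrow> is_linear (f i)) \<Longrightarrow> is_linear (\<lambda>v. \<Sum>i\<in>A. f i v)"
  by (induction A rule: infinite_finite_induct) (simp_all add: is_linear_add)

lemma is_linear_if: "is_linear f \<Longrightarrow> is_linear g \<Longrightarrow> is_linear (\<lambda>v. if P then f v else g v)"
  by (cases P) simp_all

lemma is_linear_funpow:
  fixes f :: "('a \<Rightarrow>\<^sub>0 'k::field) \<Rightarrow> ('a \<Rightarrow>\<^sub>0 'k)"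
  shows "is_linear f \<Longrightarrow> is_linear (f ^^ l)"
  by (induction l) (simp_all add: is_linear_iff)

text \<open>Coefficients outside the support are zero, so the sum may run over any finite superset.
  Additivity of \<open>lin_ext\<close> requires such a common range for u, v and u + v.\<close>

lemma lin_ext_superset:
  assumes "finite A" "Poly_Mapping.keys v \<subseteq> A"
  shows "lin_ext f v = (\<Sum>a\<in>A. pscale (Poly_Mapping.lookup v a) (f a))"
  unfolding lin_ext_def
  by (rule sum.mono_neutral_left) (use assms in \<open>auto simp: in_keys_iff\<close>)

lemma is_linear_lin_ext [simp]:
  fixes f :: "'a \<Rightarrow> ('b \<Rightarrow>\<^sub>0 'k::field)"
  shows "is_linear (lin_ext f)"
proof (rule is_linearI)
  fix u v :: "'a \<Rightarrow>\<^sub>0 'k"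
  let ?A = "Poly_Mapping.keys u \<union> Poly_Mapping.keys v"
  have "lin_ext f (u + v) = (\<Sum>a\<in>?A. pscale (Poly_Mapping.lookup (u + v) a) (f a))"
    by (rule lin_ext_superset) (simp_all add: Poly_Mapping.keys_add)
  also have "\<dots> = lin_ext f u + lin_ext f v"
    by (simp add: lookup_add pm.scale_left_distrib sum.distrib lin_ext_superset[of ?A])
  finally show "lin_ext f (u + v) = lin_ext f u + lin_ext f v" .
next
  fix c and v :: "'a \<Rightarrow>\<^sub>0 'k"
  have "lin_ext f (pscale c v)
      = (\<Sum>a\<in>Poly_Mapping.keys v. pscale (Poly_Mapping.lookup (pscale c v) a) (f a))"
    by (rule lin_ext_superset) (auto simp: in_keys_iff lookup_pscale)
  then show "lin_ext f (pscale c v) = pscale c (lin_ext f v)"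
    by (simp add: lookup_pscale lin_ext_def pm.scale_sum_right)
qed

lemma lin_ext_bvec [simp]: "lin_ext f (bvec a) = f a"
  by (simp add: lin_ext_def)

lemma is_linear_expand: "v = (\<Sum>a\<in>Poly_Mapping.keys v. pscale (Poly_Mapping.lookup v a) (bvec a))"
proof (rule poly_mapping_eqI)
  fix k
  show "Poly_Mapping.lookup v k = Poly_Mapping.lookup
      (\<Sum>a\<in>Poly_Mapping.keys v. pscale (Poly_Mapping.lookup v a) (bvec a)) k"
    by (simp add: lookup_sum lookup_single when_def sum.delta in_keys_iff)
qed

lemma subspace_span_on: "pm.subspace (span_on B)"
  by (auto simp: pm.subspace_def span_on_def in_keys_iff lookup_add lookup_pscale subset_iff)
    (metis add_0)

lemma bvec_in_span_on [simp]: "bvec a \<in> span_on B \<longleftrightarrow> a \<in> B"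
  by (simp add: span_on_def)

lemma span_on_eq_span: "(span_on B :: ('a \<Rightarrow>\<^sub>0 'k::field) set) = pm.span (bvec ` B)"
proof
  show "(span_on B :: ('a \<Rightarrow>\<^sub>0 'k::field) set) \<subseteq> pm.span (bvec ` B)"
  proof
    fix v :: "'a \<Rightarrow>\<^sub>0 'k" assume v: "v \<in> span_on B"
    show "v \<in> pm.span (bvec ` B)"
      by (subst is_linear_expand[of v], rule pm.span_sum, rule pm.span_scale, rule pm.span_base)
        (use v in \<open>auto simp: span_on_def\<close>)
  qed
  show "pm.span (bvec ` B) \<subseteq> (span_on B :: ('a \<Rightarrow>\<^sub>0 'k::field) set)"
    by (rule pm.span_minimal) (auto simp: subspace_span_on)
qed

lemma span_on_0 [simp]: "0 \<in> span_on B"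
  by (simp add: span_on_def)

text \<open>A map out of k^m is represented by a map on the whole space whose values elsewhere carry
  no meaning, so agreement is asserted on \<open>span_on B\<close> only.\<close>

lemma linear_eq_span_on:
  assumes "is_linear f" "is_linear g" "v \<in> span_on B" "\<And>a. a \<in> B \<Longrightarrow> f (bvec a) = g (bvec a)"
  shows "f v = g v"
proof -
  have "f v = (\<Sum>a\<in>Poly_Mapping.keys v. pscale (Poly_Mapping.lookup v a) (f (bvec a)))"
    by (subst is_linear_expand[of v]) (simp only: is_linearD assms)
  also have "\<dots> = (\<Sum>a\<in>Poly_Mapping.keys v. pscale (Poly_Mapping.lookup v a) (g (bvec a)))"
    using assms(3,4) by (intro sum.cong) (auto simp: span_on_def)
  also have "\<dots> = g v"
    by (subst (3) is_linear_expand[of v]) (simp only: is_linearD assms)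
  finally show ?thesis .
qed

lemma linear_eqI:
  assumes "is_linear f" "is_linear g" "\<And>a. f (bvec a) = g (bvec a)"
  shows "f v = g v"
  by (rule linear_eq_span_on[OF assms(1,2), of v UNIV]) (auto simp: assms(3) span_on_def)

lemma linear_in_subspace:
  assumes "is_linear f" "pm.subspace S" "v \<in> span_on B" "\<And>a. a \<in> B \<Longrightarrow> f (bvec a) \<in> S"
  shows "f v \<in> S"
proof -
  have "f v = (\<Sum>a\<in>Poly_Mapping.keys v. pscale (Poly_Mapping.lookup v a) (f (bvec a)))"
    by (subst is_linear_expand[of v]) (simp only: is_linearD assms)
  also have "\<dots> \<in> S"
    by (rule pm.subspace_sum[OF assms(2)], rule pm.subspace_scale[OF assms(2)])
      (use assms(3,4) in \<open>auto simp: span_on_def\<close>)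
  finally show ?thesis .
qed

lemma linear_eq_span:
  assumes "is_linear f" "is_linear g" "v \<in> pm.span S" "\<And>a. a \<in> S \<Longrightarrow> f a = g a"
  shows "f v = g v"
  using assms(3)
proof (induction rule: pm.span_induct_alt)
  case base
  then show ?case using assms by (simp add: is_linearD)
next
  case (step c x y)
  then show ?case using assms(4) by (simp add: is_linearD assms(1,2))
qed

lemma subspace_vimage: "is_linear f \<Longrightarrow> pm.subspace S \<Longrightarrow> pm.subspace {v. f v \<in> S}"
  by (auto simp: pm.subspace_def is_linearD)

lemma subspace_equalizer: "is_linear f \<Longrightarrow> is_linear g \<Longrightarrow> pm.subspace {v. f v = g v}"
  by (auto simp: pm.subspace_def is_linearD)

lemma subspace_image: "is_linear f \<Longrightarrow> pm.subspace S \<Longrightarrow> pm.subspace (f ` S)"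
  by (auto simp: pm.subspace_def image_iff is_linear_zeroD)
    (metis is_linear_addD is_linear_scaleD is_linear_zeroD)+

lemma span_image_linear:
  assumes "is_linear f"
  shows "pm.span (f ` S) = f ` pm.span S"
proof
  show "pm.span (f ` S) \<subseteq> f ` pm.span S"
    by (rule pm.span_minimal) (auto intro: pm.span_base subspace_image[OF assms])
  have "v \<in> {v. f v \<in> pm.span (f ` S)}" if "v \<in> pm.span S" for v
    using that
    by (rule pm.span_induct) (auto intro: pm.span_base subspace_vimage[OF assms, unfolded mem_Collect_eq])
  then show "f ` pm.span S \<subseteq> pm.span (f ` S)" by auto
qed

lemma independent_bvec: "\<not> pm.dependent (bvec ` B :: ('a \<Rightarrow>\<^sub>0 'k::field) set)"
proof
  assume "pm.dependent (bvec ` B :: ('a \<Rightarrow>\<^sub>0 'k::field) set)"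
  then obtain a where a: "a \<in> B" "(bvec a :: 'a \<Rightarrow>\<^sub>0 'k) \<in> pm.span (bvec ` B - {bvec a})"
    by (auto simp: pm.dependent_def)
  have "(bvec ` B - {bvec a} :: ('a \<Rightarrow>\<^sub>0 'k) set) \<subseteq> bvec ` (B - {a})" by auto
  then have "(bvec a :: 'a \<Rightarrow>\<^sub>0 'k) \<in> span_on (B - {a})"
    using a(2) pm.span_mono unfolding span_on_eq_span by blast
  then show False by simp
qed

lemma inj_bvec: "inj (bvec :: 'a \<Rightarrow> ('a \<Rightarrow>\<^sub>0 'k::field))"
  by (rule injI) (metis lookup_single_eq lookup_single_not_eq zero_neq_one)

lemma dim_span_on: "finite B \<Longrightarrow> pm.dim (span_on B :: ('a \<Rightarrow>\<^sub>0 'k::field) set) = card B"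
  unfolding span_on_eq_span
  by (subst pm.dim_span_eq_card_independent)
    (auto simp: independent_bvec card_image inj_on_subset[OF inj_bvec])

lemma finite_independent_span_on:
  assumes "finite B" "S \<subseteq> span_on B" "\<not> pm.dependent S"
  shows "finite S"
  using pm.independent_span_bound[of "bvec ` B" S] assms unfolding span_on_eq_span by auto

subsection \<open>Tensors and slices\<close>

lemma lookup_tens [simp]:
  "Poly_Mapping.lookup (tens u v) (a, b) = Poly_Mapping.lookup u a * Poly_Mapping.lookup v b"
proof -
  have "Poly_Mapping.lookup (tens u v) (a, b) = (\<Sum>x\<in>Poly_Mapping.keys u. \<Sum>y\<in>Poly_Mapping.keys v.
      if y = b then if x = a then Poly_Mapping.lookup u x * Poly_Mapping.lookup v y else 0 else 0)"
    unfolding tens_def lookup_sum lookup_single when_def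
    by (intro sum.cong refl) auto
  also have "\<dots> = (\<Sum>x\<in>Poly_Mapping.keys u. if x = a then Poly_Mapping.lookup u x * Poly_Mapping.lookup v b else 0)"
    by (intro sum.cong refl) (auto simp: in_keys_iff)
  also have "\<dots> = Poly_Mapping.lookup u a * Poly_Mapping.lookup v b"
    by (auto simp: in_keys_iff)
  finally show ?thesis .
qed

lemma pair_poly_mapping_eqI:
  "(\<And>a b. Poly_Mapping.lookup f (a, b) = Poly_Mapping.lookup g (a, b)) \<Longrightarrow> f = g"
  by (rule poly_mapping_eqI) auto

lemma tens_bvec [simp]: "tens (bvec a) (bvec b) = bvec (a, b)"
  by (rule pair_poly_mapping_eqI) (auto simp: lookup_single when_def)

lemma is_linear_tens_left: "is_linear (\<lambda>u. tens u v)"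
  and is_linear_tens_right: "is_linear (tens u)"
  by (auto intro!: is_linearI pair_poly_mapping_eqI simp: lookup_add lookup_pscale algebra_simps)

text \<open>Contraction of the second factor with the coordinate functional of \<open>b\<close>.
  Slices determine a tensor, so an equation between tensors becomes a family of equations in the
  first factor.\<close>

definition slice :: "'b \<Rightarrow> ('a \<times> 'b \<Rightarrow>\<^sub>0 'k::field) \<Rightarrow> ('a \<Rightarrow>\<^sub>0 'k)" where
  "slice b w = Poly_Mapping.map_key (\<lambda>a. (a, b)) w"

lemma lookup_slice [simp]: "Poly_Mapping.lookup (slice b w) a = Poly_Mapping.lookup w (a, b)"
  by (simp add: slice_def Poly_Mapping.map_key.rep_eq inj_def)

lemma is_linear_slice [simp]: "is_linear (slice b)"
  by (auto intro!: is_linearI poly_mapping_eqI simp: lookup_add lookup_pscale)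

lemma slice_eqI: "(\<And>b. slice b v = slice b w) \<Longrightarrow> v = w"
  by (rule pair_poly_mapping_eqI) (metis lookup_slice)

lemma slice_tens [simp]: "slice b (tens u v) = pscale (Poly_Mapping.lookup v b) u"
  by (rule poly_mapping_eqI) (simp add: lookup_pscale)

lemma slice_bvec [simp]: "slice b (bvec (a, c)) = (if b = c then bvec a else 0)"
  by (rule poly_mapping_eqI) (auto simp: lookup_single when_def)

lemma is_linear_tens_map [simp]: "is_linear (tens_map f g)"
  unfolding tens_map_def by simp

lemma tens_map_bvec [simp]: "tens_map f g (bvec (a, b)) = tens (f (bvec a)) (g (bvec b))"
  unfolding tens_map_def by simp

lemma slice_tens_map:
  assumes "is_linear f"
  shows "slice b (tens_map f id w) = f (slice b w)"
  by (rule linear_eqI[where f = "\<lambda>w. slice b (tens_map f id w)" and g = "\<lambda>w. f (slice b w)"])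
    (auto intro!: is_linear_compose[OF is_linear_slice] is_linear_compose[OF assms] assms
      simp: is_linearD[OF assms] lookup_single when_def split: prod.splits)

lemma span_on_prod_iff:
  "w \<in> span_on (A \<times> B) \<longleftrightarrow> (\<forall>b. slice b w \<in> span_on A) \<and> (\<forall>b. b \<notin> B \<longrightarrow> slice b w = 0)"
proof -
  have "slice b w = 0 \<longleftrightarrow> (\<forall>a. Poly_Mapping.lookup w (a, b) = 0)" for b
    by (metis lookup_slice lookup_zero poly_mapping_eqI)
  then show ?thesis
    by (auto simp: span_on_def subset_iff in_keys_iff)
qed

lemma slice_tens_assoc:
  "slice (b, c) (tens_assoc w) = slice b (slice c w)"
  unfolding tens_assoc_def
  by (rule linear_eqI[where f = "\<lambda>w. slice (b, c) (lin_ext (\<lambda>((a, b), c). bvec (a, b, c)) w)"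
        and g = "\<lambda>w. slice b (slice c w)"])
    (auto intro!: is_linear_compose[OF is_linear_slice] simp: is_linearD split: prod.splits)

section \<open>The comodule axioms as relations between coefficient operators\<close>

section \<open>Components of a coaction\<close>

text \<open>The action on the comodule of the coordinate functional of the path \<open>p\<close>.
  Below, E(i, l) stands for \<open>coact_at M (i, l)\<close>.\<close>

definition coact_at :: "'k::field comodule \<Rightarrow> path \<Rightarrow> (nat \<Rightarrow>\<^sub>0 'k) \<Rightarrow> (nat \<Rightarrow>\<^sub>0 'k)" where
  "coact_at M p v = slice p (coact M v)"

lemma lookup_comult:
  "Poly_Mapping.lookup (comult n (bvec (i, l))) ((j, m), (i', l'))
    = (if i' = i \<and> l' \<le> l \<and> m = l - l' \<and> j = (i + l') mod n then 1 else 0)"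
proof -
  have "Poly_Mapping.lookup (comult n (bvec (i, l))) ((j, m), (i', l'))
    = (\<Sum>k\<le>l. if k = l' then if i' = i \<and> m = l - l' \<and> j = (i + l') mod n then 1 else 0 else 0)"
    unfolding comult_def lin_ext_bvec prod.case tens_bvec lookup_sum lookup_single when_def
    by (intro sum.cong refl) auto
  also have "\<dots> = (if i' = i \<and> l' \<le> l \<and> m = l - l' \<and> j = (i + l') mod n then 1 else 0)"
    by (simp add: sum.delta)
  finally show ?thesis .
qed

text \<open>Two paths occur together in a comultiplication only if they are composable, and then
  only in that of their composite, which starts at \<open>i\<close> and has length
  \<open>l + m\<close>. So a single slice of \<open>w\<close> survives. For \<open>i \<ge> n\<close>
  there is no such path and that slice is zero by the assumption on \<open>w\<close>.\<close>

lemma slice_tens_map_comult: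
  assumes "w \<in> span_on (UNIV \<times> paths n)"
  shows "slice ((j, m), (i, l)) (tens_map id (comult n) w)
    = (if i < n \<and> j = (i + l) mod n then slice (i, l + m) w else 0)"
proof -
  have "slice ((j, m), (i, l)) (tens_map id (comult n) w)
    = (if j = (i + l) mod n then slice (i, l + m) w else 0)"
  proof (rule linear_eqI[where f = "\<lambda>w. slice ((j, m), (i, l)) (tens_map id (comult n) w)"])
    show "is_linear (\<lambda>w. slice ((j, m), (i, l)) (tens_map id (comult n) w))"
      by (intro is_linear_compose[OF is_linear_slice]) simp
    show "is_linear (\<lambda>w. if j = (i + l) mod n then slice (i, l + m) w else 0)"
      by (intro is_linear_if) simp_all
    fix x :: "'a \<times> path"
    obtain a i' l' where x: "x = (a, (i', l'))" by (metis surj_pair)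
    show "slice ((j, m), i, l) (tens_map id (comult n) (bvec x))
        = (if j = (i + l) mod n then slice (i, l + m) (bvec x) else 0)"
      unfolding x tens_map_bvec slice_tens id_apply lookup_comult slice_bvec by (auto simp del: One_nat_def)
  qed
  moreover have "slice (i, l + m) w = 0" if "\<not> i < n"
    using assms that unfolding span_on_prod_iff paths_def by simp
  ultimately show ?thesis by (cases "i < n") (simp_all only: simp_thms if_cancel)
qed

lemma id_tens_counit_eq:
  assumes "w \<in> span_on (UNIV \<times> paths n)"
  shows "id_tens_counit w = (\<Sum>i<n. slice (i, 0) w)"
  unfolding id_tens_counit_def
  by (rule linear_eq_span_on[OF _ _ assms, of "lin_ext (\<lambda>(a, p). pscale (counit (bvec p)) (bvec a))"
        "\<lambda>w. \<Sum>i<n. slice (i, 0) w"])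
    (auto intro!: is_linear_sum simp: counit_def paths_def sum.delta split: prod.splits)

text \<open>Coassociativity becomes E(j, m) E(i, l) = E(i, l + m) if j = i + l modulo n, and 0
  otherwise; counitality says that the E(i, 0) with i < n add up to the identity. In particular the
  E(i, 0) are orthogonal idempotents, which gives the grading.\<close>

lemma is_comodule_iff:
  "is_comodule n M \<longleftrightarrow> is_linear (coact M) \<and> (\<forall>v\<in>cspace M.
     (\<forall>p. coact_at M p v \<in> cspace M) \<and> (\<forall>p. p \<notin> paths n \<longrightarrow> coact_at M p v = 0) \<and>
     (\<forall>i l j m. coact_at M (j, m) (coact_at M (i, l) v) =
        (if i < n \<and> j = (i + l) mod n then coact_at M (i, l + m) v else 0)) \<and>
     (\<Sum>i<n. coact_at M (i, 0) v) = v)"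
proof (cases "is_linear (coact M)")
  case True
  have *: "(coact M v \<in> span_on ({..<cdim M} \<times> paths n) \<and>
        tens_assoc (tens_map (coact M) id (coact M v)) = tens_map id (comult n) (coact M v) \<and>
        id_tens_counit (coact M v) = v) \<longleftrightarrow> 
     (\<forall>p. coact_at M p v \<in> cspace M) \<and> (\<forall>p. p \<notin> paths n \<longrightarrow> coact_at M p v = 0) \<and>
     (\<forall>i l j m. coact_at M (j, m) (coact_at M (i, l) v) =
        (if i < n \<and> j = (i + l) mod n then coact_at M (i, l + m) v else 0)) \<and>
     (\<Sum>i<n. coact_at M (i, 0) v) = v" for v
  proof (cases "coact M v \<in> span_on ({..<cdim M} \<times> paths n)")
    case T: True
    then have u: "coact M v \<in> span_on (UNIV \<times> paths n)"
      by (auto simp: span_on_def)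
    have c1: "tens_assoc (tens_map (coact M) id (coact M v)) = tens_map id (comult n) (coact M v)
      \<longleftrightarrow> (\<forall>i l j m. coact_at M (j, m) (coact_at M (i, l) v) =
        (if i < n \<and> j = (i + l) mod n then coact_at M (i, l + m) v else 0))"
      (is "?l \<longleftrightarrow> ?r")
    proof
      assume ?l
      then have "slice ((j,m),(i,l)) (tens_assoc (tens_map (coact M) id (coact M v))) =
        slice ((j,m),(i,l)) (tens_map id (comult n) (coact M v))" for i j m l by simp
      then show ?r
        by (simp only: slice_tens_assoc slice_tens_map[OF True] slice_tens_map_comult[OF u] coact_at_def)
          simp
    next
      assume ?r
      show ?l
      proof (rule slice_eqI)
        fix b :: "path \<times> path"
        obtain j m i l where b: "b = ((j,m),(i,l))" by (metis surj_pair)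
        show "slice b (tens_assoc (tens_map (coact M) id (coact M v))) = slice b (tens_map id (comult n) (coact M v))"
          unfolding b slice_tens_assoc slice_tens_map[OF True] slice_tens_map_comult[OF u]
          using \<open>?r\<close> by (simp add: coact_at_def)
      qed
    qed
    have c2: "\<forall>p. coact_at M p v \<in> cspace M" "\<forall>p. p \<notin> paths n \<longrightarrow> coact_at M p v = 0"
      using T unfolding span_on_prod_iff coact_at_def cspace_def by blast+
    have c3: "id_tens_counit (coact M v) = (\<Sum>i<n. coact_at M (i, 0) v)"
      by (simp add: id_tens_counit_eq[OF u] coact_at_def)
    show ?thesis
      by (simp only: c1 c3 T eqTrueI[OF c2(1)] eqTrueI[OF c2(2)] simp_thms)
  next
    case False
    then have "\<not> ((\<forall>p. coact_at M p v \<in> cspace M) \<and> (\<forall>p. p \<notin> paths n \<longrightarrow> coact_at M p v = 0))"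
      unfolding span_on_prod_iff coact_at_def cspace_def by blast
    with False show ?thesis by blast
  qed
  show ?thesis unfolding is_comodule_def by (rule arg_cong2[where f = "(\<and>)", OF refl ball_cong[OF refl *]])
qed (simp add: is_comodule_def)

lemma comodule_iso_iff:
  "comodule_iso M N \<longleftrightarrow> (\<exists>f. is_linear f \<and> bij_betw f (cspace M) (cspace N) \<and>
     (\<forall>v\<in>cspace M. \<forall>p. f (coact_at M p v) = coact_at N p (f v)))"
proof -
  have *: "tens_map f id (coact M v) = coact N (f v) \<longleftrightarrow> (\<forall>p. f (coact_at M p v) = coact_at N p (f v))"
    (is "?l \<longleftrightarrow> ?r") if f: "is_linear f" for f v
  proof
    assume ?l
    then show ?r
      unfolding coact_at_def slice_tens_map[OF f, symmetric] by simp
  next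
    assume r: ?r
    show ?l
    proof (rule slice_eqI)
      fix p show "slice p (tens_map f id (coact M v)) = slice p (coact N (f v))"
        using r[THEN spec, of p] unfolding coact_at_def slice_tens_map[OF f] .
    qed
  qed
  show ?thesis unfolding comodule_iso_def
  proof (rule iff_exI)
    fix f
    show "(is_linear f \<and> bij_betw f (cspace M) (cspace N) \<and>
          (\<forall>v\<in>cspace M. tens_map f id (coact M v) = coact N (f v))) \<longleftrightarrow>
      (is_linear f \<and> bij_betw f (cspace M) (cspace N) \<and>
     (\<forall>v\<in>cspace M. \<forall>p. f (coact_at M p v) = coact_at N p (f v)))"
    proof (cases "is_linear f")
      case True
      show ?thesis by (simp only: *[OF True])
    next
      case False
      then show ?thesis by (simp only: simp_thms)
    qed
  qed
qed

lemma is_linear_coact_at: "is_linear (coact M) \<Longrightarrow> is_linear (coact_at M p)"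
  unfolding coact_at_def by (rule is_linear_compose[OF is_linear_slice])

section \<open>The q-Pascal recursion and Gaussian binomials at roots of unity\<close>

section \<open>Gaussian binomial coefficients\<close>

text \<open>The q-Pascal recursion produces the Gaussian polynomials without division, so they can
  be evaluated at a root of unity.\<close>

fun gauss_poly :: "nat \<Rightarrow> nat \<Rightarrow> 'k::field poly" where
  "gauss_poly 0 m = 1"
| "gauss_poly (Suc l) 0 = 1"
| "gauss_poly (Suc l) (Suc m) = gauss_poly l (Suc m) + monom 1 (Suc l) * gauss_poly (Suc l) m"

lemma gauss_poly_0_right [simp]: "gauss_poly l 0 = 1"
  by (cases l) simp_all

lemma q_int_add: "q_int (l + m) = q_int l + monom 1 l * q_int m"
  by (induction m) (simp_all add: q_int_def algebra_simps mult_monom)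

lemma q_fact_0 [simp]: "q_fact 0 = 1"
  and q_fact_Suc: "q_fact (Suc l) = q_fact l * q_int (Suc l)"
  by (simp_all add: q_fact_def)

text \<open>Splitting the top factor (l + m + 2)_q of the factorial as (l + 1)_q + q^(l + 1) (m +
  1)_q turns the two induction hypotheses into the two terms of the recursion.\<close>

lemma q_fact_add: "q_fact (l + m) = gauss_poly l m * (q_fact l * q_fact m)"
proof (induction l m rule: gauss_poly.induct)
  case (3 l m)
  have "q_fact (Suc l + Suc m) = q_fact (l + Suc m) * (q_int (Suc l + Suc m) :: 'a poly)"
    by (simp add: q_fact_Suc)
  also have "\<dots> = q_fact (l + Suc m) * q_int (Suc l) + monom 1 (Suc l) * q_fact (Suc l + m) * q_int (Suc m)"
    unfolding q_int_add[of "Suc l" "Suc m"] by (simp add: algebra_simps)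
  also have "\<dots> = gauss_poly (Suc l) (Suc m) * (q_fact (Suc l) * q_fact (Suc m))"
    unfolding 3 by (simp add: q_fact_Suc algebra_simps)
  finally show ?case .
qed simp_all

lemma q_int_nonzero: "l > 0 \<Longrightarrow> q_int l \<noteq> (0 :: 'k::field poly)"
proof -
  assume "l > 0"
  then have "coeff (q_int l :: 'k poly) 0 = 1"
    by (simp add: q_int_def coeff_sum)
  then show ?thesis by auto
qed

lemma q_fact_nonzero: "q_fact l \<noteq> (0 :: 'k::field poly)"
  by (induction l) (simp_all add: q_fact_Suc q_int_nonzero)

lemma gauss_binom_eq: "gauss_binom l m q = poly (gauss_poly l m) q"
  by (simp add: gauss_binom_def q_fact_add q_fact_nonzero)

lemma gauss_binom_0_left [simp]: "gauss_binom 0 m q = 1"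
  and gauss_binom_0_right [simp]: "gauss_binom l 0 q = 1"
  by (simp_all add: gauss_binom_eq)

lemma gauss_binom_Suc_Suc:
  "gauss_binom (Suc l) (Suc m) q = gauss_binom l (Suc m) q + q ^ Suc l * gauss_binom (Suc l) m q"
  by (simp add: gauss_binom_eq poly_monom)

lemma gauss_binom_1_left: "gauss_binom 1 m q = poly (q_int (Suc m)) q"
proof (induction m)
  case (Suc m)
  have "q_int (Suc (Suc m)) = 1 + monom 1 1 * (q_int (Suc m) :: 'a poly)"
    using q_int_add[of 1 "Suc m"] by (simp add: q_int_def)
  with Suc show ?case
    using gauss_binom_Suc_Suc[of 0 m q] by (simp add: poly_monom)
qed (simp add: q_int_def)

lemma poly_q_int: "poly (q_int l) q = (\<Sum>i<l. q ^ i)"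
  by (simp add: q_int_def poly_sum poly_monom)

lemma poly_q_int_add: "poly (q_int (l + m)) q = poly (q_int l) q + q ^ l * poly (q_int m) q"
  by (simp add: q_int_add poly_monom)

text \<open>Separates off the factor (d)_q, which vanishes at a root of unity of order d > 1; the
  cofactor takes the value c there.\<close>

lemma q_int_mult: "q_int (c * d) = q_int d * (\<Sum>j<c. monom 1 (d * j) :: 'k::field poly)"
proof (induction c)
  case (Suc c)
  then show ?case
    using q_int_add[of "c * d" d, where 'a = 'k] by (simp add: algebra_simps)
qed (simp add: q_int_def)

text \<open>Cancelling m!_q leaves the factors (m + 1)_q, ..., (m + l)_q. For l = d and m = c d,
  exactly the last of them vanishes at a root of unity of order d > 1.\<close>

lemma gauss_poly_mult_q_fact:
  "gauss_poly l m * q_fact l = (\<Prod>i=1..l. q_int (m + i) :: 'k::field poly)"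
proof -
  have "q_fact (m + l) = q_fact m * (\<Prod>i=1..l. q_int (m + i) :: 'k poly)" for l
    by (induction l) (simp_all add: q_fact_Suc)
  moreover have "gauss_poly l m * q_fact l * q_fact m = (q_fact (m + l) :: 'k poly)"
    using q_fact_add[of l m, where 'a = 'k] by (simp add: add.commute mult_ac)
  ultimately have "gauss_poly l m * q_fact l * q_fact m = (\<Prod>i=1..l. q_int (m + i) :: 'k poly) * q_fact m"
    by (simp only: mult.commute)
  then show ?thesis using q_fact_nonzero[of m, where 'k = 'k] by simp
qed

text \<open>
  A special case of the \<open>q\<close>-Lucas theorem. The factor \<open>q_int d\<close>, which vanishes at \<open>q\<close>, is cancelled
  as a polynomial before evaluating.
\<close>

lemma gauss_binom_root:
  fixes q :: "'k::field"
  assumes d: "d > 0" "q ^ d = 1" "q \<noteq> 1" and nz: "\<And>i. 0 < i \<Longrightarrow> i < d \<Longrightarrow> poly (q_int i) q \<noteq> 0"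
  shows "gauss_binom d (c * d) q = of_nat (Suc c)"
proof -
  obtain d' where d': "d = Suc d'" using d by (cases d) auto
  let ?s = "\<Sum>j<Suc c. monom 1 (d * j) :: 'k poly"
  have fact: "q_fact d = q_fact d' * (q_int d :: 'k poly)"
    by (simp add: d' q_fact_Suc)
  have "gauss_poly d (c * d) * q_fact d' * q_int d = (\<Prod>i=1..d. q_int (c * d + i) :: 'k poly)"
    using gauss_poly_mult_q_fact[of d "c * d", where 'k = 'k] unfolding fact by (simp add: mult_ac)
  also have "\<dots> = (\<Prod>i=1..d'. q_int (c * d + i)) * q_int (Suc c * d)"
    by (simp add: d' algebra_simps)
  also have "\<dots> = (\<Prod>i=1..d'. q_int (c * d + i)) * ?s * q_int d"
    unfolding q_int_mult by (simp only: mult_ac)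
  finally have "gauss_poly d (c * d) * q_fact d' = (\<Prod>i=1..d'. q_int (c * d + i)) * ?s"
    using q_int_nonzero[of d, where 'k = 'k] d by simp
  then have "poly (gauss_poly d (c * d) * q_fact d') q = poly ((\<Prod>i=1..d'. q_int (c * d + i)) * ?s) q"
    by simp
  then have "gauss_binom d (c * d) q * poly (q_fact d') q
      = (\<Prod>i=1..d'. poly (q_int (c * d + i)) q) * poly ?s q"
    by (simp only: gauss_binom_eq poly_mult poly_prod)
  also have "poly ?s q = of_nat (Suc c)"
    by (simp only: poly_sum poly_monom power_mult d(2) power_one) simp
  \<comment> \<open>Since q^d = 1 and (c d)_q = 0, the q-integers are periodic with period d, so the
    remaining factors are those of (d - 1)!_q.\<close>
  also have "(\<Prod>i=1..d'. poly (q_int (c * d + i)) q) = poly (q_fact d') q"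
  proof -
    have "poly (q_int d) q = 0"
      using power_diff_1_eq[of q d] d by (simp add: poly_q_int)
    then have "poly (q_int (c * d)) q = 0"
      by (simp add: q_int_mult)
    then have "poly (q_int (c * d + i)) q = poly (q_int i) q" for i
      using poly_q_int_add[of "c * d" i q] d(2) by (simp add: mult.commute[of c d] power_mult)
    then show ?thesis by (simp add: q_fact_def poly_prod)
  qed
  finally show ?thesis
  proof -
    have "poly (q_fact d') q \<noteq> 0"
      using nz by (simp add: q_fact_def poly_prod d')
    moreover assume "gauss_binom d (c * d) q * poly (q_fact d') q = poly (q_fact d') q * of_nat (Suc c)"
    ultimately show ?thesis by (simp add: mult.commute)
  qed
qed

section \<open>Grading and nilpotent operator of a comodule\<close>

section \<open>Comodules as graded spaces with a shift operator\<close>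

text \<open>Summing over all start vertices gives one operator X for all degrees; on a homogeneous
  vector a single summand survives.\<close>

definition xop :: "nat \<Rightarrow> 'k::field comodule \<Rightarrow> (nat \<Rightarrow>\<^sub>0 'k) \<Rightarrow> (nat \<Rightarrow>\<^sub>0 'k)" where
  "xop n M v = (\<Sum>i<n. coact_at M (i, 1) v)"

text \<open>Degrees are natural numbers, and in a comodule the zero vector has every degree. For
  \<open>i \<ge> n\<close> it is the only vector of degree i, which is why several proofs below
  treat that case separately.\<close>

definition hmg :: "'k::field comodule \<Rightarrow> nat \<Rightarrow> (nat \<Rightarrow>\<^sub>0 'k) \<Rightarrow> bool" where
  "hmg M i v \<longleftrightarrow> v \<in> cspace M \<and> coact_at M (i, 0) v = v"

lemma subspace_cspace: "pm.subspace (cspace M)"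
  unfolding cspace_def by (rule subspace_span_on)

lemma hmg_cspace: "hmg M i v \<Longrightarrow> v \<in> cspace M"
  by (simp add: hmg_def)

locale comodule =
  fixes n :: nat and M :: "'k::field comodule"
  assumes is_com: "is_comodule n M"
begin

lemma linear_coact: "is_linear (coact M)"
  using is_com by (simp add: is_comodule_iff)

lemma linear_coact_at: "is_linear (coact_at M p)"
  by (rule is_linear_coact_at[OF linear_coact])

lemma coact_at_in: "v \<in> cspace M \<Longrightarrow> coact_at M p v \<in> cspace M"
  using is_com unfolding is_comodule_iff by blast

lemma coact_at_outside: "v \<in> cspace M \<Longrightarrow> p \<notin> paths n \<Longrightarrow> coact_at M p v = 0"
  using is_com unfolding is_comodule_iff by blast

lemma coact_at_coact_at: "v \<in> cspace M \<Longrightarrow> coact_at M (j, m) (coact_at M (i, l) v) =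
    (if i < n \<and> j = (i + l) mod n then coact_at M (i, l + m) v else 0)"
  using is_com unfolding is_comodule_iff by blast

lemma sum_coact_at: "v \<in> cspace M \<Longrightarrow> (\<Sum>i<n. coact_at M (i, 0) v) = v"
  using is_com unfolding is_comodule_iff by blast

lemma linear_xop: "is_linear (xop n M)"
  unfolding xop_def by (rule is_linear_sum) (rule linear_coact_at)

lemma linear_xop_pow: "is_linear (xop n M ^^ l)"
  by (rule is_linear_funpow[OF linear_xop])

lemma xop_in: "v \<in> cspace M \<Longrightarrow> xop n M v \<in> cspace M"
  unfolding xop_def by (rule pm.subspace_sum[OF subspace_cspace]) (rule coact_at_in)

lemma hmg_coact_at: "v \<in> cspace M \<Longrightarrow> i < n \<Longrightarrow> hmg M ((i + l) mod n) (coact_at M (i, l) v)"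
  by (simp add: hmg_def coact_at_in coact_at_coact_at)

lemma hmg_eq_0: "hmg M i v \<Longrightarrow> \<not> i < n \<Longrightarrow> v = 0"
  using coact_at_outside[of v "(i, 0)"] by (simp add: hmg_def paths_def)

lemma coact_at_hmg_0: "hmg M i v \<Longrightarrow> j \<noteq> i \<Longrightarrow> coact_at M (j, l) v = 0"
  using coact_at_coact_at[of v j l i 0] by (auto simp: hmg_def split: if_splits)

lemma xop_hmg: "hmg M i v \<Longrightarrow> xop n M v = coact_at M (i, 1) v"
proof -
  assume v: "hmg M i v"
  have "xop n M v = (\<Sum>j<n. if j = i then coact_at M (i, 1) v else 0)"
    unfolding xop_def using coact_at_hmg_0[OF v] by (intro sum.cong) auto
  also have "\<dots> = coact_at M (i, 1) v"
    using hmg_eq_0[OF v] by (auto simp: is_linear_zeroD[OF linear_coact_at])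
  finally show ?thesis .
qed

lemma hmg_zero [simp]: "hmg M i 0"
  by (simp add: hmg_def is_linear_zeroD[OF linear_coact_at] cspace_def)

text \<open>On degree i, X^(l + 1) is E(i + l, 1) E(i, l), which composes to E(i, l + 1). Hence the
  grading and X determine the whole coaction.\<close>

lemma coact_at_hmg: "hmg M i v \<Longrightarrow> coact_at M (i, l) v = (xop n M ^^ l) v"
proof (induction l)
  case 0
  then show ?case by (simp add: hmg_def)
next
  case (Suc l)
  show ?case
  proof (cases "i < n")
    case True
    have "(xop n M ^^ Suc l) v = xop n M (coact_at M (i, l) v)"
      using Suc by simp
    also have "\<dots> = coact_at M ((i + l) mod n, 1) (coact_at M (i, l) v)"
      by (rule xop_hmg[OF hmg_coact_at[OF hmg_cspace[OF Suc(2)] True]])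
    also have "\<dots> = coact_at M (i, Suc l) v"
      using Suc(2) True by (simp add: coact_at_coact_at hmg_cspace)
    finally show ?thesis by simp
  next
    case False
    then show ?thesis using hmg_eq_0[OF Suc(2)]
      by (simp add: is_linear_zeroD[OF linear_xop_pow] is_linear_zeroD[OF linear_coact_at]
        is_linear_zeroD[OF linear_xop] del: funpow.simps)
  qed
qed

lemma hmg_xop_pow: "hmg M i v \<Longrightarrow> hmg M ((i + l) mod n) ((xop n M ^^ l) v)"
proof (cases "i < n")
  case True
  assume v: "hmg M i v"
  show ?thesis
    using hmg_coact_at[OF hmg_cspace[OF v] True, of l] by (simp only: coact_at_hmg[OF v])
next
  case False
  assume "hmg M i v"
  with False have "v = 0" by (simp add: hmg_eq_0)
  then show ?thesis by (simp add: is_linear_zeroD[OF linear_xop_pow])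
qed

lemma hmg_xop: "hmg M i v \<Longrightarrow> hmg M (Suc i mod n) (xop n M v)"
  using hmg_xop_pow[of i v 1] by simp

lemma xop_pow_in: "v \<in> cspace M \<Longrightarrow> (xop n M ^^ l) v \<in> cspace M"
  by (induction l) (simp_all add: xop_in)

lemma coact_at_eq: "v \<in> cspace M \<Longrightarrow> coact_at M (i, l) v = (xop n M ^^ l) (coact_at M (i, 0) v)"
proof (cases "i < n")
  case True
  assume v: "v \<in> cspace M"
  have "coact_at M (i, l) v = coact_at M (i, l) (coact_at M (i, 0) v)"
    using True v by (simp add: coact_at_coact_at)
  also have "\<dots> = (xop n M ^^ l) (coact_at M (i, 0) v)"
    using hmg_coact_at[OF v True, of 0] True by (intro coact_at_hmg) simp
  finally show ?thesis .
next
  case False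
  assume v: "v \<in> cspace M"
  with False show ?thesis
    by (simp add: coact_at_outside paths_def is_linear_zeroD[OF linear_xop_pow])
qed

lemma xop_pow_eq: "v \<in> cspace M \<Longrightarrow> (xop n M ^^ l) v = (\<Sum>i<n. coact_at M (i, l) v)"
proof -
  assume v: "v \<in> cspace M"
  have "(xop n M ^^ l) v = (xop n M ^^ l) (\<Sum>i<n. coact_at M (i, 0) v)"
    using v by (simp add: sum_coact_at)
  also have "\<dots> = (\<Sum>i<n. coact_at M (i, l) v)"
    using coact_at_eq[OF v, of _ l] by (simp add: is_linear_sumD[OF linear_xop_pow])
  finally show ?thesis .
qed

lemma in_span_hmg: "v \<in> cspace M \<Longrightarrow> v \<in> pm.span {u. \<exists>i<n. hmg M i u}"
proof -
  assume v: "v \<in> cspace M"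
  have "(\<Sum>i<n. coact_at M (i, 0) v) \<in> pm.span {u. \<exists>i<n. hmg M i u}"
    using hmg_coact_at[OF v, of _ 0] by (intro pm.span_sum pm.span_base) auto
  then show ?thesis by (simp add: sum_coact_at[OF v])
qed

text \<open>The coaction of a single vector involves finitely many paths, whose lengths are bounded.
  The bound depends on \<open>v\<close>; a uniform one is obtained in
  \<open>bounded_length\<close>.\<close>

lemma nilpotent_at: "\<exists>L. \<forall>l\<ge>L. (xop n M ^^ l) v = 0" if v: "v \<in> cspace M"
proof -
  define K where "K = (\<lambda>(a, (i, l)). l) ` Poly_Mapping.keys (coact M v)"
  have "finite K" by (simp add: K_def)
  then obtain L where L: "\<forall>l\<in>K. l < L" by (meson finite_nat_set_iff_bounded)
  have "coact_at M (i, l) v = 0" if "L \<le> l" for i l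
  proof (rule poly_mapping_eqI)
    fix a
    have "(a, (i, l)) \<notin> Poly_Mapping.keys (coact M v)"
      using L that by (force simp: K_def)
    then show "Poly_Mapping.lookup (coact_at M (i, l) v) a = Poly_Mapping.lookup 0 a"
      by (simp add: coact_at_def in_keys_iff)
  qed
  then show ?thesis using xop_pow_eq[OF v] by (intro exI[of _ L]) simp
qed

lemma coact_hmg:
  assumes v: "hmg M i v" and L: "(xop n M ^^ L) v = 0"
  shows "coact M v = (\<Sum>l<L. tens ((xop n M ^^ l) v) (bvec (i, l)))"
proof (rule slice_eqI)
  fix p :: path
  obtain j m where p: "p = (j, m)" by (metis surj_pair)
  have "slice p (\<Sum>l<L. tens ((xop n M ^^ l) v) (bvec (i, l)))
      = (\<Sum>l<L. if l = m then (if i = j then (xop n M ^^ m) v else 0) else 0)"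
    unfolding is_linear_sumD[OF is_linear_slice] p
    by (intro sum.cong) (auto simp: lookup_single when_def)
  also have "\<dots> = (if i = j then (xop n M ^^ m) v else 0)"
  proof -
    have "(xop n M ^^ m) v = 0" if "L \<le> m"
    proof -
      have "(xop n M ^^ m) v = (xop n M ^^ (m - L)) ((xop n M ^^ L) v)"
        using that funpow_add[of "m - L" L "xop n M"] by simp
      then show ?thesis by (simp add: L is_linear_zeroD[OF linear_xop_pow])
    qed
    then show ?thesis by (auto simp: sum.delta)
  qed
  also have "\<dots> = slice p (coact M v)"
    using coact_at_hmg[OF v, of m] coact_at_hmg_0[OF v, of j m]
    by (auto simp: coact_at_def p)
  finally show "slice p (coact M v) = slice p (\<Sum>l<L. tens ((xop n M ^^ l) v) (bvec (i, l)))" ..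
qed

end

lemma is_linear_xop: "is_linear (coact M) \<Longrightarrow> is_linear (xop n M)"
  unfolding xop_def by (rule is_linear_sum) (rule is_linear_coact_at)

text \<open>It suffices to have generators \<open>S i\<close> on which the coefficients are the
  powers of X and which X carries into the span of the next degree. Direct sums, tensor products,
  the unit and the uniserial comodules are all recognized in this way.\<close>

lemma is_comoduleI:
  assumes lin: "is_linear (coact M)"
    and S_in: "\<And>i v. i < n \<Longrightarrow> v \<in> S i \<Longrightarrow> v \<in> cspace M"
    and S_coact: "\<And>i v j l. i < n \<Longrightarrow> v \<in> S i \<Longrightarrow>
      coact_at M (j, l) v = (if j = i then (xop n M ^^ l) v else 0)"
    and S_x: "\<And>i v. i < n \<Longrightarrow> v \<in> S i \<Longrightarrow> xop n M v \<in> pm.span (S (Suc i mod n))"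
    and span: "cspace M \<subseteq> pm.span (\<Union>i<n. S i)"
  shows "is_comodule n M" and "i < n \<Longrightarrow> v \<in> S i \<Longrightarrow> hmg M i v"
proof -
  have linE: "is_linear (coact_at M p)" for p by (rule is_linear_coact_at[OF lin])
  have linX: "is_linear (xop n M)" by (rule is_linear_xop[OF lin])
  have linXl: "is_linear (xop n M ^^ l)" for l by (rule is_linear_funpow[OF linX])
  have D_in: "pm.span (S i) \<subseteq> cspace M" if "i < n" for i
    by (rule pm.span_minimal[OF _ subspace_cspace]) (use S_in that in auto)
  have D_coact: "coact_at M (j, l) v = (if j = i then (xop n M ^^ l) v else 0)"
    if "i < n" "v \<in> pm.span (S i)" for i v j l
    by (rule linear_eq_span[OF linE _ that(2)])
      (use S_coact[OF that(1)] in \<open>auto intro!: is_linear_if linXl\<close>)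
  have D_x: "xop n M v \<in> pm.span (S (Suc i mod n))" if "i < n" "v \<in> pm.span (S i)" for i v
  proof -
    have "pm.span (S i) \<subseteq> {v. xop n M v \<in> pm.span (S (Suc i mod n))}"
      by (rule pm.span_minimal[OF _ subspace_vimage[OF linX]]) (use S_x that in auto)
    with that show ?thesis by auto
  qed
  have D_xl: "(xop n M ^^ l) v \<in> pm.span (S ((i + l) mod n))" if "i < n" "v \<in> pm.span (S i)" for i v l
  proof (induction l)
    case (Suc l)
    have "(i + l) mod n < n" using that(1) by simp
    from D_x[OF this Suc] show ?case by (simp add: mod_Suc_eq)
  qed (use that in simp)
  \<comment> \<open>Each axiom is an equation between linear maps or membership in the preimage of a
    subspace, so the vectors satisfying it form a subspace, and it spreads from the generators to
    \<open>cspace M\<close>.\<close>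
  have *: "v \<in> {v. P v}" if "v \<in> cspace M" "pm.subspace {v. P v}" "\<And>i v. i < n \<Longrightarrow> v \<in> S i \<Longrightarrow> P v"
    for v P
    using that span pm.span_minimal[of "\<Union>i<n. S i" "{v. P v}"] by blast
  show "is_comodule n M"
    unfolding is_comodule_iff
  proof (intro conjI ballI allI impI lin)
    fix v and p :: path assume v: "v \<in> cspace M"
    obtain j m where p: "p = (j, m)" by (metis surj_pair)
    have "coact_at M p w \<in> cspace M" if "i < n" "w \<in> S i" for i w
    proof (cases "j = i")
      case True
      have "(i + m) mod n < n" using \<open>i < n\<close> by simp
      then show ?thesis
        using D_xl[OF that(1) pm.span_base[OF that(2)], of m] D_in[OF \<open>(i + m) mod n < n\<close>] that True by (auto simp: p S_coact)
    qed (use that in \<open>auto simp: p S_coact cspace_def\<close>)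
    from *[OF v subspace_vimage[OF linE subspace_cspace] this] show "coact_at M p v \<in> cspace M" by simp
  next
    fix v p assume v: "v \<in> cspace M" and p: "p \<notin> paths n"
    have "coact_at M p w = 0" if "i < n" "w \<in> S i" for i w
      using S_coact[OF that, of "fst p" "snd p"] p that by (cases p) (auto simp: paths_def split: if_splits)
    from *[OF v subspace_equalizer[OF linE is_linear_const_zero] this] show "coact_at M p v = 0" by simp
  next
    fix v i l j m assume v: "v \<in> cspace M"
    have "coact_at M (j, m) (coact_at M (i, l) w) =
        (if i < n \<and> j = (i + l) mod n then coact_at M (i, l + m) w else 0)"
      if "i' < n" "w \<in> S i'" for i' w
    proof (cases "i = i'")
      case True
      have "(i' + l) mod n < n" using \<open>i' < n\<close> by simp
      note D = D_coact[OF this D_xl[OF that(1) pm.span_base[OF that(2)]], of j m]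
      show ?thesis
        using that True by (simp add: S_coact D funpow_add add.commute[of l m])
    next
      case False
      with that show ?thesis by (auto simp: S_coact is_linear_zeroD[OF linE])
    qed
    from *[OF v subspace_equalizer[OF is_linear_compose[OF linE linE] is_linear_if[OF linE is_linear_const_zero]] this]
    show "coact_at M (j, m) (coact_at M (i, l) v) =
        (if i < n \<and> j = (i + l) mod n then coact_at M (i, l + m) v else 0)" by simp
  next
    fix v assume v: "v \<in> cspace M"
    have "(\<Sum>i<n. coact_at M (i, 0) w) = w" if "i' < n" "w \<in> S i'" for i' w
      using that by (simp add: S_coact sum.delta)
    from *[OF v subspace_equalizer[OF is_linear_sum[OF linE] is_linear_id(2)] this]
    show "(\<Sum>i<n. coact_at M (i, 0) v) = v" by simp
  qed
  show "i < n \<Longrightarrow> v \<in> S i \<Longrightarrow> hmg M i v"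
    by (simp add: hmg_def S_coact S_in)
qed

definition chom :: "'k::field comodule \<Rightarrow> 'k comodule \<Rightarrow> ((nat \<Rightarrow>\<^sub>0 'k) \<Rightarrow> (nat \<Rightarrow>\<^sub>0 'k)) \<Rightarrow> bool" where
  "chom M N f \<longleftrightarrow> is_linear f \<and>
    (\<forall>v\<in>cspace M. f v \<in> cspace N \<and> (\<forall>p. f (coact_at M p v) = coact_at N p (f v)))"

lemma comodule_isoI:
  assumes "chom M N f" "bij_betw f (cspace M) (cspace N)"
  shows "comodule_iso M N"
  unfolding comodule_iso_iff using assms unfolding chom_def by blast

text \<open>Degrees and X determine the coaction, so a linear map that respects both on homogeneous
  generators respects every coefficient.\<close>

lemma chomI:
  assumes M: "comodule n M" and N: "comodule n N" and f: "is_linear f"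
    and S: "cspace M \<subseteq> pm.span S"
    and hmg: "\<And>v. v \<in> S \<Longrightarrow> \<exists>i. hmg M i v \<and> hmg N i (f v)"
    and x: "\<And>v. v \<in> S \<Longrightarrow> f (xop n M v) = xop n N (f v)"
  shows "chom M N f"
proof -
  interpret M: comodule n M by (rule M)
  interpret N: comodule n N by (rule N)
  have fin: "f v \<in> cspace N" if "v \<in> cspace M" for v
  proof -
    have "pm.span S \<subseteq> {v. f v \<in> cspace N}"
      by (rule pm.span_minimal[OF _ subspace_vimage[OF f subspace_cspace]])
        (use hmg hmg_cspace in blast)
    then show ?thesis using that S by auto
  qed
  have fx: "f (xop n M v) = xop n N (f v)" if "v \<in> cspace M" for v
    using linear_eq_span[OF is_linear_compose[OF f M.linear_xop] is_linear_compose[OF N.linear_xop f] _ x]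
      that S by auto
  have fxl: "f ((xop n M ^^ l) v) = (xop n N ^^ l) (f v)" if "v \<in> cspace M" for v l
    using that by (induction l) (simp_all add: fx M.xop_pow_in)
  have "f (coact_at M p v) = coact_at N p (f v)" if "v \<in> cspace M" for p v
  proof (rule linear_eq_span[OF is_linear_compose[OF f M.linear_coact_at] is_linear_compose[OF N.linear_coact_at f]])
    show "v \<in> pm.span S" using that S by auto
    fix w assume "w \<in> S"
    then obtain i where i: "hmg M i w" "hmg N i (f w)" using hmg by blast
    obtain j l where p: "p = (j, l)" by (metis surj_pair)
    show "f (coact_at M p w) = coact_at N p (f w)"
    proof (cases "j = i")
      case True
      with i show ?thesis by (simp add: p M.coact_at_hmg N.coact_at_hmg fxl hmg_cspace)
    next
      case False
      with i show ?thesis by (simp add: p M.coact_at_hmg_0 N.coact_at_hmg_0 is_linear_zeroD[OF f])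
    qed
  qed
  with f fin show ?thesis unfolding chom_def by blast
qed

section \<open>Direct sums as graded spaces with operator\<close>

section \<open>Direct sums\<close>

definition shift :: "nat \<Rightarrow> (nat \<Rightarrow>\<^sub>0 'k::field) \<Rightarrow> (nat \<Rightarrow>\<^sub>0 'k)" where
  "shift k = lin_ext (\<lambda>b. bvec (k + b))"

lemma is_linear_shift [simp]: "is_linear (shift k)"
  by (simp add: shift_def)

lemma shift_bvec [simp]: "shift k (bvec b) = bvec (k + b)"
  by (simp add: shift_def)

lemma cdim_csum [simp]: "cdim (csum M N) = cdim M + cdim N"
  by (simp add: csum_def)

lemma linear_coact_csum: "is_linear (coact (csum M N))"
  by (simp add: csum_def)

lemma coact_at_csum_left:
  assumes "is_linear (coact M)" "u \<in> cspace M"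
  shows "coact_at (csum M N) p u = coact_at M p u"
  by (rule linear_eq_span_on[OF is_linear_coact_at[OF linear_coact_csum] is_linear_coact_at[OF assms(1)]
        assms(2)[unfolded cspace_def]]) (simp add: coact_at_def csum_def)

lemma coact_at_csum_right:
  assumes "is_linear (coact N)"
  shows "coact_at (csum M N) p (shift (cdim M) v) = shift (cdim M) (coact_at N p v)"
  by (rule linear_eqI[OF is_linear_compose[OF is_linear_coact_at[OF linear_coact_csum] is_linear_shift]
        is_linear_compose[OF is_linear_shift is_linear_coact_at[OF assms]]])
    (simp add: coact_at_def csum_def slice_tens_map flip: shift_def)

lemma cspace_mono_csum: "u \<in> cspace M \<Longrightarrow> u \<in> cspace (csum M N)"
  by (auto simp: cspace_def span_on_def)

lemma shift_in_csum: "v \<in> cspace N \<Longrightarrow> shift (cdim M) v \<in> cspace (csum M N)"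
  unfolding cspace_def
  by (rule linear_in_subspace[OF is_linear_shift subspace_span_on]) auto

lemma cspace_csum_span: "cspace (csum M N) \<subseteq> pm.span (cspace M \<union> shift (cdim M) ` cspace N)"
proof -
  have "bvec a \<in> cspace M \<union> shift (cdim M) ` cspace N" if "a < cdim M + cdim N" for a
  proof (cases "a < cdim M")
    case False
    then have "bvec a = shift (cdim M) (bvec (a - cdim M))" by simp
    with False that show ?thesis by (auto simp: cspace_def simp del: shift_bvec)
  qed (auto simp: cspace_def)
  then show ?thesis
    unfolding cspace_def[of "csum M N"] span_on_eq_span[of "{..<cdim (csum M N)}"]
    by (intro pm.span_mono) auto
qed

locale comodule_pair = M: comodule n M + N: comodule n N
  for n :: nat and M N :: "'k::field comodule"
begin

lemma xop_csum_left: "u \<in> cspace M \<Longrightarrow> xop n (csum M N) u = xop n M u"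
  unfolding xop_def by (simp add: coact_at_csum_left[OF M.linear_coact])

lemma xop_csum_right: "xop n (csum M N) (shift (cdim M) v) = shift (cdim M) (xop n N v)"
  unfolding xop_def by (simp add: coact_at_csum_right[OF N.linear_coact] is_linear_sumD)

lemma xop_pow_csum_left: "u \<in> cspace M \<Longrightarrow> (xop n (csum M N) ^^ l) u = (xop n M ^^ l) u"
  by (induction l) (simp_all add: xop_csum_left M.xop_pow_in)

lemma xop_pow_csum_right: "(xop n (csum M N) ^^ l) (shift (cdim M) v) = shift (cdim M) ((xop n N ^^ l) v)"
  by (induction l) (simp_all add: xop_csum_right)

text \<open>Provides the homogeneous generators of the direct sum that \<open>is_comoduleI\<close>
  asks for.\<close>

lemma csum_span_hmg:
  "cspace (csum M N) \<subseteq> pm.span (\<Union>i<n. {u. hmg M i u} \<union> shift (cdim M) ` {v. hmg N i v})" (is "_ \<subseteq> pm.span ?S")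
proof -
  have "cspace M \<subseteq> pm.span ?S"
    using M.in_span_hmg pm.span_mono[of "{u. \<exists>i<n. hmg M i u}" ?S] by blast
  moreover have "shift (cdim M) ` cspace N \<subseteq> pm.span ?S"
  proof -
    have "shift (cdim M) ` cspace N \<subseteq> shift (cdim M) ` pm.span {u. \<exists>i<n. hmg N i u}"
      using N.in_span_hmg by blast
    also have "\<dots> = pm.span (shift (cdim M) ` {u. \<exists>i<n. hmg N i u})"
      by (simp add: span_image_linear)
    also have "\<dots> \<subseteq> pm.span ?S" by (rule pm.span_mono) auto
    finally show ?thesis .
  qed
  ultimately have "pm.span (cspace M \<union> shift (cdim M) ` cspace N) \<subseteq> pm.span ?S"
    by (intro pm.span_minimal) auto
  with cspace_csum_span show ?thesis by blast
qed

lemma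
  is_comodule_csum: "is_comodule n (csum M N)" and
  hmg_csum: "hmg M i u \<Longrightarrow> hmg (csum M N) i u" "hmg N i v \<Longrightarrow> hmg (csum M N) i (shift (cdim M) v)"
proof -
  let ?S = "\<lambda>i. {u. hmg M i u} \<union> shift (cdim M) ` {v. hmg N i v}"
  have 1: "v \<in> cspace (csum M N)" if "v \<in> ?S i" for i v
    using that by (auto simp: hmg_cspace cspace_mono_csum shift_in_csum)
  have 2: "coact_at (csum M N) (j, l) v = (if j = i then (xop n (csum M N) ^^ l) v else 0)"
    if "v \<in> ?S i" for i v j l
    using that
    by (auto simp: hmg_cspace coact_at_csum_left[OF M.linear_coact] coact_at_csum_right[OF N.linear_coact]
        M.coact_at_hmg N.coact_at_hmg M.coact_at_hmg_0 N.coact_at_hmg_0 xop_pow_csum_left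
        xop_pow_csum_right is_linear_zeroD)
  have 3: "xop n (csum M N) v \<in> pm.span (?S (Suc i mod n))" if "v \<in> ?S i" for i v
    using that by (intro pm.span_base)
      (auto simp: xop_csum_left xop_csum_right hmg_cspace M.hmg_xop N.hmg_xop)
  note * = is_comoduleI[of "csum M N" n ?S, OF linear_coact_csum 1 2 3 csum_span_hmg]
  show "is_comodule n (csum M N)" by (rule *(1))
  show "hmg (csum M N) i u" if "hmg M i u"
    using that coact_at_csum_left[OF M.linear_coact hmg_cspace[OF that]]
    by (simp add: hmg_def cspace_mono_csum)
  show "hmg (csum M N) i (shift (cdim M) v)" if "hmg N i v"
    using that by (simp add: hmg_def shift_in_csum coact_at_csum_right[OF N.linear_coact])
qed

lemma comodule_csum: "comodule n (csum M N)"
  by (simp add: comodule_def is_comodule_csum)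

end

section \<open>Tensor products and the q-Leibniz rule\<close>

section \<open>Tensor products\<close>

text \<open>
  The tensor product of two vectors under the identification of \<open>k\<^sup>m\<^sup>' \<otimes> k\<^sup>m\<close> with \<open>k\<^sup>m\<^sup>'\<^sup>m\<close> used in \<open>ctensor\<close>.
\<close>

definition ft :: "nat \<Rightarrow> (nat \<Rightarrow>\<^sub>0 'k::field) \<Rightarrow> (nat \<Rightarrow>\<^sub>0 'k) \<Rightarrow> (nat \<Rightarrow>\<^sub>0 'k)" where
  "ft m u v = lin_ext (\<lambda>(i, j). bvec (i * m + j)) (tens u v)"

lemma ft_bvec [simp]: "ft m (bvec i) (bvec j) = bvec (i * m + j)"
  by (simp add: ft_def)

lemma is_linear_ft_left: "is_linear (\<lambda>u. ft m u v)"
  unfolding ft_def by (rule is_linear_compose[OF is_linear_lin_ext is_linear_tens_left])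

lemma is_linear_ft_right: "is_linear (\<lambda>v. ft m u v)"
  unfolding ft_def by (rule is_linear_compose[OF is_linear_lin_ext is_linear_tens_right])

lemma ft_zero [simp]: "ft m 0 v = 0" "ft m u 0 = 0"
  using is_linear_zeroD[OF is_linear_ft_left] is_linear_zeroD[OF is_linear_ft_right] by auto

lemma ft_pscale: "ft m (pscale c u) v = pscale c (ft m u v)" "ft m u (pscale c v) = pscale c (ft m u v)"
  using is_linear_scaleD[OF is_linear_ft_left] is_linear_scaleD[OF is_linear_ft_right] by auto

lemma ft_add: "ft m (u + u') v = ft m u v + ft m u' v" "ft m u (v + v') = ft m u v + ft m u v'"
  using is_linear_addD[OF is_linear_ft_left] is_linear_addD[OF is_linear_ft_right] by auto

lemma cdim_ctensor [simp]: "cdim (ctensor n q M N) = cdim M * cdim N"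
  by (simp add: ctensor_def)

lemma linear_coact_ctensor: "is_linear (coact (ctensor n q M N))"
  by (simp add: ctensor_def)

lemma mult_add_less_mult: "i < m \<Longrightarrow> j < m' \<Longrightarrow> i * m' + j < m * (m' :: nat)"
proof -
  assume "i < m" "j < m'"
  then have "i * m' + j < Suc i * m'" by simp
  also have "\<dots> \<le> m * m'" using \<open>i < m\<close> by (intro mult_right_mono) auto
  finally show ?thesis .
qed

lemma span_ft:
  assumes "u \<in> pm.span A" "v \<in> pm.span B"
  shows "ft m u v \<in> pm.span {ft m a b |a b. a \<in> A \<and> b \<in> B}" (is "_ \<in> pm.span ?S")
proof -
  have "pm.span B \<subseteq> {v. ft m a v \<in> pm.span ?S}" if "a \<in> A" for a
    by (rule pm.span_minimal[OF _ subspace_vimage[OF is_linear_ft_right]])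
      (use that in \<open>auto intro: pm.span_base\<close>)
  then have "pm.span A \<subseteq> {u. ft m u v \<in> pm.span ?S}"
    by (intro pm.span_minimal[OF _ subspace_vimage[OF is_linear_ft_left]]) (use assms in auto)
  with assms show ?thesis by auto
qed

lemma cspace_ctensor_span:
  "cspace (ctensor n q M N) = pm.span {ft (cdim N) u v |u v. u \<in> cspace M \<and> v \<in> cspace N}"
  (is "_ = pm.span ?S")
proof
  have "bvec a \<in> ?S" if "a < cdim M * cdim N" for a
  proof -
    have N: "cdim N > 0" using that by (cases "cdim N") auto
    have "bvec a = ft (cdim N) (bvec (a div cdim N)) (bvec (a mod cdim N))" by simp
    moreover have "a div cdim N < cdim M" using that by (simp add: less_mult_imp_div_less)
    ultimately show ?thesis using N by (force simp: cspace_def simp del: ft_bvec)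
  qed
  then show "cspace (ctensor n q M N) \<subseteq> pm.span ?S"
    unfolding cspace_def[of "ctensor n q M N"] span_on_eq_span[of "{..<cdim (ctensor n q M N)}"]
    by (intro pm.span_mono) auto
  have "ft (cdim N) u v \<in> cspace (ctensor n q M N)" if "u \<in> cspace M" "v \<in> cspace N" for u v
  proof -
    have "ft (cdim N) (bvec i) v \<in> cspace (ctensor n q M N)" if "i < cdim M" for i
      unfolding cspace_def
      by (rule linear_in_subspace[OF is_linear_ft_right subspace_span_on \<open>v \<in> cspace N\<close>[unfolded cspace_def]])
        (use that in \<open>simp add: mult_add_less_mult\<close>)
    then show ?thesis
      using linear_in_subspace[OF is_linear_ft_left subspace_cspace \<open>u \<in> cspace M\<close>[unfolded cspace_def]]
      by simp
  qed
  then show "pm.span ?S \<subseteq> cspace (ctensor n q M N)"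
    by (intro pm.span_minimal subspace_cspace) auto
qed

lemma ft_in_ctensor: "u \<in> cspace M \<Longrightarrow> v \<in> cspace N \<Longrightarrow> ft (cdim N) u v \<in> cspace (ctensor n q M N)"
  unfolding cspace_ctensor_span by (rule pm.span_base) auto

lemma lookup_hmult: "Poly_Mapping.lookup (hmult n q (bvec ((i, l), (j, m)))) (k, s) =
    (if k = (i + j) mod n \<and> s = l + m then q ^ (i * m) * gauss_binom l m q else 0)"
  by (auto simp: hmult_def lookup_single when_def)

text \<open>Both sides are bilinear in \<open>x\<close> and \<open>y\<close>, so basis vectors
  suffice. This lets the formula in \<open>ctensor\<close> be applied to the expansions of coactions
  of arbitrary homogeneous vectors.\<close>

lemma lin_ext_tens_tens:
  "lin_ext (\<lambda>((i, c), (j, c')). tens (bvec (i * m + j)) (h (bvec (c, c'))))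
     (tens (tens x (bvec c)) (tens y (bvec c'))) = tens (ft m x y) (h (bvec (c, c')))" (is "?l x y = ?r x y")
proof -
  let ?G = "\<lambda>((i, c), (j, c')). tens (bvec (i * m + j)) (h (bvec (c, c')))"
  have lx: "is_linear (\<lambda>x. ?l x y)" for y
    by (rule is_linear_compose[OF is_linear_lin_ext is_linear_compose[OF is_linear_tens_left is_linear_tens_left]])
  have ly: "is_linear (\<lambda>y. ?l x y)" for x
    by (rule is_linear_compose[OF is_linear_lin_ext is_linear_compose[OF is_linear_tens_right is_linear_tens_left]])
  have rx: "is_linear (\<lambda>x. ?r x y)" for y
    by (rule is_linear_compose[OF is_linear_tens_left is_linear_ft_left])
  have ry: "is_linear (\<lambda>y. ?r x y)" for x
    by (rule is_linear_compose[OF is_linear_tens_left is_linear_ft_right])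
  have "?l (bvec i) y = ?r (bvec i) y" for i
    by (rule linear_eqI[OF ly ry]) simp
  then show ?thesis by (rule linear_eqI[OF lx rx])
qed

locale tensor_pair = comodule_pair n M N for n :: nat and M N :: "'k::field comodule" +
  fixes q :: 'k
  assumes q_n: "q ^ n = 1"
begin

abbreviation T :: "'k comodule" where "T \<equiv> ctensor n q M N"
abbreviation t :: "(nat \<Rightarrow>\<^sub>0 'k) \<Rightarrow> (nat \<Rightarrow>\<^sub>0 'k) \<Rightarrow> (nat \<Rightarrow>\<^sub>0 'k)" where "t \<equiv> ft (cdim N)"

text \<open>The degree of a vector matters only modulo n, and q^deg must not depend on the
  representative.\<close>

lemma q_mod: "q ^ (k mod n) = q ^ k"
proof -
  have "q ^ k = q ^ (n * (k div n) + k mod n)" by simp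
  also have "\<dots> = q ^ (k mod n)" unfolding power_add power_mult q_n by simp
  finally show ?thesis ..
qed

lemma coact_ft:
  assumes "u \<in> cspace M" "v \<in> cspace N"
  shows "coact T (t u v) = lin_ext (\<lambda>((i, c), (j, c')). tens (bvec (i * cdim N + j)) (hmult n q (bvec (c, c'))))
         (tens (coact M u) (coact N v))" (is "_ = lin_ext ?G _")
proof -
  have "coact T (t (bvec i) v) = lin_ext ?G (tens (coact M (bvec i)) (coact N v))" if "i < cdim M" for i
  proof (rule linear_eq_span_on[OF _ _ assms(2)[unfolded cspace_def]])
    show "is_linear (\<lambda>v. coact T (t (bvec i) v))"
      by (rule is_linear_compose[OF linear_coact_ctensor is_linear_ft_right])
    show "is_linear (\<lambda>v. lin_ext ?G (tens (coact M (bvec i)) (coact N v)))"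
      by (rule is_linear_compose[OF is_linear_lin_ext is_linear_compose[OF is_linear_tens_right N.linear_coact]])
    fix j assume "j \<in> {..<cdim N}"
    then show "coact T (t (bvec i) (bvec j)) = lin_ext ?G (tens (coact M (bvec i)) (coact N (bvec j)))"
      by (simp add: ctensor_def)
  qed
  moreover have "is_linear (\<lambda>u. coact T (t u v))"
    by (rule is_linear_compose[OF linear_coact_ctensor is_linear_ft_left])
  moreover have "is_linear (\<lambda>u. lin_ext ?G (tens (coact M u) (coact N v)))"
    by (rule is_linear_compose[OF is_linear_lin_ext is_linear_compose[OF is_linear_tens_left M.linear_coact]])
  ultimately show ?thesis
    using linear_eq_span_on[OF _ _ assms(1)[unfolded cspace_def], of "\<lambda>u. coact T (t u v)"
        "\<lambda>u. lin_ext ?G (tens (coact M u) (coact N v))"] by simp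
qed

text \<open>The q-binomial expansion of X^s on u \<otimes> v, with \<open>u\<close> of degree
  \<open>i\<close>. The factor \<open>q ^ (i * (s - l))\<close> is the one in the product of a path
  starting at \<open>i\<close> with a path of length \<open>s - l\<close>.\<close>

definition tpow :: "nat \<Rightarrow> nat \<Rightarrow> (nat \<Rightarrow>\<^sub>0 'k) \<Rightarrow> (nat \<Rightarrow>\<^sub>0 'k) \<Rightarrow> (nat \<Rightarrow>\<^sub>0 'k)" where
  "tpow i s u v = (\<Sum>l\<le>s. pscale (q ^ (i * (s - l)) * gauss_binom l (s - l) q)
     (t ((xop n M ^^ l) u) ((xop n N ^^ (s - l)) v)))"

lemma coact_at_ft:
  assumes u: "hmg M i u" and v: "hmg N j v"
  shows "coact_at T (k, s) (t u v) = (if k = (i + j) mod n then tpow i s u v else 0)"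
proof -
  obtain L1 where L1: "\<forall>l\<ge>L1. (xop n M ^^ l) u = 0" using M.nilpotent_at[OF hmg_cspace[OF u]] by auto
  obtain L2 where L2: "\<forall>l\<ge>L2. (xop n N ^^ l) v = 0" using N.nilpotent_at[OF hmg_cspace[OF v]] by auto
  \<comment> \<open>Beyond \<open>s\<close> and both nilpotency orders, so that the two coactions
    are expanded over one range which contains every \<open>l \<le> s\<close> and every
    \<open>s - l\<close>.\<close>
  define L where "L = Suc (max s (max L1 L2))"
  have L: "(xop n M ^^ L) u = 0" "(xop n N ^^ L) v = 0"
    using L1[THEN spec, of L] L2[THEN spec, of L] by (auto simp: L_def)
  let ?F = "\<lambda>l m. pscale (q ^ (i * m) * gauss_binom l m q) (t ((xop n M ^^ l) u) ((xop n N ^^ m) v))"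
  have lm: "is_linear (\<lambda>u. tens u v)" for v :: "'c \<Rightarrow>\<^sub>0 'k" by (rule is_linear_tens_left)
  have "coact T (t u v) = (\<Sum>l<L. \<Sum>m<L. tens (t ((xop n M ^^ l) u) ((xop n N ^^ m) v)) (hmult n q (bvec ((i, l), (j, m)))))"
    unfolding coact_ft[OF hmg_cspace[OF u] hmg_cspace[OF v]] M.coact_hmg[OF u L(1)] N.coact_hmg[OF v L(2)]
    by (simp only: is_linear_sumD[OF is_linear_tens_left] is_linear_sumD[OF is_linear_tens_right]
      is_linear_sumD[OF is_linear_lin_ext] lin_ext_tens_tens) (rule sum.swap)
  then have "coact_at T (k, s) (t u v)
      = (\<Sum>l<L. \<Sum>m<L. if m = s - l then if k = (i + j) mod n \<and> l \<le> s then ?F l (s - l) else 0 else 0)"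
    unfolding coact_at_def is_linear_sumD[OF is_linear_slice] slice_tens lookup_hmult
    by (simp only: is_linear_sumD[OF is_linear_slice] slice_tens lookup_hmult)
      (intro sum.cong refl, auto)
  also have "\<dots> = (\<Sum>l<L. if k = (i + j) mod n \<and> l \<le> s then ?F l (s - l) else 0)"
    by (intro sum.cong refl) (auto simp: sum.delta L_def)
  also have "\<dots> = (\<Sum>l\<le>s. if k = (i + j) mod n \<and> l \<le> s then ?F l (s - l) else 0)"
    by (rule sum.mono_neutral_right) (auto simp: L_def)
  also have "\<dots> = (if k = (i + j) mod n then tpow i s u v else 0)"
    by (auto simp: tpow_def)
  finally show ?thesis .
qed

lemma xop_ft:
  assumes u: "hmg M i u" and v: "hmg N j v"
  shows "xop n T (t u v) = t (xop n M u) v + pscale (q ^ i) (t u (xop n N v))"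
proof (cases "n = 0")
  case True
  with M.hmg_eq_0[OF u] N.hmg_eq_0[OF v] show ?thesis
    by (simp add: is_linear_zeroD[OF is_linear_xop[OF linear_coact_ctensor]]
        is_linear_zeroD[OF M.linear_xop])
next
  case False
  have "xop n T (t u v) = (\<Sum>k<n. if k = (i + j) mod n then tpow i 1 u v else 0)"
    unfolding xop_def coact_at_ft[OF u v] ..
  also have "\<dots> = tpow i 1 u v"
    using False by (simp add: sum.delta)
  also have "\<dots> = t (xop n M u) v + pscale (q ^ i) (t u (xop n N v))"
    by (simp add: tpow_def add.commute)
  finally show ?thesis .
qed

text \<open>By the q-Leibniz rule each term splits in two. One of the sums is shifted to match the
  exponents on the first factor, and the coefficients then combine by the q-Pascal
  recursion.\<close>

lemma xop_tpow:
  assumes u: "hmg M i u" and v: "hmg N j v"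
  shows "xop n T (tpow i s u v) = tpow i (Suc s) u v"
proof -
  let ?A = "\<lambda>l. t ((xop n M ^^ l) u) ((xop n N ^^ (Suc s - l)) v)"
  let ?c = "\<lambda>s l. q ^ (i * (s - l)) * gauss_binom l (s - l) q"
  have "xop n T (tpow i s u v) = (\<Sum>l\<le>s. pscale (?c s l) (?A (Suc l)) + pscale (?c s l * q ^ (i + l)) (?A l))"
  proof -
    have "xop n T (t ((xop n M ^^ l) u) ((xop n N ^^ (s - l)) v)) = ?A (Suc l) + pscale (q ^ (i + l)) (?A l)"
      if "l \<le> s" for l
      using xop_ft[OF M.hmg_xop_pow[OF u, of l] N.hmg_xop_pow[OF v, of "s - l"]] that
      by (simp add: q_mod Suc_diff_le)
    then show ?thesis
      unfolding tpow_def is_linear_sumD[OF is_linear_xop[OF linear_coact_ctensor]]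
        is_linear_scaleD[OF is_linear_xop[OF linear_coact_ctensor]]
      by (intro sum.cong refl) (simp add: pm.scale_right_distrib)
  qed
  also have "\<dots> = (\<Sum>l\<le>s. pscale (?c s l) (?A (Suc l))) + (\<Sum>l\<le>s. pscale (?c s l * q ^ (i + l)) (?A l))"
    by (rule sum.distrib)
  also have "(\<Sum>l\<le>s. pscale (?c s l * q ^ (i + l)) (?A l))
      = pscale (q ^ (i * Suc s)) (?A 0) + (\<Sum>l<s. pscale (?c s (Suc l) * q ^ (i + Suc l)) (?A (Suc l)))"
    unfolding lessThan_Suc_atMost[symmetric] sum.lessThan_Suc_shift by (simp add: power_add mult.commute)
  also have "(\<Sum>l\<le>s. pscale (?c s l) (?A (Suc l))) = (\<Sum>l<s. pscale (?c s l) (?A (Suc l))) + ?A (Suc s)"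
    unfolding lessThan_Suc_atMost[symmetric] sum.lessThan_Suc by simp
  also have "((\<Sum>l<s. pscale (?c s l) (?A (Suc l))) + ?A (Suc s)) + (pscale (q ^ (i * Suc s)) (?A 0) +
        (\<Sum>l<s. pscale (?c s (Suc l) * q ^ (i + Suc l)) (?A (Suc l))))
      = pscale (q ^ (i * Suc s)) (?A 0) + ((\<Sum>l<s. pscale (?c s l + ?c s (Suc l) * q ^ (i + Suc l)) (?A (Suc l))) + ?A (Suc s))"
    by (simp only: pm.scale_left_distrib sum.distrib add_ac)
  also have "(\<Sum>l<s. pscale (?c s l + ?c s (Suc l) * q ^ (i + Suc l)) (?A (Suc l)))
      = (\<Sum>l<s. pscale (?c (Suc s) (Suc l)) (?A (Suc l)))"
  proof (intro sum.cong refl arg_cong2[where f = pscale])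
    fix l assume "l \<in> {..<s}"
    then obtain m where s: "s = Suc (l + m)" using less_imp_Suc_add by auto
    show "?c s l + ?c s (Suc l) * q ^ (i + Suc l) = ?c (Suc s) (Suc l)"
      by (simp add: s gauss_binom_Suc_Suc power_add algebra_simps)
  qed
  also have "pscale (q ^ (i * Suc s)) (?A 0) + ((\<Sum>l<s. pscale (?c (Suc s) (Suc l)) (?A (Suc l))) + ?A (Suc s))
      = tpow i (Suc s) u v"
  proof -
    have "tpow i (Suc s) u v = pscale (?c (Suc s) 0) (?A 0) + (\<Sum>l<Suc s. pscale (?c (Suc s) (Suc l)) (?A (Suc l)))"
      unfolding tpow_def lessThan_Suc_atMost[symmetric] by (rule sum.lessThan_Suc_shift)
    then show ?thesis by simp
  qed
  finally show ?thesis .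
qed

text \<open>Together with \<open>coact_at_ft\<close> this shows that the coefficients of the tensor
  product are the powers of its own X, as \<open>is_comoduleI\<close> demands. The tensor product is
  thus a comodule without an appeal to the bialgebra axioms of the path space.\<close>

lemma xop_pow_ft:
  assumes u: "hmg M i u" and v: "hmg N j v"
  shows "(xop n T ^^ s) (t u v) = tpow i s u v"
proof (induction s)
  case 0
  then show ?case by (simp add: tpow_def)
next
  case (Suc s)
  then show ?case using xop_tpow[OF assms] by simp
qed

lemma ctensor_span_hmg:
  "cspace T \<subseteq> pm.span {t u v |u v. (\<exists>i<n. hmg M i u) \<and> (\<exists>j<n. hmg N j v)}"
proof -
  have "t u v \<in> pm.span {t u v |u v. (\<exists>i<n. hmg M i u) \<and> (\<exists>j<n. hmg N j v)}"
    if "u \<in> cspace M" "v \<in> cspace N" for u v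
    using span_ft[OF M.in_span_hmg[OF that(1)] N.in_span_hmg[OF that(2)], of "cdim N"] by simp
  then show ?thesis
    unfolding cspace_ctensor_span by (intro pm.span_minimal) auto
qed

lemma is_comodule_ctensor: "is_comodule n T"
  and hmg_ft_less: "i < n \<Longrightarrow> j < n \<Longrightarrow> hmg M i u \<Longrightarrow> hmg N j v \<Longrightarrow> hmg T ((i + j) mod n) (t u v)"
proof -
  let ?S = "\<lambda>k. {t u v |u v i j. i < n \<and> j < n \<and> hmg M i u \<and> hmg N j v \<and> k = (i + j) mod n}"
  have 1: "w \<in> cspace T" if "w \<in> ?S i" for i w
    using that by (auto simp: hmg_cspace ft_in_ctensor)
  have 2: "coact_at T (j, l) w = (if j = i then (xop n T ^^ l) w else 0)" if "w \<in> ?S i" for i w j l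
    using that by (auto simp: coact_at_ft xop_pow_ft)
  have 3: "xop n T w \<in> pm.span (?S (Suc i mod n))" if "i < n" "w \<in> ?S i" for i w
  proof -
    from that obtain u v a b where w: "w = t u v" "a < n" "b < n" "hmg M a u" "hmg N b v" "i = (a + b) mod n"
      by blast
    have "t (xop n M u) v \<in> ?S (Suc i mod n)"
      using w M.hmg_xop[OF w(4)] by (intro CollectI exI[of _ "xop n M u"] exI[of _ v] exI[of _ "Suc a mod n"] exI[of _ b])
        (auto simp: mod_simps)
    moreover have "t u (xop n N v) \<in> ?S (Suc i mod n)"
      using w N.hmg_xop[OF w(5)] by (intro CollectI exI[of _ u] exI[of _ "xop n N v"] exI[of _ a] exI[of _ "Suc b mod n"])
        (auto simp: mod_simps)
    ultimately show ?thesis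
      unfolding w(1) xop_ft[OF w(4,5)] by (intro pm.span_add pm.span_scale pm.span_base)
  qed
  have 4: "cspace T \<subseteq> pm.span (\<Union>k<n. ?S k)"
  proof -
    have "{t u v |u v. (\<exists>i<n. hmg M i u) \<and> (\<exists>j<n. hmg N j v)} \<subseteq> (\<Union>k<n. ?S k)"
    proof clarify
      fix u v i j assume "i < n" "hmg M i u" "j < n" "hmg N j v"
      then show "t u v \<in> (\<Union>k<n. ?S k)"
        by (intro UN_I[of "(i + j) mod n"]) auto
    qed
    then show ?thesis using ctensor_span_hmg pm.span_mono by blast
  qed
  note * = is_comoduleI[of T n ?S, OF linear_coact_ctensor 1 2 3 4]
  show "is_comodule n T" by (rule *(1))
  show "hmg T ((i + j) mod n) (t u v)" if "i < n" "j < n" "hmg M i u" "hmg N j v"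
    by (rule *(2)) (use that in auto)
qed

lemma comodule_ctensor: "comodule n T"
  by (simp add: comodule_def is_comodule_ctensor)

lemma hmg_ft: "hmg M i u \<Longrightarrow> hmg N j v \<Longrightarrow> hmg T ((i + j) mod n) (t u v)"
proof -
  assume uv: "hmg M i u" "hmg N j v"
  show ?thesis
  proof (cases "i < n \<and> j < n")
    case False
    then have "t u v = 0" using M.hmg_eq_0[OF uv(1)] N.hmg_eq_0[OF uv(2)] by auto
    then show ?thesis using comodule.hmg_zero[OF comodule_ctensor] by simp
  qed (use hmg_ft_less uv in blast)
qed

end

section \<open>Comodule maps and the monoidal structure up to isomorphism\<close>

section \<open>Isomorphisms of comodules\<close>

text \<open>This simplification rule would turn the basis vector \<open>bvec 0\<close> into the unit \<open>1\<close> of the monoid ring.\<close>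

declare single_one [simp del]

lemma chom_linear: "chom M N f \<Longrightarrow> is_linear f"
  and chom_in: "chom M N f \<Longrightarrow> v \<in> cspace M \<Longrightarrow> f v \<in> cspace N"
  and chom_coact_at: "chom M N f \<Longrightarrow> v \<in> cspace M \<Longrightarrow> f (coact_at M p v) = coact_at N p (f v)"
  unfolding chom_def by blast+

lemma chom_hmg: "chom M N f \<Longrightarrow> hmg M i u \<Longrightarrow> hmg N i (f u)"
  using chom_coact_at[of M N f u "(i, 0)"] by (simp add: hmg_def chom_in)

lemma chom_xop: "chom M N f \<Longrightarrow> u \<in> cspace M \<Longrightarrow> f (xop n M u) = xop n N (f u)"
  by (simp add: xop_def is_linear_sumD[OF chom_linear] chom_coact_at)

lemma chom_id: "chom M M (\<lambda>v. v)"
  by (simp add: chom_def)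

global_interpretation pmp: vector_space_pair
  "pscale :: 'k::field \<Rightarrow> ('a \<Rightarrow>\<^sub>0 'k) \<Rightarrow> _" "pscale :: 'k::field \<Rightarrow> ('b \<Rightarrow>\<^sub>0 'k) \<Rightarrow> _"
  by unfold_locales

lemma dim_image_inj:
  fixes f :: "('a \<Rightarrow>\<^sub>0 'k::field) \<Rightarrow> ('b \<Rightarrow>\<^sub>0 'k)"
  assumes "is_linear f" "inj_on f (pm.span S)"
  shows "pm.dim (f ` S) = pm.dim S"
proof -
  obtain B where B: "B \<subseteq> S" "\<not> pm.dependent B" "S \<subseteq> pm.span B" "card B = pm.dim S"
    by (rule pm.basis_exists)
  have inj: "inj_on f (pm.span B)"
    using assms(2) pm.span_mono[OF B(1)] by (rule inj_on_subset)
  have "pm.dim (f ` S) = card (f ` B)"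
  proof (rule pm.dim_unique[OF _ _ _ refl])
    show "f ` S \<subseteq> pm.span (f ` B)"
      unfolding span_image_linear[OF assms(1)] using B(3) by blast
    show "\<not> pm.dependent (f ` B)"
      by (rule pmp.linear_independent_injective_image[OF assms(1) B(2) inj])
  qed (use B in auto)
  also have "\<dots> = card B"
    by (rule card_image[OF inj_on_subset[OF inj pm.span_superset]])
  finally show ?thesis using B(4) by simp
qed

lemma span_cspace: "pm.span (cspace M) = cspace M"
  by (simp add: subspace_cspace)

lemma dim_cspace: "pm.dim (cspace M) = cdim M"
  by (simp add: cspace_def dim_span_on)

lemma independent_spanning:
  assumes "S \<subseteq> cspace M" "\<not> pm.dependent S" "card S = cdim M"
  shows "cspace M \<subseteq> pm.span S"
proof -
  obtain B where B: "S \<subseteq> B" "B \<subseteq> cspace M" "\<not> pm.dependent B" "cspace M \<subseteq> pm.span B"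
    by (rule pm.maximal_independent_subset_extend[OF assms(1,2)])
  have "card B = card S"
    using pm.basis_card_eq_dim[OF B(2,4,3)] assms(3) by (simp add: dim_cspace)
  moreover have "finite B"
    by (rule finite_independent_span_on[OF _ B(2)[unfolded cspace_def] B(3)]) simp
  ultimately have "S = B" using B(1) card_subset_eq by metis
  then show ?thesis using B(4) by simp
qed

text \<open>Preimages are chosen for the basis vectors of the target and extended linearly; indices
  outside the coordinate space get the value 0.\<close>

lemma linear_right_inverse:
  assumes f: "is_linear f" and surj: "cspace N \<subseteq> f ` cspace M"
  shows "\<exists>g. is_linear g \<and> (\<forall>w\<in>cspace N. g w \<in> cspace M \<and> f (g w) = w)"
proof -
  define g where "g = lin_ext (\<lambda>b. if b < cdim N then inv_into (cspace M) f (bvec b) else 0)"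
  have gl: "is_linear g" by (simp add: g_def)
  have b: "bvec b \<in> f ` cspace M" if "b < cdim N" for b
    using surj that by (auto simp: cspace_def)
  have "g w \<in> cspace M" if "w \<in> cspace N" for w
    by (rule linear_in_subspace[OF gl subspace_cspace that[unfolded cspace_def]])
      (use b in \<open>auto simp: g_def intro!: inv_into_into\<close>)
  moreover have "f (g w) = w" if "w \<in> cspace N" for w
    by (rule linear_eq_span_on[OF is_linear_compose[OF f gl] is_linear_id(2) that[unfolded cspace_def]])
      (use b in \<open>auto simp: g_def intro!: f_inv_into_f\<close>)
  ultimately show ?thesis using gl by blast
qed

text \<open>A linear section \<open>g\<close> carries a basis of the target to an independent set of
  \<open>cdim M\<close> vectors, which spans the source. So \<open>g\<close> is onto and
  \<open>f\<close> is injective.\<close>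

lemma bij_betw_of_surj:
  assumes f: "is_linear f" and into: "f ` cspace M \<subseteq> cspace N" and surj: "cspace N \<subseteq> f ` cspace M"
    and dim: "cdim M = cdim N"
  shows "bij_betw f (cspace M) (cspace N)"
proof -
  obtain g where g: "is_linear g" "\<And>w. w \<in> cspace N \<Longrightarrow> g w \<in> cspace M \<and> f (g w) = w"
    using linear_right_inverse[OF f surj] by blast
  have inj: "inj_on g (cspace N)"
    by (rule inj_on_inverseI[of _ f]) (use g in auto)
  let ?B = "bvec ` {..<cdim N} :: (nat \<Rightarrow>\<^sub>0 'a) set"
  have span: "pm.span ?B = cspace N"
    by (simp add: cspace_def span_on_eq_span)
  have "cspace M \<subseteq> pm.span (g ` ?B)"
  proof (rule independent_spanning)
    show "g ` ?B \<subseteq> cspace M" using g(2) by (auto simp: cspace_def)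
    show "\<not> pm.dependent (g ` ?B)"
      by (rule pmp.linear_independent_injective_image[OF g(1) independent_bvec])
        (simp add: span inj)
    have "card (g ` ?B) = card ?B"
      by (rule card_image[OF inj_on_subset[OF inj]]) (auto simp: cspace_def)
    also have "\<dots> = cdim N" by (simp add: card_image inj_on_subset[OF inj_bvec])
    finally show "card (g ` ?B) = cdim M" using dim by simp
  qed
  also have "pm.span (g ` ?B) = g ` cspace N"
    by (simp add: span_image_linear[OF g(1)] span)
  finally have *: "cspace M \<subseteq> g ` cspace N" .
  have "inj_on f (cspace M)"
  proof (rule inj_onI)
    fix x y assume "x \<in> cspace M" "y \<in> cspace M" "f x = f y"
    moreover from this obtain w w' where "x = g w" "y = g w'" "w \<in> cspace N" "w' \<in> cspace N"
      using * by blast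
    ultimately show "x = y" using g(2) by metis
  qed
  with into surj show ?thesis unfolding bij_betw_def by blast
qed

lemma bij_betw_of_spanning:
  assumes f: "is_linear f" and into: "f ` cspace M \<subseteq> cspace N"
    and surj: "cspace N \<subseteq> pm.span (f ` cspace M)" and dim: "cdim M = cdim N"
  shows "bij_betw f (cspace M) (cspace N)"
proof (rule bij_betw_of_surj[OF f into _ dim])
  show "cspace N \<subseteq> f ` cspace M"
    using surj by (simp add: span_image_linear[OF f] span_cspace)
qed

lemma comodule_iso_refl: "comodule_iso M M"
  unfolding comodule_iso_iff by (rule exI[of _ "\<lambda>v. v"]) (auto simp: bij_betw_def)

lemma comodule_iso_trans:
  assumes "comodule_iso M N" "comodule_iso N P"
  shows "comodule_iso M P"
proof -
  obtain f g where f: "is_linear f" "bij_betw f (cspace M) (cspace N)"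
      "\<And>v p. v \<in> cspace M \<Longrightarrow> f (coact_at M p v) = coact_at N p (f v)"
    and g: "is_linear g" "bij_betw g (cspace N) (cspace P)"
      "\<And>v p. v \<in> cspace N \<Longrightarrow> g (coact_at N p v) = coact_at P p (g v)"
    using assms unfolding comodule_iso_iff by metis
  have "bij_betw (\<lambda>v. g (f v)) (cspace M) (cspace P)"
    using bij_betw_trans[OF f(2) g(2)] by (simp add: o_def)
  moreover have "g (f (coact_at M p v)) = coact_at P p (g (f v))" if "v \<in> cspace M" for v p
    using that f(3) g(3) bij_betwE[OF f(2)] by auto
  ultimately show ?thesis
    unfolding comodule_iso_iff using is_linear_compose[OF g(1) f(1)] by blast
qed

text \<open>The inverse respects coefficients because those of a vector of \<open>M\<close> stay in
  \<open>cspace M\<close>, where \<open>f\<close> is inverted; this is what the comodule hypothesis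
  provides.\<close>

lemma comodule_iso_sym:
  assumes M: "is_comodule n M" and "comodule_iso M N"
  shows "comodule_iso N M"
proof -
  interpret M: comodule n M by standard (rule M)
  obtain f where f: "is_linear f" "bij_betw f (cspace M) (cspace N)"
      "\<And>v p. v \<in> cspace M \<Longrightarrow> f (coact_at M p v) = coact_at N p (f v)"
    using assms(2) unfolding comodule_iso_iff by metis
  obtain g where g: "is_linear g" "\<And>w. w \<in> cspace N \<Longrightarrow> g w \<in> cspace M \<and> f (g w) = w"
    using linear_right_inverse[OF f(1), of N M] f(2) unfolding bij_betw_def by blast
  have inj: "inj_on f (cspace M)" using f(2) by (simp add: bij_betw_def)
  have gf: "g (f v) = v" if "v \<in> cspace M" for v
    using that g(2)[of "f v"] bij_betwE[OF f(2)] inj by (auto dest: inj_onD)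
  have "bij_betw g (cspace N) (cspace M)"
    by (rule bij_betw_byWitness[where f' = f]) (use g f(2) gf bij_betwE[OF f(2)] in auto)
  moreover have "g (coact_at N p w) = coact_at M p (g w)" if "w \<in> cspace N" for w p
    using gf[OF M.coact_at_in, of "g w" p] f(3)[of "g w" p] g(2)[OF that] by simp
  ultimately show ?thesis
    unfolding comodule_iso_iff using g(1) by blast
qed

lemma comodule_iso_cdim:
  assumes "comodule_iso M N"
  shows "cdim M = cdim N"
proof -
  obtain f where f: "is_linear f" "bij_betw f (cspace M) (cspace N)"
    using assms unfolding comodule_iso_iff by metis
  then have "pm.dim (f ` cspace M) = pm.dim (cspace M)"
    by (intro dim_image_inj) (auto simp: span_cspace bij_betw_def)
  with f(2) show ?thesis by (simp add: bij_betw_def dim_cspace)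
qed

subsection \<open>Maps out of direct sums and tensor products\<close>

definition csum_map :: "nat \<Rightarrow> ((nat \<Rightarrow>\<^sub>0 'k::field) \<Rightarrow> (nat \<Rightarrow>\<^sub>0 'k)) \<Rightarrow> ((nat \<Rightarrow>\<^sub>0 'k) \<Rightarrow> (nat \<Rightarrow>\<^sub>0 'k))
    \<Rightarrow> (nat \<Rightarrow>\<^sub>0 'k) \<Rightarrow> (nat \<Rightarrow>\<^sub>0 'k)" where
  "csum_map k f g = lin_ext (\<lambda>a. if a < k then f (bvec a) else g (bvec (a - k)))"

lemma is_linear_csum_map [simp]: "is_linear (csum_map k f g)"
  by (simp add: csum_map_def)

lemma csum_map_left:
  "is_linear f \<Longrightarrow> u \<in> cspace M \<Longrightarrow> csum_map (cdim M) f g u = f u"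
  by (rule linear_eq_span_on[of "csum_map (cdim M) f g" f]) (auto simp: csum_map_def cspace_def)

lemma csum_map_right: "is_linear g \<Longrightarrow> csum_map k f g (shift k v) = g v"
  by (rule linear_eqI[OF is_linear_compose[OF is_linear_csum_map is_linear_shift]])
    (simp_all add: csum_map_def)

lemma csum_map_in:
  assumes "is_linear f" "is_linear g" "f ` cspace M \<subseteq> cspace P" "g ` cspace N \<subseteq> cspace P"
  shows "csum_map (cdim M) f g ` cspace (csum M N) \<subseteq> cspace P"
proof clarify
  fix w assume w: "w \<in> cspace (csum M N)"
  show "csum_map (cdim M) f g w \<in> cspace P"
    by (rule linear_in_subspace[OF is_linear_csum_map subspace_cspace w[unfolded cspace_def[of "csum M N"]]])
      (use assms(3,4) in \<open>auto simp: csum_map_def cspace_def\<close>)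
qed

lemma (in comodule_pair) chom_csum:
  assumes P: "comodule n P" and f: "chom M P f" and g: "chom N P g"
  shows "chom (csum M N) P (csum_map (cdim M) f g)"
proof -
  let ?h = "csum_map (cdim M) f g"
  have lin: "is_linear f" "is_linear g" using f g by (auto simp: chom_def)
  have "?h (coact_at (csum M N) p w) = coact_at P p (?h w)" if "w \<in> cspace (csum M N)" for p w
  proof (rule linear_eq_span[OF is_linear_compose[OF is_linear_csum_map is_linear_coact_at[OF linear_coact_csum]]
        is_linear_compose[OF comodule.linear_coact_at[OF P] is_linear_csum_map]])
    show "w \<in> pm.span (cspace M \<union> shift (cdim M) ` cspace N)" using that cspace_csum_span by blast
    fix a assume "a \<in> cspace M \<union> shift (cdim M) ` cspace N"
    then show "?h (coact_at (csum M N) p a) = coact_at P p (?h a)"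
      by (auto simp: coact_at_csum_left[OF M.linear_coact] coact_at_csum_right[OF N.linear_coact]
          csum_map_left[OF lin(1)] csum_map_right[OF lin(2)] M.coact_at_in chom_coact_at[OF f] chom_coact_at[OF g])
  qed
  moreover have "?h ` cspace (csum M N) \<subseteq> cspace P"
    by (rule csum_map_in[OF lin]) (use f g in \<open>auto simp: chom_def\<close>)
  ultimately show ?thesis unfolding chom_def by auto
qed

definition ft_map :: "nat \<Rightarrow> ((nat \<Rightarrow>\<^sub>0 'k::field) \<Rightarrow> (nat \<Rightarrow>\<^sub>0 'k) \<Rightarrow> (nat \<Rightarrow>\<^sub>0 'k)) \<Rightarrow> (nat \<Rightarrow>\<^sub>0 'k) \<Rightarrow> (nat \<Rightarrow>\<^sub>0 'k)"
  where "ft_map m h = lin_ext (\<lambda>a. h (bvec (a div m)) (bvec (a mod m)))"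

lemma is_linear_ft_map [simp]: "is_linear (ft_map m h)"
  by (simp add: ft_map_def)

text \<open>The universal property of the tensor product. An index \<open>i * m + j\<close> is
  decoded by division with remainder, which needs \<open>j < m\<close>; hence the condition on
  \<open>v\<close>.\<close>

lemma ft_map_ft:
  assumes "\<And>v. is_linear (\<lambda>u. h u v)" "\<And>u. is_linear (h u)" "v \<in> cspace N"
  shows "ft_map (cdim N) h (ft (cdim N) u v) = h u v"
proof (rule linear_eqI[OF is_linear_compose[OF is_linear_ft_map is_linear_ft_left] assms(1)])
  fix a
  show "ft_map (cdim N) h (ft (cdim N) (bvec a) v) = h (bvec a) v"
    by (rule linear_eq_span_on[OF is_linear_compose[OF is_linear_ft_map is_linear_ft_right] assms(2)
          assms(3)[unfolded cspace_def]])
      (simp add: ft_map_def)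
qed

subsection \<open>The tensor product is a monoidal structure\<close>

text \<open>In row-major order the indices agree: (a m + b) p + c = a (m p) + (b p + c). The
  associator is therefore the identity map.\<close>

lemma ft_assoc: "w \<in> cspace P \<Longrightarrow> ft (cdim P) (ft (cdim N) u v) w = ft (cdim N * cdim P) u (ft (cdim P) v w)"
proof -
  have a: "ft p (ft m (bvec a) (bvec b)) w = ft (m * p) (bvec a) (ft p (bvec b) w)" for p m a b
    and w :: "nat \<Rightarrow>\<^sub>0 'a"
    by (rule linear_eqI[OF is_linear_ft_right is_linear_compose[OF is_linear_ft_right is_linear_ft_right]])
      (simp add: algebra_simps)
  have b: "ft p (ft m (bvec a) v) w = ft (m * p) (bvec a) (ft p v w)" for p m a
    and v w :: "nat \<Rightarrow>\<^sub>0 'a"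
    by (rule linear_eqI[OF is_linear_compose[OF is_linear_ft_left is_linear_ft_right]
          is_linear_compose[OF is_linear_ft_right is_linear_ft_left] a])
  show ?thesis
    by (rule linear_eqI[OF is_linear_compose[OF is_linear_ft_left is_linear_ft_left] is_linear_ft_left b])
qed

lemma ft_shift_left: "ft m (shift k u) v = shift (k * m) (ft m u v)"
proof -
  have a: "ft m (shift k (bvec a)) v = shift (k * m) (ft m (bvec a) v)" for a
    by (rule linear_eqI[OF is_linear_ft_right is_linear_compose[OF is_linear_shift is_linear_ft_right]])
      (simp add: algebra_simps)
  show ?thesis
    by (rule linear_eqI[OF is_linear_compose[OF is_linear_ft_left is_linear_shift]
          is_linear_compose[OF is_linear_shift is_linear_ft_left] a])
qed

lemma bij_betw_id_cspace: "cdim M = cdim N \<Longrightarrow> bij_betw (\<lambda>v. v) (cspace M) (cspace N)"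
  by (simp add: cspace_def bij_betw_def)

lemma coact_at_cunit: "coact_at cunit p v = (if p = (0, 0) then v else 0)"
  by (auto simp: coact_at_def cunit_def hunit_def lookup_single when_def)

lemma xop_cunit: "xop n cunit v = 0"
  by (simp add: xop_def coact_at_cunit)

lemma cdim_cunit [simp]: "cdim cunit = 1"
  by (simp add: cunit_def)

lemma ft_unit_left: "ft m (bvec 0) v = v"
  by (rule linear_eqI[OF is_linear_ft_right is_linear_id(2)]) simp

lemma ft_unit_right: "ft (Suc 0) v (bvec 0) = v"
  by (rule linear_eqI[OF is_linear_ft_left is_linear_id(2)]) simp

locale root_of_unity =
  fixes n :: nat and q :: "'k::field"
  assumes n_pos: "n > 0" and q_n: "q ^ n = 1"
begin

lemma tensor_pairI: "is_comodule n M \<Longrightarrow> is_comodule n N \<Longrightarrow> tensor_pair n M N q"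
  by (simp add: tensor_pair_def tensor_pair_axioms_def comodule_pair_def comodule_def q_n)

lemma comodule_pairI: "is_comodule n M \<Longrightarrow> is_comodule n N \<Longrightarrow> comodule_pair n M N"
  by (simp add: comodule_pair_def comodule_def)

abbreviation ct (infixl "\<otimes>c" 70) where "M \<otimes>c N \<equiv> ctensor n q M N"
abbreviation cs (infixl "\<oplus>c" 65) where "M \<oplus>c N \<equiv> csum M N"

lemma is_comodule_ct: "is_comodule n M \<Longrightarrow> is_comodule n N \<Longrightarrow> is_comodule n (M \<otimes>c N)"
  by (rule tensor_pair.is_comodule_ctensor[OF tensor_pairI])

lemma is_comodule_cs: "is_comodule n M \<Longrightarrow> is_comodule n N \<Longrightarrow> is_comodule n (M \<oplus>c N)"
  by (rule comodule_pair.is_comodule_csum[OF comodule_pairI])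

lemma iso_assoc:
  assumes M: "is_comodule n M" and N: "is_comodule n N" and P: "is_comodule n P"
  shows "comodule_iso ((M \<otimes>c N) \<otimes>c P) (M \<otimes>c (N \<otimes>c P))"
proof -
  interpret MN: tensor_pair n M N q by (rule tensor_pairI[OF M N])
  interpret NP: tensor_pair n N P q by (rule tensor_pairI[OF N P])
  interpret L: tensor_pair n "M \<otimes>c N" P q by (rule tensor_pairI[OF is_comodule_ct[OF M N] P])
  interpret R: tensor_pair n M "N \<otimes>c P" q by (rule tensor_pairI[OF M is_comodule_ct[OF N P]])
  let ?S = "{ft (cdim P) (ft (cdim N) u v) w |u v w. (\<exists>i. hmg M i u) \<and> (\<exists>i. hmg N i v) \<and> (\<exists>i. hmg P i w)}"
  have S: "cspace ((M \<otimes>c N) \<otimes>c P) \<subseteq> pm.span ?S"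
  proof -
    have "ft (cdim P) x w \<in> pm.span ?S" if x: "x \<in> cspace (M \<otimes>c N)" and w: "w \<in> cspace P" for x w
    proof -
      let ?A = "{ft (cdim N) u v |u v. (\<exists>i<n. hmg M i u) \<and> (\<exists>j<n. hmg N j v)}"
      have "ft (cdim P) x w \<in> pm.span {ft (cdim P) a b |a b. a \<in> ?A \<and> b \<in> {w. \<exists>i<n. hmg P i w}}"
        by (rule span_ft) (use x w MN.ctensor_span_hmg NP.N.in_span_hmg in auto)
      also have "\<dots> \<subseteq> pm.span ?S" by (rule pm.span_mono) blast
      finally show ?thesis .
    qed
    then show ?thesis
      unfolding cspace_ctensor_span[of n q "M \<otimes>c N" P] by (intro pm.span_minimal) auto
  qed
  have "chom ((M \<otimes>c N) \<otimes>c P) (M \<otimes>c (N \<otimes>c P)) (\<lambda>v. v)"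
  proof (rule chomI[OF L.comodule_ctensor R.comodule_ctensor is_linear_id(2) S])
    fix x assume "x \<in> ?S"
    then obtain u v w i j k where x: "x = ft (cdim P) (ft (cdim N) u v) w"
      and h: "hmg M i u" "hmg N j v" "hmg P k w" by blast
    have x': "x = ft (cdim (N \<otimes>c P)) u (ft (cdim P) v w)"
      using x ft_assoc[OF hmg_cspace[OF h(3)]] by simp
    have hl: "hmg (M \<otimes>c N) ((i + j) mod n) (ft (cdim N) u v)" by (rule MN.hmg_ft[OF h(1,2)])
    have hr: "hmg (N \<otimes>c P) ((j + k) mod n) (ft (cdim P) v w)" by (rule NP.hmg_ft[OF h(2,3)])
    have "hmg ((M \<otimes>c N) \<otimes>c P) ((i + j + k) mod n) x"
      using L.hmg_ft[OF hl h(3)] by (simp add: x mod_simps)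
    moreover have "hmg (M \<otimes>c (N \<otimes>c P)) ((i + j + k) mod n) x"
      using R.hmg_ft[OF h(1) hr] by (simp add: x' mod_simps add.assoc)
    ultimately show "\<exists>i. hmg (M \<otimes>c N \<otimes>c P) i x \<and> hmg (M \<otimes>c (N \<otimes>c P)) i x" by blast
    have wP: "w \<in> cspace P" "xop n P w \<in> cspace P"
      using h(3) NP.N.xop_in by (auto simp: hmg_cspace)
    \<comment> \<open>With tensor signs omitted, both sides expand to (Xu) v w + q^i u (Xv) w + q^(i
      + j) u v (Xw); the reduction of i + j modulo n is absorbed by \<open>q_mod\<close>.\<close>
    show "xop n (M \<otimes>c N \<otimes>c P) x = xop n (M \<otimes>c (N \<otimes>c P)) x"
      apply (subst x)
      apply (subst x')
      unfolding L.xop_ft[OF hl h(3)] R.xop_ft[OF h(1) hr] MN.xop_ft[OF h(1,2)] NP.xop_ft[OF h(2,3)]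
      by (simp add: ft_add ft_pscale ft_assoc wP MN.q_mod power_add pm.scale_right_distrib add.assoc)
  qed
  then show ?thesis
    by (rule comodule_isoI) (simp add: bij_betw_id_cspace mult.assoc)
qed

lemma is_comodule_cunit: "is_comodule n (cunit :: 'k comodule)"
  and hmg_cunit: "hmg (cunit :: 'k comodule) 0 (bvec 0)"
proof -
  let ?S = "\<lambda>i. if i = 0 then {bvec 0 :: nat \<Rightarrow>\<^sub>0 'k} else {}"
  have lin: "is_linear (coact (cunit :: 'k comodule))"
    by (simp add: cunit_def is_linear_tens_left)
  have pow: "(xop n cunit ^^ l) v = (if l = 0 then v else 0)" for l and v :: "nat \<Rightarrow>\<^sub>0 'k"
    by (cases l) (simp_all add: xop_cunit)
  have U: "(\<Union>i<n. ?S i) = bvec ` {..<1}"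
    using n_pos by (auto split: if_splits)
  have sp: "cspace (cunit :: 'k comodule) \<subseteq> pm.span (\<Union>i<n. ?S i)"
    by (subst U) (simp add: cspace_def span_on_eq_span)
  note * = is_comoduleI[of "cunit :: 'k comodule" n ?S, OF lin _ _ _ sp]
  show "is_comodule n (cunit :: 'k comodule)"
    by (rule *(1)) (auto simp: coact_at_cunit pow cspace_def xop_cunit pm.span_zero split: if_splits)
  show "hmg (cunit :: 'k comodule) 0 (bvec 0)"
    by (auto simp: hmg_def coact_at_cunit cspace_def)
qed

lemma cspace_cunit: "cspace (cunit :: 'k comodule) = pm.span {bvec 0}"
  by (simp add: cspace_def span_on_eq_span lessThan_Suc)

lemma iso_unit_left:
  assumes M: "is_comodule n M"
  shows "comodule_iso (cunit \<otimes>c M) M"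
proof -
  interpret tensor_pair n cunit M q by (rule tensor_pairI[OF is_comodule_cunit M])
  let ?S = "{v. \<exists>i<n. hmg M i v}"
  have "cspace (cunit \<otimes>c M) = cspace M" by (simp add: cspace_def)
  then have S: "cspace (cunit \<otimes>c M) \<subseteq> pm.span ?S" using N.in_span_hmg by auto
  have "chom (cunit \<otimes>c M) M (\<lambda>v. v)"
  proof (rule chomI[OF comodule_ctensor N.comodule_axioms is_linear_id(2) S])
    fix v assume "v \<in> ?S"
    then obtain i where i: "i < n" "hmg M i v" by blast
    then show "\<exists>i. hmg (cunit \<otimes>c M) i v \<and> hmg M i v"
      using hmg_ft[OF hmg_cunit i(2)] by (auto simp: ft_unit_left)
    show "xop n (cunit \<otimes>c M) v = xop n M v"
      using xop_ft[OF hmg_cunit i(2)] by (simp add: ft_unit_left xop_cunit)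
  qed
  then show ?thesis by (rule comodule_isoI) (simp add: bij_betw_id_cspace)
qed

lemma iso_unit_right:
  assumes M: "is_comodule n M"
  shows "comodule_iso (M \<otimes>c cunit) M"
proof -
  interpret tensor_pair n M cunit q by (rule tensor_pairI[OF M is_comodule_cunit])
  let ?S = "{v. \<exists>i<n. hmg M i v}"
  have "cspace (M \<otimes>c cunit) = cspace M" by (simp add: cspace_def)
  then have S: "cspace (M \<otimes>c cunit) \<subseteq> pm.span ?S" using M.in_span_hmg by auto
  have "chom (M \<otimes>c cunit) M (\<lambda>v. v)"
  proof (rule chomI[OF comodule_ctensor M.comodule_axioms is_linear_id(2) S])
    fix v assume "v \<in> ?S"
    then obtain i where i: "i < n" "hmg M i v" by blast
    then show "\<exists>i. hmg (M \<otimes>c cunit) i v \<and> hmg M i v"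
      using hmg_ft[OF i(2) hmg_cunit] by (auto simp: ft_unit_right)
    show "xop n (M \<otimes>c cunit) v = xop n M v"
      using xop_ft[OF i(2) hmg_cunit] by (simp add: ft_unit_right xop_cunit)
  qed
  then show ?thesis by (rule comodule_isoI) (simp add: bij_betw_id_cspace)
qed

text \<open>The summands of the first factor occupy consecutive blocks of indices in the tensor
  product, so the identity map is the isomorphism.\<close>

lemma iso_distrib_right:
  assumes M: "is_comodule n M" and N: "is_comodule n N" and P: "is_comodule n P"
  shows "comodule_iso ((M \<oplus>c N) \<otimes>c P) ((M \<otimes>c P) \<oplus>c (N \<otimes>c P))"
proof -
  interpret MN: comodule_pair n M N by (rule comodule_pairI[OF M N])
  interpret MP: tensor_pair n M P q by (rule tensor_pairI[OF M P])
  interpret NP: tensor_pair n N P q by (rule tensor_pairI[OF N P])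
  interpret L: tensor_pair n "M \<oplus>c N" P q by (rule tensor_pairI[OF is_comodule_cs[OF M N] P])
  interpret R: comodule_pair n "M \<otimes>c P" "N \<otimes>c P"
    by (rule comodule_pairI[OF is_comodule_ct[OF M P] is_comodule_ct[OF N P]])
  let ?U = "\<Union>i<n. {u. hmg M i u} \<union> shift (cdim M) ` {v. hmg N i v}"
  let ?S = "{ft (cdim P) u w |u w. u \<in> ?U \<and> w \<in> {w. \<exists>i<n. hmg P i w}}"
  have S: "cspace ((M \<oplus>c N) \<otimes>c P) \<subseteq> pm.span ?S"
  proof -
    have "ft (cdim P) x w \<in> pm.span ?S" if "x \<in> cspace (M \<oplus>c N)" "w \<in> cspace P" for x w
      by (rule span_ft) (use that MN.csum_span_hmg MP.N.in_span_hmg in auto)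
    then show ?thesis
      unfolding cspace_ctensor_span[of n q "M \<oplus>c N" P] by (intro pm.span_minimal) auto
  qed
  have "chom ((M \<oplus>c N) \<otimes>c P) ((M \<otimes>c P) \<oplus>c (N \<otimes>c P)) (\<lambda>v. v)"
  proof (rule chomI[OF L.comodule_ctensor R.comodule_csum is_linear_id(2) S])
    fix x assume "x \<in> ?S"
    then obtain a w k i where x: "x = ft (cdim P) a w" and w: "hmg P k w"
      and a: "hmg M i a \<or> (\<exists>v. hmg N i v \<and> a = shift (cdim M) v)" by blast
    have "(\<exists>i. hmg ((M \<oplus>c N) \<otimes>c P) i x \<and> hmg ((M \<otimes>c P) \<oplus>c (N \<otimes>c P)) i x) \<and>
      xop n ((M \<oplus>c N) \<otimes>c P) x = xop n ((M \<otimes>c P) \<oplus>c (N \<otimes>c P)) x"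
      using a
    proof (elim disjE exE conjE)
      assume a: "hmg M i a"
      have l: "hmg ((M \<oplus>c N) \<otimes>c P) ((i + k) mod n) x"
        unfolding x by (rule L.hmg_ft[OF MN.hmg_csum(1)[OF a] w])
      have r: "hmg (M \<otimes>c P) ((i + k) mod n) x" unfolding x by (rule MP.hmg_ft[OF a w])
      have "xop n ((M \<oplus>c N) \<otimes>c P) x = xop n (M \<otimes>c P) x"
        unfolding x L.xop_ft[OF MN.hmg_csum(1)[OF a] w] MP.xop_ft[OF a w]
        by (simp add: MN.xop_csum_left hmg_cspace[OF a])
      with l R.hmg_csum(1)[OF r] show ?thesis
        using R.xop_csum_left[OF hmg_cspace[OF r]] by auto
    next
      fix v assume v: "hmg N i v" and a: "a = shift (cdim M) v"
      have x': "x = shift (cdim (M \<otimes>c P)) (ft (cdim P) v w)"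
        by (simp add: x a ft_shift_left)
      have l: "hmg ((M \<oplus>c N) \<otimes>c P) ((i + k) mod n) x"
        unfolding x a by (rule L.hmg_ft[OF MN.hmg_csum(2)[OF v] w])
      have r: "hmg (N \<otimes>c P) ((i + k) mod n) (ft (cdim P) v w)" by (rule NP.hmg_ft[OF v w])
      have "xop n ((M \<oplus>c N) \<otimes>c P) x = shift (cdim (M \<otimes>c P)) (xop n (N \<otimes>c P) (ft (cdim P) v w))"
        unfolding x a L.xop_ft[OF MN.hmg_csum(2)[OF v] w] NP.xop_ft[OF v w]
        by (simp add: MN.xop_csum_right ft_shift_left is_linearD[OF is_linear_shift])
      also have "\<dots> = xop n ((M \<otimes>c P) \<oplus>c (N \<otimes>c P)) x"
        unfolding x' by (rule R.xop_csum_right[symmetric])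
      finally show ?thesis using l R.hmg_csum(2)[OF r] unfolding x' by auto
    qed
    then show "\<exists>i. hmg ((M \<oplus>c N) \<otimes>c P) i x \<and> hmg ((M \<otimes>c P) \<oplus>c (N \<otimes>c P)) i x"
      "xop n ((M \<oplus>c N) \<otimes>c P) x = xop n ((M \<otimes>c P) \<oplus>c (N \<otimes>c P)) x" by auto
  qed
  then show ?thesis
    by (rule comodule_isoI) (simp add: bij_betw_id_cspace algebra_simps)
qed

lemma chom_ctensor:
  assumes M: "is_comodule n M" and N: "is_comodule n N" and P: "is_comodule n P" and Q: "is_comodule n Q"
    and f: "chom M P f" and g: "chom N Q g"
  shows "chom (M \<otimes>c N) (P \<otimes>c Q) (ft_map (cdim N) (\<lambda>u v. ft (cdim Q) (f u) (g v)))"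
    and "u \<in> cspace M \<Longrightarrow> v \<in> cspace N \<Longrightarrow>
      ft_map (cdim N) (\<lambda>u v. ft (cdim Q) (f u) (g v)) (ft (cdim N) u v) = ft (cdim Q) (f u) (g v)"
proof -
  interpret MN: tensor_pair n M N q by (rule tensor_pairI[OF M N])
  interpret PQ: tensor_pair n P Q q by (rule tensor_pairI[OF P Q])
  let ?h = "\<lambda>u v. ft (cdim Q) (f u) (g v)"
  have lin: "is_linear f" "is_linear g" using f g by (auto simp: chom_def)
  have h: "ft_map (cdim N) ?h (ft (cdim N) u v) = ?h u v" if "v \<in> cspace N" for u v
    by (rule ft_map_ft[OF is_linear_compose[OF is_linear_ft_left lin(1)]
          is_linear_compose[OF is_linear_ft_right lin(2)] that])
  show "u \<in> cspace M \<Longrightarrow> v \<in> cspace N \<Longrightarrow> ft_map (cdim N) ?h (ft (cdim N) u v) = ?h u v"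
    by (rule h)
  show "chom (M \<otimes>c N) (P \<otimes>c Q) (ft_map (cdim N) ?h)"
  proof (rule chomI[OF MN.comodule_ctensor PQ.comodule_ctensor is_linear_ft_map MN.ctensor_span_hmg])
    fix x assume "x \<in> {ft (cdim N) u v |u v. (\<exists>i<n. hmg M i u) \<and> (\<exists>j<n. hmg N j v)}"
    then obtain u v i j where x: "x = ft (cdim N) u v" and u: "hmg M i u" and v: "hmg N j v" by blast
    note vN = hmg_cspace[OF v]
    show "\<exists>i. hmg (M \<otimes>c N) i x \<and> hmg (P \<otimes>c Q) i (ft_map (cdim N) ?h x)"
      using MN.hmg_ft[OF u v] PQ.hmg_ft[OF chom_hmg[OF f u] chom_hmg[OF g v]]
      unfolding x h[OF vN] by blast
    show "ft_map (cdim N) ?h (xop n (M \<otimes>c N) x) = xop n (P \<otimes>c Q) (ft_map (cdim N) ?h x)"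
      unfolding x h[OF vN] MN.xop_ft[OF u v] PQ.xop_ft[OF chom_hmg[OF f u] chom_hmg[OF g v]]
        is_linear_addD[OF is_linear_ft_map] is_linear_scaleD[OF is_linear_ft_map] h[OF vN] h[OF MN.N.xop_in[OF vN]]
        chom_xop[OF f hmg_cspace[OF u]] chom_xop[OF g vN] ..
  qed
qed

text \<open>Every pure tensor is hit because both factors are onto, and the dimensions agree, so
  injectivity comes for free. The product of isomorphism classes rests on this.\<close>

lemma iso_ctensor_cong:
  assumes M: "is_comodule n M" and N: "is_comodule n N" and P: "is_comodule n P" and Q: "is_comodule n Q"
    and MP: "comodule_iso M P" and NQ: "comodule_iso N Q"
  shows "comodule_iso (M \<otimes>c N) (P \<otimes>c Q)"
proof -
  obtain f where f: "chom M P f" "bij_betw f (cspace M) (cspace P)"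
    using MP unfolding comodule_iso_iff chom_def by (metis bij_betwE)
  obtain g where g: "chom N Q g" "bij_betw g (cspace N) (cspace Q)"
    using NQ unfolding comodule_iso_iff chom_def by (metis bij_betwE)
  note h = chom_ctensor[OF M N P Q f(1) g(1)]
  let ?h = "ft_map (cdim N) (\<lambda>u v. ft (cdim Q) (f u) (g v))"
  have "bij_betw ?h (cspace (M \<otimes>c N)) (cspace (P \<otimes>c Q))"
  proof (rule bij_betw_of_spanning)
    show "?h ` cspace (M \<otimes>c N) \<subseteq> cspace (P \<otimes>c Q)" using chom_in[OF h(1)] by blast
    have "ft (cdim Q) u v \<in> ?h ` cspace (M \<otimes>c N)" if "u \<in> cspace P" "v \<in> cspace Q" for u v
    proof -
      have "u \<in> f ` cspace M" "v \<in> g ` cspace N"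
        using that bij_betw_imp_surj_on[OF f(2)] bij_betw_imp_surj_on[OF g(2)] by simp_all
      then obtain u' v' where u: "u' \<in> cspace M" "u = f u'" and v: "v' \<in> cspace N" "v = g v'"
        by blast
      show ?thesis
        by (rule image_eqI[of _ _ "ft (cdim N) u' v'"]) (simp_all only: h(2) ft_in_ctensor u v)
    qed
    then show "cspace (P \<otimes>c Q) \<subseteq> pm.span (?h ` cspace (M \<otimes>c N))"
      unfolding cspace_ctensor_span[of n q P Q] by (intro pm.span_mono) blast
  qed (simp_all add: comodule_iso_cdim[OF MP] comodule_iso_cdim[OF NQ])
  with h(1) show ?thesis by (rule comodule_isoI)
qed

lemma chom_csum_left: "is_comodule n M \<Longrightarrow> chom M (M \<oplus>c N) (\<lambda>v. v)"
  by (auto simp: chom_def cspace_mono_csum coact_at_csum_left[OF comodule.linear_coact[OF comodule.intro]])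

lemma chom_csum_right: "is_comodule n N \<Longrightarrow> chom N (M \<oplus>c N) (shift (cdim M))"
  by (auto simp: chom_def shift_in_csum coact_at_csum_right[OF comodule.linear_coact[OF comodule.intro]])

text \<open>Here the indices of the two summands are interleaved in the tensor product, so a genuine
  map is needed; it is assembled from the two inclusions tensored with the identity of
  \<open>M\<close>.\<close>

lemma iso_distrib_left:
  assumes M: "is_comodule n M" and N: "is_comodule n N" and P: "is_comodule n P"
  shows "comodule_iso ((M \<otimes>c N) \<oplus>c (M \<otimes>c P)) (M \<otimes>c (N \<oplus>c P))"
proof -
  interpret S: comodule_pair n "M \<otimes>c N" "M \<otimes>c P"
    by (rule comodule_pairI[OF is_comodule_ct[OF M N] is_comodule_ct[OF M P]])
  have NP: "is_comodule n (N \<oplus>c P)" by (rule is_comodule_cs[OF N P])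
  have R: "comodule n (M \<otimes>c (N \<oplus>c P))" by (rule comodule.intro[OF is_comodule_ct[OF M NP]])
  let ?m = "cdim (N \<oplus>c P)"
  let ?f = "ft_map (cdim N) (\<lambda>u v. ft ?m u v)" and ?g = "ft_map (cdim P) (\<lambda>u w. ft ?m u (shift (cdim N) w))"
  note f = chom_ctensor[OF M N M NP chom_id chom_csum_left[OF N]]
  note g = chom_ctensor[OF M P M NP chom_id chom_csum_right[OF P]]
  let ?h = "csum_map (cdim (M \<otimes>c N)) ?f ?g"
  have h: "chom ((M \<otimes>c N) \<oplus>c (M \<otimes>c P)) (M \<otimes>c (N \<oplus>c P)) ?h"
    by (rule S.chom_csum[OF R f(1) g(1)])
  have "bij_betw ?h (cspace ((M \<otimes>c N) \<oplus>c (M \<otimes>c P))) (cspace (M \<otimes>c (N \<oplus>c P)))"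
  proof (rule bij_betw_of_spanning)
    let ?I = "?h ` cspace ((M \<otimes>c N) \<oplus>c (M \<otimes>c P))"
    show "?I \<subseteq> cspace (M \<otimes>c (N \<oplus>c P))" using chom_in[OF h] by blast
    have 1: "ft ?m u v \<in> ?I" if "u \<in> cspace M" "v \<in> cspace N" for u v
      by (rule image_eqI[of _ _ "ft (cdim N) u v"])
        (use that in \<open>simp_all add: csum_map_left ft_in_ctensor f(2) cspace_mono_csum del: cdim_ctensor cdim_csum\<close>)
    have 2: "ft ?m u (shift (cdim N) v) \<in> ?I" if "u \<in> cspace M" "v \<in> cspace P" for u v
      by (rule image_eqI[of _ _ "shift (cdim (M \<otimes>c N)) (ft (cdim P) u v)"])
        (use that in \<open>simp_all add: csum_map_right ft_in_ctensor g(2) shift_in_csum del: cdim_ctensor cdim_csum\<close>)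
    have "ft ?m u x \<in> pm.span ?I" if "u \<in> cspace M" "x \<in> cspace (N \<oplus>c P)" for u x
    proof -
      have "ft ?m u x \<in> pm.span {ft ?m a b |a b. a \<in> cspace M \<and> b \<in> cspace N \<union> shift (cdim N) ` cspace P}"
        by (rule span_ft) (use that cspace_csum_span in \<open>auto intro: pm.span_base\<close>)
      also have "\<dots> \<subseteq> pm.span ?I" by (rule pm.span_mono) (use 1 2 in blast)
      finally show ?thesis .
    qed
    then show "cspace (M \<otimes>c (N \<oplus>c P)) \<subseteq> pm.span ?I"
      unfolding cspace_ctensor_span[of n q M "N \<oplus>c P"] by (intro pm.span_minimal) auto
  qed (simp_all add: algebra_simps)
  with h show ?thesis by (rule comodule_isoI)
qed

end

section \<open>Direct summands from retractions\<close>

section \<open>Splitting off summands\<close>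

lemma chom_add_coact:
  "chom M N f \<Longrightarrow> v \<in> cspace M \<Longrightarrow> f v = 0 \<Longrightarrow> is_linear (coact N) \<Longrightarrow> f (coact_at M p v) = 0"
  by (simp add: chom_coact_at is_linear_zeroD[OF is_linear_coact_at])

text \<open>The complement is the kernel of \<pi>. It is closed under the coaction because \<pi> is
  a comodule map, but it sits inside the coordinate space of \<open>M\<close> and has to be moved to
  a coordinate space of its own.\<close>

lemma idempotent_splitting:
  assumes V: "is_comodule n V" and M: "is_comodule n M" and i: "chom V M \<iota>" and p: "chom M V \<pi>"
    and pi: "\<And>v. v \<in> cspace V \<Longrightarrow> \<pi> (\<iota> v) = v"
  shows "\<exists>M'. is_comodule n M' \<and> comodule_iso (csum V M') M"
proof -
  interpret V: comodule n V by standard (rule V)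
  interpret M: comodule n M by standard (rule M)
  note il = chom_linear[OF i] and pl = chom_linear[OF p]
  define U where "U = {w \<in> cspace M. \<pi> w = 0}"
  have U: "pm.subspace U"
    using subspace_cspace[of M] pl unfolding U_def by (auto simp: pm.subspace_def is_linearD)
  obtain B where B: "B \<subseteq> U" "\<not> pm.dependent B" "U \<subseteq> pm.span B"
    by (rule pm.basis_exists)
  have spanB: "pm.span B = U"
    using B pm.span_minimal[OF B(1) U] by blast
  have "finite B"
    by (rule finite_independent_span_on[OF _ _ B(2), of "{..<cdim M}"])
      (use B(1) in \<open>auto simp: U_def cspace_def\<close>)
  then obtain b where b: "bij_betw b {0..<card B} B" using ex_bij_betw_nat_finite by blast
  define m where "m = card B"
  have b_surj: "\<exists>a<m. x = b a" if "x \<in> B" for x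
  proof -
    have "x \<in> b ` {0..<card B}" using that bij_betw_imp_surj_on[OF b] by simp
    then show ?thesis by (auto simp: m_def)
  qed
  \<comment> \<open>\<open>h\<close> and \<open>g\<close> are mutually inverse between k^m, with m
    the dimension of the kernel \<open>U\<close>, and \<open>U\<close>; outside \<open>U\<close> the
    map \<open>g\<close> is an arbitrary linear extension.\<close>
  define h where "h = lin_ext b"
  have hl: "is_linear h" by (simp add: h_def)
  obtain g where gl: "is_linear g" and g0: "\<forall>x\<in>B. g x = bvec (inv_into {0..<card B} b x)"
    using pmp.linear_independent_extend[OF B(2), of "\<lambda>x. bvec (inv_into {0..<card B} b x)"] by blast
  have gb: "g (b a) = bvec a" if "a < m" for a
    using g0 b that by (simp add: m_def bij_betwE bij_betw_inv_into_left)
  have gh: "g (h v) = v" if "v \<in> span_on {..<m}" for v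
    by (rule linear_eq_span_on[OF is_linear_compose[OF gl hl] is_linear_id(2) that])
      (simp add: h_def gb)
  have hg: "h (g w) = w" if "w \<in> U" for w
  proof (rule linear_eq_span[OF is_linear_compose[OF hl gl] is_linear_id(2)])
    show "w \<in> pm.span B" using that spanB by simp
    fix x assume "x \<in> B"
    then obtain a where "a < m" "x = b a" using b_surj by blast
    then show "h (g x) = x" by (simp add: gb h_def)
  qed
  have hU: "h v \<in> U" if "v \<in> span_on {..<m}" for v
  proof (rule linear_in_subspace[OF hl U that])
    fix a assume "a \<in> {..<m}"
    then have "b a \<in> B" using b by (auto simp: m_def bij_betw_def)
    then show "h (bvec a) \<in> U" using B(1) by (auto simp: h_def)
  qed
  have gU: "g w \<in> span_on {..<m}" if "w \<in> U" for w
  proof -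
    have "pm.span B \<subseteq> {w. g w \<in> span_on {..<m}}"
    proof (rule pm.span_minimal[OF _ subspace_vimage[OF gl subspace_span_on]], rule subsetI)
      fix x assume "x \<in> B"
      then obtain a where "a < m" "x = b a" using b_surj by blast
      then show "x \<in> {w. g w \<in> span_on {..<m}}" by (simp add: gb)
    qed
    then show ?thesis using that spanB by auto
  qed
  have EU: "coact_at M p w \<in> U" if "w \<in> U" for w p
    using that chom_add_coact[OF assms(4) _ _ V.linear_coact, of w p] M.coact_at_in
    unfolding U_def by simp
  define M' where "M' = \<lparr>cdim = m, coact = (\<lambda>v. tens_map g id (coact M (h v)))\<rparr>"
  have cs: "cspace M' = span_on {..<m}" by (simp add: cspace_def M'_def)
  have E': "coact_at M' p v = g (coact_at M p (h v))" for p v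
    by (simp add: M'_def coact_at_def slice_tens_map[OF gl])
  have lin': "is_linear (coact M')"
    unfolding M'_def by (simp add: is_linear_compose[OF is_linear_tens_map is_linear_compose[OF M.linear_coact hl]])
  have com': "is_comodule n M'"
    unfolding is_comodule_iff
  proof (intro conjI ballI allI impI lin')
    fix v and p :: path assume v: "v \<in> cspace M'"
    show "coact_at M' p v \<in> cspace M'" using v by (simp add: E' cs gU EU hU)
  next
    fix v and p :: path assume v: "v \<in> cspace M'" and "p \<notin> paths n"
    then show "coact_at M' p v = 0"
      using hU[of v] by (simp add: E' cs M.coact_at_outside U_def is_linear_zeroD[OF gl])
  next
    fix v i l j k assume v: "v \<in> cspace M'"
    have "h v \<in> U" using v cs hU by simp
    then have "h (g (coact_at M (i, l) (h v))) = coact_at M (i, l) (h v)" "h v \<in> cspace M"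
      using hg[OF EU] by (simp_all add: U_def)
    then show "coact_at M' (j, k) (coact_at M' (i, l) v) =
        (if i < n \<and> j = (i + l) mod n then coact_at M' (i, l + k) v else 0)"
      using M.coact_at_coact_at[of "h v" j k i l]
      by (simp add: E' is_linear_zeroD[OF gl])
  next
    fix v assume v: "v \<in> cspace M'"
    then have "h v \<in> cspace M" using hU cs by (simp add: U_def)
    with v show "(\<Sum>i<n. coact_at M' (i, 0) v) = v"
      by (simp add: E' is_linear_sumD[OF gl, symmetric] M.sum_coact_at gh cs)
  qed
  interpret VM': comodule_pair n V M' by standard (rule com')
  have hhom: "chom M' M h"
    unfolding chom_def
  proof (intro conjI hl ballI allI)
    fix v and p :: path assume v: "v \<in> cspace M'"
    then have "h v \<in> U" using cs hU by simp
    then show "h v \<in> cspace M" "h (coact_at M' p v) = coact_at M p (h v)"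
      by (simp add: U_def, simp add: E' hg EU)
  qed
  let ?F = "csum_map (cdim V) \<iota> h"
  \<comment> \<open>The inverse separates w into \<iota> (\<pi> w) and a remainder, which lies in
    the kernel because \<pi> \<iota> is the identity.\<close>
  let ?G = "\<lambda>w. \<pi> w + shift (cdim V) (g (w - \<iota> (\<pi> w)))"
  have Fhom: "chom (csum V M') M ?F" by (rule VM'.chom_csum[OF M.comodule_axioms i hhom])
  have resU: "w - \<iota> (\<pi> w) \<in> U" if "w \<in> cspace M" for w
    using that by (simp add: U_def pm.subspace_diff[OF subspace_cspace] chom_in[OF i] chom_in[OF p]
        is_linear_diffD[OF pl] pi)
  have Gl: "is_linear ?G"
    by (rule is_linear_add[OF pl is_linear_compose[OF is_linear_shift is_linear_compose[OF gl
            is_linear_minus[OF is_linear_id(2) is_linear_compose[OF il pl]]]]])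
  have GF: "?G (?F x) = x" if "x \<in> cspace (csum V M')" for x
  proof (rule linear_eq_span[OF is_linear_compose[OF Gl is_linear_csum_map] is_linear_id(2)])
    show "x \<in> pm.span (cspace V \<union> shift (cdim V) ` cspace M')"
      using that cspace_csum_span by blast
    fix a assume "a \<in> cspace V \<union> shift (cdim V) ` cspace M'"
    then consider "a \<in> cspace V" | v where "v \<in> cspace M'" "a = shift (cdim V) v" by blast
    then show "?G (?F a) = a"
    proof cases
      case 1
      then show ?thesis
        by (simp add: csum_map_left[OF il] pi is_linear_zeroD[OF gl] is_linear_zeroD[OF is_linear_shift])
    next
      case 2
      then have "h v \<in> U" using cs hU by simp
      then show ?thesis
        using 2 by (simp add: csum_map_right[OF hl] U_def is_linear_zeroD[OF il] gh cs)
    qed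
  qed
  have FG: "?F (?G w) = w" if "w \<in> cspace M" for w
    using that by (simp only: is_linear_addD[OF is_linear_csum_map] csum_map_left[OF il chom_in[OF p]]
        csum_map_right[OF hl] hg[OF resU]) simp
  have "bij_betw ?F (cspace (csum V M')) (cspace M)"
  proof (rule bij_betw_byWitness[where f' = ?G])
    show "\<forall>a\<in>cspace (csum V M'). ?G (?F a) = a" using GF by blast
    show "\<forall>a\<in>cspace M. ?F (?G a) = a" using FG by blast
    show "?F ` cspace (csum V M') \<subseteq> cspace M" using chom_in[OF Fhom] by blast
    show "?G ` cspace M \<subseteq> cspace (csum V M')"
    proof clarify
      fix w assume w: "w \<in> cspace M"
      show "?G w \<in> cspace (csum V M')"
        by (rule pm.subspace_add[OF subspace_cspace cspace_mono_csum[OF chom_in[OF p w]] shift_in_csum])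
          (simp add: cs gU resU[OF w])
    qed
  qed
  with com' Fhom show ?thesis using comodule_isoI by blast
qed

section \<open>Strings and their splitting off\<close>

section \<open>Uniserial comodules\<close>

text \<open>The comodule with basis \<open>f\<^sub>0, \<dots>, f\<^sub>l\<close>, where \<open>f\<^sub>j\<close> has degree \<open>t + j\<close> and is sent to \<open>f\<^sub>j\<^sub>+\<^sub>1\<close>.\<close>

definition uni :: "nat \<Rightarrow> nat \<Rightarrow> nat \<Rightarrow> 'k::field comodule" where
  "uni n t l = \<lparr>cdim = Suc l, coact = lin_ext (\<lambda>j. \<Sum>s\<le>l - j. bvec (j + s, ((t + j) mod n, s)))\<rparr>"

lemma cdim_uni [simp]: "cdim (uni n t l) = Suc l"
  by (simp add: uni_def)

lemma uni_mod: "uni n (t mod n) l = uni n t l"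
  by (simp add: uni_def mod_simps)

lemma linear_coact_uni: "is_linear (coact (uni n t l))"
  by (simp add: uni_def)

lemma coact_at_uni:
  "coact_at (uni n t l) (i, m) (bvec j) = (if i = (t + j) mod n \<and> m \<le> l - j then bvec (j + m) else 0)"
proof -
  have "coact_at (uni n t l) (i, m) (bvec j)
    = (\<Sum>s\<le>l - j. if s = m then if i = (t + j) mod n then bvec (j + m) else 0 else 0)"
    unfolding coact_at_def uni_def by (auto simp: is_linear_sumD intro!: sum.cong)
  then show ?thesis by (auto simp: sum.delta)
qed

text \<open>E(i, m) shifts coordinates by m: the coordinate with index \<open>k\<close> comes from
  index \<open>k - m\<close> and survives if the degree there is \<open>i\<close>. The condition
  \<open>m \<le> k\<close> keeps the subtraction from being truncated.\<close>

lemma lookup_coact_at_uni: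
  assumes "u \<in> cspace (uni n t l)"
  shows "Poly_Mapping.lookup (coact_at (uni n t l) (i, m) u) k =
    (if m \<le> k \<and> k \<le> l \<and> i = (t + (k - m)) mod n then Poly_Mapping.lookup u (k - m) else 0)"
proof -
  let ?P = "\<lambda>k. m \<le> k \<and> k \<le> l \<and> i = (t + (k - m)) mod n"
  have u: "u = (\<Sum>a\<in>Poly_Mapping.keys u. pscale (Poly_Mapping.lookup u a) (bvec a))"
    by (rule is_linear_expand)
  have "Poly_Mapping.lookup (coact_at (uni n t l) (i, m) u) k
      = (\<Sum>a\<in>Poly_Mapping.keys u. Poly_Mapping.lookup u a * Poly_Mapping.lookup (coact_at (uni n t l) (i, m) (bvec a)) k)"
    by (subst arg_cong[OF u, of "\<lambda>u. Poly_Mapping.lookup (coact_at (uni n t l) (i, m) u) k"])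
      (simp only: is_linear_sumD[OF is_linear_coact_at[OF linear_coact_uni]]
      is_linear_scaleD[OF is_linear_coact_at[OF linear_coact_uni]] lookup_sum lookup_pscale)
  also have "\<dots> = (\<Sum>a\<in>Poly_Mapping.keys u. if a = k - m then (if ?P k then Poly_Mapping.lookup u (k - m) else 0) else 0)"
  proof (rule sum.cong[OF refl])
    fix a assume "a \<in> Poly_Mapping.keys u"
    then have "a \<le> l" using assms by (auto simp: cspace_def span_on_def)
    then have *: "m \<le> l - a \<and> a + m = k \<longleftrightarrow> a = k - m \<and> m \<le> k \<and> k \<le> l" by linarith
    have h1: "i = (t + a) mod n \<and> m \<le> l - a \<and> a + m = k \<longleftrightarrow> a = k - m \<and> ?P k"
    proof (cases "a = k - m")
      case True
      show ?thesis using * unfolding True by blast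
    next
      case False
      then show ?thesis using * by blast
    qed
    have h2: "Poly_Mapping.lookup (coact_at (uni n t l) (i, m) (bvec a)) k
      = (if i = (t + a) mod n \<and> m \<le> l - a \<and> a + m = k then 1 else 0)"
      by (simp add: coact_at_uni lookup_single when_def)
    have h3: "(if A then if B then x else 0 else 0) = (if A \<and> B then x else 0)" for A B and x :: 'a
      by simp
    show "Poly_Mapping.lookup u a * Poly_Mapping.lookup (coact_at (uni n t l) (i, m) (bvec a)) k
      = (if a = k - m then (if ?P k then Poly_Mapping.lookup u (k - m) else 0) else 0)"
    proof (cases "a = k - m \<and> ?P k")
      case True
      have a: "a = k - m" using True by blast
      show ?thesis unfolding h2 h1 h3 if_P[OF True] unfolding a by (rule mult_1_right)
    next
      case False
      show ?thesis unfolding h2 h1 h3 if_not_P[OF False] by (rule mult_zero_right)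
    qed
  qed
  also have "\<dots> = (if ?P k then Poly_Mapping.lookup u (k - m) else 0)"
    by (auto simp: sum.delta in_keys_iff)
  finally show ?thesis .
qed

lemma mod_add_right_cancel: "(a + m) mod n = (b + m) mod n \<longleftrightarrow> a mod n = (b :: nat) mod n"
  unfolding nat_mod_eq_iff by (simp add: algebra_simps)

lemma funpow_eq_0:
  fixes D :: "('a \<Rightarrow>\<^sub>0 'k::field) \<Rightarrow> ('a \<Rightarrow>\<^sub>0 'k)"
  assumes "is_linear D" "(D ^^ a) v = 0" "a \<le> b"
  shows "(D ^^ b) v = 0"
proof -
  obtain c where b: "b = c + a" using assms(3) by (metis add.commute le_Suc_ex)
  show ?thesis
    by (simp add: b funpow_add assms(2) is_linear_zeroD[OF is_linear_funpow[OF assms(1)]])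
qed

text \<open>A coordinate functional that does not vanish on D^L v is corrected step by step until it
  kills all lower powers. The functional is delivered as a linear map \<open>g\<close> followed by
  the coordinate \<open>a\<close>.\<close>

lemma dual_functional:
  fixes D :: "(nat \<Rightarrow>\<^sub>0 'k::field) \<Rightarrow> (nat \<Rightarrow>\<^sub>0 'k)" and v :: "nat \<Rightarrow>\<^sub>0 'k" and L a :: nat
  assumes X: "is_linear D" and a: "Poly_Mapping.lookup ((D ^^ L) v) a \<noteq> 0" and Xv: "(D ^^ Suc L) v = 0"
  shows "\<exists>g. is_linear g \<and> (\<forall>s\<le>L. Poly_Mapping.lookup (g ((D ^^ s) v)) a = (if s = L then 1 else 0))"
proof -
  have zero: "(D ^^ s) v = 0" if "L < s" for s
    by (rule funpow_eq_0[OF X Xv]) (use that in simp)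
  have "\<exists>g. is_linear g \<and> (\<forall>s\<le>L. L \<le> s + k \<longrightarrow> Poly_Mapping.lookup (g ((D ^^ s) v)) a = (if s = L then 1 else 0))" for k
  proof (induction k)
    case 0
    show ?case
      by (rule exI[of _ "\<lambda>w. pscale (1 / Poly_Mapping.lookup ((D ^^ L) v) a) w"])
        (use a in \<open>auto simp: is_linear_scale lookup_pscale\<close>)
  next
    case (Suc k)
    then obtain g where g: "is_linear g"
      "\<And>s. s \<le> L \<Longrightarrow> L \<le> s + k \<Longrightarrow> Poly_Mapping.lookup (g ((D ^^ s) v)) a = (if s = L then 1 else 0)" by blast
    show ?case
    proof (cases "Suc k \<le> L")
      case False
      with g show ?thesis by (intro exI[of _ g]) auto
    next
      case True
      define s0 where "s0 = L - Suc k"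
      define c where "c = Poly_Mapping.lookup (g ((D ^^ s0) v)) a"
      \<comment> \<open>At s = s0 the correction is c times the value at D^L v, which is already 1,
        so the value becomes 0. For s > s0 it vanishes because D^(L + 1) v = 0, and the earlier
        values persist.\<close>
      let ?g = "\<lambda>w. g w - pscale c (g ((D ^^ Suc k) w))"
      have "is_linear ?g"
        by (rule is_linear_minus[OF g(1) is_linear_scale[OF is_linear_compose[OF g(1) is_linear_funpow[OF X]]]])
      moreover have "Poly_Mapping.lookup (?g ((D ^^ s) v)) a = (if s = L then 1 else 0)"
        if "s \<le> L" "L \<le> s + Suc k" for s
      proof -
        have e: "(D ^^ Suc k) ((D ^^ s) v) = (D ^^ (Suc k + s)) v" by (simp add: funpow_add)
        show ?thesis
        proof (cases "s = s0")
          case True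
          then have "Suc k + s = L" "s \<noteq> L" using \<open>Suc k \<le> L\<close> by (auto simp: s0_def)
          then show ?thesis
            using True g(2)[of L] unfolding e by (simp add: lookup_minus lookup_pscale c_def)
        next
          case False
          then have "L < Suc k + s" "L \<le> s + k" using that by (auto simp: s0_def)
          then show ?thesis
            using g(2)[OF that(1)] is_linear_zeroD[OF g(1)] unfolding e
            by (simp add: lookup_minus lookup_pscale zero del: funpow.simps)
        qed
      qed
      ultimately show ?thesis by (intro exI[of _ ?g]) blast
    qed
  qed
  from this[of L] show ?thesis by auto
qed

context root_of_unity
begin

lemma xop_uni: "xop n (uni n t l) (bvec j) = (if j < l then bvec (Suc j) else 0)"
proof -
  have "xop n (uni n t l) (bvec j) = (\<Sum>i<n. if i = (t + j) mod n then (if j < l then bvec (Suc j) else 0) else 0)"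
    unfolding xop_def by (intro sum.cong refl) (auto simp: coact_at_uni)
  then show ?thesis using n_pos by (simp add: sum.delta)
qed

lemma xop_pow_uni: "j \<le> l \<Longrightarrow> (xop n (uni n t l) ^^ m) (bvec j) = (if j + m \<le> l then bvec (j + m) else 0)"
proof (induction m)
  case (Suc m)
  then show ?case
    by (auto simp: xop_uni is_linear_zeroD[OF is_linear_xop[OF linear_coact_uni]])
qed simp

lemma cspace_uni: "cspace (uni n t l) = pm.span (bvec ` {..l})"
  by (simp add: cspace_def span_on_eq_span lessThan_Suc_atMost)

lemma
  is_comodule_uni: "is_comodule n (uni n t l :: 'k comodule)" and
  hmg_uni: "j \<le> l \<Longrightarrow> hmg (uni n t l :: 'k comodule) ((t + j) mod n) (bvec j)"
proof -
  let ?S = "\<lambda>i. {bvec j :: nat \<Rightarrow>\<^sub>0 'k |j. j \<le> l \<and> i = (t + j) mod n}"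
  let ?M = "uni n t l :: 'k comodule"
  have 1: "v \<in> cspace ?M" if "v \<in> ?S i" for i v
    using that by (auto simp: cspace_def)
  have 2: "coact_at ?M (j, m) v = (if j = i then (xop n ?M ^^ m) v else 0)" if "v \<in> ?S i" for i v j m
    using that by (auto simp: coact_at_uni xop_pow_uni)
  have 3: "xop n ?M v \<in> pm.span (?S (Suc i mod n))" if "v \<in> ?S i" for i v
  proof -
    from that obtain j where j: "j \<le> l" "i = (t + j) mod n" "v = bvec j" by blast
    show ?thesis
    proof (cases "j < l")
      case True
      then have "bvec (Suc j) \<in> ?S (Suc i mod n)"
        by (intro CollectI exI[of _ "Suc j"]) (simp add: j mod_simps)
      then show ?thesis using True j by (simp add: xop_uni pm.span_base)
    qed (simp add: j xop_uni pm.span_zero)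
  qed
  have 4: "cspace ?M \<subseteq> pm.span (\<Union>i<n. ?S i)"
    unfolding cspace_uni
  proof (rule pm.span_mono, rule subsetI)
    fix x :: "nat \<Rightarrow>\<^sub>0 'k" assume "x \<in> bvec ` {..l}"
    then obtain j where "j \<le> l" "x = bvec j" by auto
    then show "x \<in> (\<Union>i<n. ?S i)"
      using n_pos by (intro UN_I[of "(t + j) mod n"]) auto
  qed
  note * = is_comoduleI[of ?M n ?S, OF linear_coact_uni 1 2 3 4]
  show "is_comodule n ?M" by (rule *(1))
  show "hmg ?M ((t + j) mod n) (bvec j)" if "j \<le> l"
    by (rule *(2)) (use that n_pos in auto)
qed

lemma chom_uni:
  fixes M :: "'k comodule"
  assumes M: "is_comodule n M" and v: "hmg M (t mod n) v" and X: "(xop n M ^^ Suc l) v = 0"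
  shows "chom (uni n t l) M (lin_ext (\<lambda>j. (xop n M ^^ j) v))" (is "chom _ _ ?f")
proof (rule chomI[OF comodule.intro[OF is_comodule_uni] comodule.intro[OF M] is_linear_lin_ext])
  show "cspace (uni n t l) \<subseteq> pm.span (bvec ` {..l})" by (simp add: cspace_uni)
  fix x :: "nat \<Rightarrow>\<^sub>0 'k" assume "x \<in> bvec ` {..l}"
  then obtain j where j: "j \<le> l" "x = bvec j" by auto
  show "\<exists>i. hmg (uni n t l) i x \<and> hmg M i (?f x)"
    using hmg_uni[OF j(1)] comodule.hmg_xop_pow[OF comodule.intro[OF M] v, of j]
    by (auto simp: j(2) mod_simps)
  show "?f (xop n (uni n t l) x) = xop n M (?f x)"
    using X j by (cases "j = l") (simp_all add: xop_uni is_linear_zeroD[OF is_linear_lin_ext])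
qed

lemma iso_uniI:
  fixes M :: "'k comodule"
  assumes M: "is_comodule n M" and v: "hmg M (t mod n) v" and X: "(xop n M ^^ Suc l) v = 0"
    and dim: "cdim M = Suc l" and span: "cspace M \<subseteq> pm.span ((\<lambda>j. (xop n M ^^ j) v) ` {..l})"
  shows "comodule_iso (uni n t l) M"
proof (rule comodule_isoI[OF chom_uni[OF M v X] bij_betw_of_spanning[OF is_linear_lin_ext]])
  let ?f = "lin_ext (\<lambda>j. (xop n M ^^ j) v)"
  show "?f ` cspace (uni n t l) \<subseteq> cspace M"
    using chom_in[OF chom_uni[OF M v X]] by blast
  have "(\<lambda>j. (xop n M ^^ j) v) ` {..l} \<subseteq> ?f ` cspace (uni n t l)"
    by (auto intro!: image_eqI[of _ ?f "bvec j" for j] simp: cspace_def)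
  then show "cspace M \<subseteq> pm.span (?f ` cspace (uni n t l))"
    using span pm.span_mono by blast
qed (simp add: dim)

lemma iso_csum_uniI:
  fixes M :: "'k comodule"
  assumes M: "is_comodule n M" and v: "hmg M (t mod n) v" and X: "(xop n M ^^ Suc a) v = 0"
    and w: "hmg M (s mod n) w" and Y: "(xop n M ^^ Suc b) w = 0"
    and dim: "cdim M = Suc a + Suc b"
    and span: "cspace M \<subseteq> pm.span ((\<lambda>j. (xop n M ^^ j) v) ` {..a} \<union> (\<lambda>j. (xop n M ^^ j) w) ` {..b})"
  shows "comodule_iso (uni n t a \<oplus>c uni n s b) M"
proof -
  interpret U: comodule_pair n "uni n t a :: 'k comodule" "uni n s b :: 'k comodule"
    by (rule comodule_pairI[OF is_comodule_uni is_comodule_uni])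
  let ?f = "lin_ext (\<lambda>j. (xop n M ^^ j) v)" and ?g = "lin_ext (\<lambda>j. (xop n M ^^ j) w)"
  let ?V = "uni n t a :: 'k comodule" and ?W = "uni n s b :: 'k comodule"
  let ?h = "csum_map (cdim ?V) ?f ?g"
  have h: "chom (?V \<oplus>c ?W) M ?h"
    by (rule U.chom_csum[OF comodule.intro[OF M] chom_uni[OF M v X] chom_uni[OF M w Y]])
  have "bij_betw ?h (cspace (?V \<oplus>c ?W)) (cspace M)"
  proof (rule bij_betw_of_spanning[OF is_linear_csum_map])
    show "?h ` cspace (?V \<oplus>c ?W) \<subseteq> cspace M" using chom_in[OF h] by blast
    have 1: "(xop n M ^^ j) v \<in> ?h ` cspace (?V \<oplus>c ?W)" if "j \<le> a" for j
    proof (rule image_eqI[of _ _ "bvec j"])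
      have "bvec j \<in> cspace ?V" using that by (simp add: cspace_def)
      then show "(xop n M ^^ j) v = ?h (bvec j)" "bvec j \<in> cspace (?V \<oplus>c ?W)"
        by (simp_all add: csum_map_left cspace_mono_csum del: cdim_uni)
    qed
    have 2: "(xop n M ^^ j) w \<in> ?h ` cspace (?V \<oplus>c ?W)" if "j \<le> b" for j
    proof (rule image_eqI[of _ _ "shift (cdim ?V) (bvec j)"])
      have "bvec j \<in> cspace ?W" using that by (simp add: cspace_def)
      then show "shift (cdim ?V) (bvec j) \<in> cspace (?V \<oplus>c ?W)"
        by (rule shift_in_csum)
      show "(xop n M ^^ j) w = ?h (shift (cdim ?V) (bvec j))"
        by (subst csum_map_right) simp_all
    qed
    have "(\<lambda>j. (xop n M ^^ j) v) ` {..a} \<union> (\<lambda>j. (xop n M ^^ j) w) ` {..b} \<subseteq> ?h ` cspace (?V \<oplus>c ?W)"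
      using 1 2 by blast
    then show "cspace M \<subseteq> pm.span (?h ` cspace (?V \<oplus>c ?W))"
      using span pm.span_mono by blast
  qed (simp add: dim)
  with h show ?thesis by (rule comodule_isoI)
qed

lemma split_uni:
  fixes M :: "'k comodule"
  assumes M: "is_comodule n M" and v: "hmg M t v" and Xv: "(xop n M ^^ L) v \<noteq> 0"
    and XM: "\<And>w. w \<in> cspace M \<Longrightarrow> (xop n M ^^ Suc L) w = 0"
  shows "\<exists>M'. is_comodule n M' \<and> comodule_iso (uni n t L \<oplus>c M') M"
proof -
  interpret M: comodule n M by standard (rule M)
  have t: "t < n" using M.hmg_eq_0[OF v] Xv is_linear_zeroD[OF M.linear_xop_pow] by auto
  obtain a where "Poly_Mapping.lookup ((xop n M ^^ L) v) a \<noteq> 0"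
    using Xv by (metis lookup_zero poly_mapping_eqI)
  then obtain g where g: "is_linear g"
    "\<And>s. s \<le> L \<Longrightarrow> Poly_Mapping.lookup (g ((xop n M ^^ s) v)) a = (if s = L then 1 else 0)"
    using dual_functional[OF M.linear_xop _ XM[OF hmg_cspace[OF v]]] by blast
  have zero: "coact_at M (i, l) w = 0" if "w \<in> cspace M" "L < l" for i l w
  proof -
    have "coact_at M (i, l) w = (xop n M ^^ (l - Suc L)) ((xop n M ^^ Suc L) (coact_at M (i, 0) w))"
      using that funpow_add[of "l - Suc L" "Suc L" "xop n M"] M.coact_at_eq[OF that(1), of i l] by simp
    then show ?thesis
      using XM[OF M.coact_at_in[OF that(1)]] is_linear_zeroD[OF M.linear_xop_pow] by simp
  qed
  let ?V = "uni n t L :: 'k comodule"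
  define \<pi> where "\<pi> w = (\<Sum>j\<le>L. Poly_Mapping.single j
      (Poly_Mapping.lookup (g (coact_at M ((t + j) mod n, L - j) w)) a))" for w
  have lookup_\<pi>: "Poly_Mapping.lookup (\<pi> w) k =
      (if k \<le> L then Poly_Mapping.lookup (g (coact_at M ((t + k) mod n, L - k) w)) a else 0)" for w k
    unfolding \<pi>_def lookup_sum lookup_single when_def by (simp add: sum.delta')
  have \<pi>l: "is_linear \<pi>"
    by (rule is_linearI; rule poly_mapping_eqI)
      (simp_all add: lookup_\<pi> lookup_add lookup_pscale is_linear_addD[OF M.linear_coact_at]
        is_linear_scaleD[OF M.linear_coact_at] is_linear_addD[OF g(1)] is_linear_scaleD[OF g(1)])
  have \<pi>_in: "\<pi> w \<in> cspace ?V" for w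
    by (auto simp: cspace_def span_on_def in_keys_iff lookup_\<pi> split: if_splits)
  have \<pi>hom: "chom M ?V \<pi>"
    unfolding chom_def
  proof (intro conjI \<pi>l ballI allI \<pi>_in)
    fix w and p :: path assume w: "w \<in> cspace M"
    obtain i m where p: "p = (i, m)" by (metis surj_pair)
    show "\<pi> (coact_at M p w) = coact_at ?V p (\<pi> w)"
    proof (rule poly_mapping_eqI)
      fix k
      show "Poly_Mapping.lookup (\<pi> (coact_at M p w)) k = Poly_Mapping.lookup (coact_at ?V p (\<pi> w)) k"
      proof (cases "m \<le> k \<and> k \<le> L")
        case True
        then obtain k' where k': "k = k' + m" by (metis add.commute le_Suc_ex)
        have iff: "i < n \<and> (t + k) mod n = (i + m) mod n \<longleftrightarrow> i = (t + k') mod n"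
          using mod_add_right_cancel[of "t + k'" m n i] n_pos by (auto simp: k' add.assoc)
        have "L - k + m = L - k'" "m + (L - k) = L - k'" using True k' by auto
        then show ?thesis
          using True unfolding p lookup_coact_at_uni[OF \<pi>_in] lookup_\<pi> M.coact_at_coact_at[OF w] iff
          by (simp add: k' is_linear_zeroD[OF g(1)])
      next
        case False
        \<comment> \<open>For k < m the right side has no coordinate to shift from, and the left
          side involves X^(m + L - k), a power above L.\<close>
        then have "m + (L - k) > L" if "k \<le> L" using that by linarith
        then show ?thesis
          using False unfolding p lookup_coact_at_uni[OF \<pi>_in] lookup_\<pi> M.coact_at_coact_at[OF w]
          by (auto simp: zero[OF w] is_linear_zeroD[OF g(1)])
      qed
    qed
  qed
  have v': "hmg M (t mod n) v" using v t by simp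
  let ?\<iota> = "lin_ext (\<lambda>j. (xop n M ^^ j) v)"
  have \<iota>hom: "chom ?V M ?\<iota>"
    by (rule chom_uni[OF M v' XM[OF hmg_cspace[OF v]]])
  have "\<pi> (?\<iota> x) = x" if "x \<in> cspace ?V" for x
  proof (rule linear_eq_span_on[OF is_linear_compose[OF \<pi>l is_linear_lin_ext] is_linear_id(2) that[unfolded cspace_def]])
    fix s assume "s \<in> {..<cdim ?V}"
    then have s: "s \<le> L" by simp
    have "\<pi> ((xop n M ^^ s) v) = bvec s"
    proof (rule poly_mapping_eqI)
      fix k
      \<comment> \<open>Degrees agree only modulo n, so several k pass the degree test; among them
        the dual functional selects L - k + s = L, that is, k = s.\<close>
      have eq: "coact_at M ((t + k) mod n, L - k) ((xop n M ^^ s) v)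
          = (if (t + k) mod n = (t + s) mod n then (xop n M ^^ (L - k + s)) v else 0)"
        using M.coact_at_hmg[OF M.hmg_xop_pow[OF v, of s], of "L - k"]
          M.coact_at_hmg_0[OF M.hmg_xop_pow[OF v, of s], of "(t + k) mod n" "L - k"]
        by (simp add: funpow_add)
      show "Poly_Mapping.lookup (\<pi> ((xop n M ^^ s) v)) k = Poly_Mapping.lookup (bvec s) k"
      proof (cases "k \<le> L")
        case True
        show ?thesis
        proof (cases "L - k + s \<le> L")
          case le: True
          have "L - k + s = L \<longleftrightarrow> s = k" using True by linarith
          then show ?thesis
            using True g(2)[OF le] unfolding lookup_\<pi> eq
            by (auto simp: lookup_single is_linear_zeroD[OF g(1)])
        next
          case False
          have z: "(xop n M ^^ (L - k + s)) v = 0"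
            by (rule funpow_eq_0[OF M.linear_xop XM[OF hmg_cspace[OF v]]]) (use False in simp)
          have "s \<noteq> k" using False True by linarith
          then show ?thesis
            unfolding lookup_\<pi> eq z by (simp add: lookup_single is_linear_zeroD[OF g(1)])
        qed
      next
        case False
        then show ?thesis using s by (simp add: lookup_\<pi> lookup_single when_def)
      qed
    qed
    then show "\<pi> (?\<iota> (bvec s)) = bvec s" by simp
  qed
  then show ?thesis
    by (rule idempotent_splitting[OF is_comodule_uni M \<iota>hom \<pi>hom])
qed

end

section \<open>Ranks as additive invariants, and leading strings of tensor products\<close>

section \<open>Ranks\<close>

text \<open>For p = (i, l), this is the rank of X^l on degree i. These numbers take the place of
  multiplicities of indecomposable summands.\<close>

definition rk :: "'k::field comodule \<Rightarrow> path \<Rightarrow> nat" where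
  "rk M p = pm.dim (coact_at M p ` cspace M)"

lemma rk_iso:
  assumes M: "is_comodule n M" and "comodule_iso M N"
  shows "rk M p = rk N p"
proof -
  interpret M: comodule n M by standard (rule M)
  obtain f where f: "is_linear f" "bij_betw f (cspace M) (cspace N)"
      "\<And>v p. v \<in> cspace M \<Longrightarrow> f (coact_at M p v) = coact_at N p (f v)"
    using assms(2) unfolding comodule_iso_iff by metis
  have "coact_at N p ` cspace N = coact_at N p ` f ` cspace M"
    by (simp only: bij_betw_imp_surj_on[OF f(2)])
  also have "\<dots> = f ` coact_at M p ` cspace M"
    unfolding image_image by (rule image_cong[OF refl]) (simp add: f(3))
  finally have "rk N p = pm.dim (f ` coact_at M p ` cspace M)" by (simp add: rk_def)
  also have "\<dots> = rk M p"
    unfolding rk_def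
  proof (rule dim_image_inj[OF f(1)])
    have "pm.span (coact_at M p ` cspace M) \<subseteq> cspace M"
      by (rule pm.span_minimal[OF _ subspace_cspace]) (use M.coact_at_in in blast)
    then show "inj_on f (pm.span (coact_at M p ` cspace M))"
      using inj_on_subset[OF bij_betw_imp_inj_on[OF f(2)]] by blast
  qed
  finally show ?thesis ..
qed

definition proj_left :: "nat \<Rightarrow> (nat \<Rightarrow>\<^sub>0 'k::field) \<Rightarrow> (nat \<Rightarrow>\<^sub>0 'k)" where
  "proj_left k = lin_ext (\<lambda>a. if a < k then bvec a else 0)"

definition proj_right :: "nat \<Rightarrow> (nat \<Rightarrow>\<^sub>0 'k::field) \<Rightarrow> (nat \<Rightarrow>\<^sub>0 'k)" where
  "proj_right k = lin_ext (\<lambda>a. if a < k then 0 else bvec (a - k))"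

lemma is_linear_proj [simp]: "is_linear (proj_left k)" "is_linear (proj_right k)"
  by (simp_all add: proj_left_def proj_right_def)

lemma proj_span_on:
  assumes "u \<in> span_on {..<k}"
  shows "proj_left k u = u" "proj_right k u = 0"
  by (rule linear_eq_span_on[OF _ _ assms], simp_all add: proj_left_def)
    (rule linear_eq_span_on[OF _ _ assms], simp_all add: proj_right_def)

lemma proj_shift: "proj_left k (shift k v) = 0" "proj_right k (shift k v) = v"
proof -
  have l: "is_linear (\<lambda>v. proj_left k (shift k v))" "is_linear (\<lambda>v. proj_right k (shift k v))"
    by (rule is_linear_compose; simp)+
  show "proj_left k (shift k v) = 0"
    by (rule linear_eqI[OF l(1) is_linear_const_zero]) (simp add: proj_left_def)
  show "proj_right k (shift k v) = v"
    by (rule linear_eqI[OF l(2) is_linear_id(2)]) (simp add: proj_right_def)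
qed

text \<open>Each of the two projections kills one block and restores the other, so a linear relation
  projects to one within \<open>A\<close> or within \<open>B\<close>.\<close>

lemma independent_Un_shift:
  assumes A: "A \<subseteq> span_on {..<k}" "\<not> pm.dependent A" and B: "\<not> pm.dependent B"
  shows "\<not> pm.dependent (A \<union> shift k ` B)"
proof
  let ?S = "A \<union> shift k ` B"
  assume "pm.dependent ?S"
  then obtain x where x: "x \<in> ?S" "x \<in> pm.span (?S - {x})"
    unfolding pm.dependent_def by blast
  from x(1) show False
  proof
    assume xA: "x \<in> A"
    have "proj_left k x \<in> pm.span (proj_left k ` (?S - {x}))"
      using x(2) unfolding span_image_linear[OF is_linear_proj(1)] by blast
    moreover have "proj_left k ` (?S - {x}) \<subseteq> insert 0 (A - {x})"
      using A(1) by (auto simp: proj_span_on proj_shift subset_iff)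
    ultimately have "x \<in> pm.span (insert 0 (A - {x}))"
      using pm.span_mono xA A(1) by (metis (no_types, lifting) proj_span_on(1) subset_iff)
    then show False using A(2) xA unfolding pm.dependent_def by simp
  next
    assume "x \<in> shift k ` B"
    then obtain y where y: "y \<in> B" "x = shift k y" by blast
    have "y = proj_right k x" by (simp add: y proj_shift)
    also have "\<dots> \<in> pm.span (proj_right k ` (?S - {x}))"
      using x(2) unfolding span_image_linear[OF is_linear_proj(2)] by blast
    finally have "y \<in> pm.span (proj_right k ` (?S - {x}))" .
    moreover have "proj_right k ` (?S - {x}) \<subseteq> insert 0 (B - {y})"
      using A(1) y by (auto simp: proj_span_on proj_shift subset_iff)
    ultimately have "y \<in> pm.span (insert 0 (B - {y}))"
      using pm.span_mono by blast
    then show False using B y unfolding pm.dependent_def by simp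
  qed
qed

lemma inj_shift: "inj (shift k)"
  by (rule inj_on_inverseI[of _ "proj_right k"]) (simp add: proj_shift)

text \<open>The image is the direct sum of the two images, with a basis of the first together with a
  shifted basis of the second.\<close>

lemma (in comodule_pair) rk_csum: "rk (csum M N) p = rk M p + rk N p"
proof -
  let ?k = "cdim M"
  let ?I = "coact_at M p ` cspace M" and ?J = "coact_at N p ` cspace N"
  let ?C = "coact_at (csum M N) p"
  have Cl: "is_linear ?C" by (rule is_linear_coact_at[OF linear_coact_csum])
  obtain A where A: "A \<subseteq> ?I" "\<not> pm.dependent A" "?I \<subseteq> pm.span A" "card A = pm.dim ?I"
    by (rule pm.basis_exists)
  obtain B where B: "B \<subseteq> ?J" "\<not> pm.dependent B" "?J \<subseteq> pm.span B" "card B = pm.dim ?J"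
    by (rule pm.basis_exists)
  have Ak: "A \<subseteq> span_on {..<?k}" using A(1) M.coact_at_in unfolding cspace_def[symmetric] by blast
  have finA: "finite A" by (rule finite_independent_span_on[OF _ Ak A(2)]) simp
  have "B \<subseteq> span_on {..<cdim N}" using B(1) N.coact_at_in unfolding cspace_def[symmetric] by blast
  then have finB: "finite B" by (rule finite_independent_span_on[OF _ _ B(2), rotated]) simp
  have "pm.dim (?C ` cspace (csum M N)) = card (A \<union> shift ?k ` B)"
  proof (rule pm.dim_unique[OF _ _ _ refl])
    show "A \<union> shift ?k ` B \<subseteq> ?C ` cspace (csum M N)"
    proof -
      have "coact_at M p u \<in> ?C ` cspace (csum M N)" if "u \<in> cspace M" for u
        by (rule image_eqI[of _ _ u]) (use that in \<open>simp_all add: coact_at_csum_left[OF M.linear_coact] cspace_mono_csum\<close>)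
      moreover have "shift ?k (coact_at N p v) \<in> ?C ` cspace (csum M N)" if "v \<in> cspace N" for v
        by (rule image_eqI[of _ _ "shift ?k v"])
          (use that in \<open>simp_all add: coact_at_csum_right[OF N.linear_coact] shift_in_csum\<close>)
      ultimately show ?thesis using A(1) B(1) by blast
    qed
    have "cspace M \<union> shift ?k ` cspace N \<subseteq> {w. ?C w \<in> pm.span (A \<union> shift ?k ` B)}"
    proof -
      have "coact_at M p u \<in> pm.span (A \<union> shift ?k ` B)" if "u \<in> cspace M" for u
        using A(3) that pm.span_mono[of A "A \<union> shift ?k ` B"] by blast
      moreover have "shift ?k (coact_at N p v) \<in> pm.span (A \<union> shift ?k ` B)" if "v \<in> cspace N" for v
      proof -
        have "shift ?k (coact_at N p v) \<in> pm.span (shift ?k ` B)"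
          using B(3) that unfolding span_image_linear[OF is_linear_shift] by blast
        then show ?thesis using pm.span_mono[of "shift ?k ` B" "A \<union> shift ?k ` B"] by blast
      qed
      ultimately show ?thesis
        by (auto simp: coact_at_csum_left[OF M.linear_coact] coact_at_csum_right[OF N.linear_coact])
    qed
    then have "pm.span (cspace M \<union> shift ?k ` cspace N) \<subseteq> {w. ?C w \<in> pm.span (A \<union> shift ?k ` B)}"
      by (rule pm.span_minimal[OF _ subspace_vimage[OF Cl pm.subspace_span]])
    then show "?C ` cspace (csum M N) \<subseteq> pm.span (A \<union> shift ?k ` B)"
      using cspace_csum_span by blast
    show "\<not> pm.dependent (A \<union> shift ?k ` B)"
      by (rule independent_Un_shift[OF Ak A(2) B(2)])
  qed
  also have "\<dots> = card A + card (shift ?k ` B)"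
  proof (rule card_Un_disjoint[OF finA finite_imageI[OF finB]])
    show "A \<inter> shift ?k ` B = {}"
    proof (rule ccontr)
      assume "A \<inter> shift ?k ` B \<noteq> {}"
      then obtain x y where "x \<in> A" "x = shift ?k y" by blast
      then have "x = 0" using Ak proj_span_on(1)[of x ?k] proj_shift(1)[of ?k y] by auto
      then show False using \<open>x \<in> A\<close> A(2) pm.dependent_zero by blast
    qed
  qed
  also have "card (shift ?k ` B) = card B"
    by (rule card_image[OF inj_on_subset[OF inj_shift]]) simp
  finally show ?thesis by (simp add: rk_def A(4) B(4))
qed

lemma (in comodule) rk_eq_0_iff: "rk M p = 0 \<longleftrightarrow> (\<forall>w\<in>cspace M. coact_at M p w = 0)"
proof
  assume r: "rk M p = 0"
  obtain A where A: "A \<subseteq> coact_at M p ` cspace M" "\<not> pm.dependent A"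
      "coact_at M p ` cspace M \<subseteq> pm.span A" "card A = pm.dim (coact_at M p ` cspace M)"
    by (rule pm.basis_exists)
  have "A \<subseteq> span_on {..<cdim M}" using A(1) coact_at_in unfolding cspace_def[symmetric] by blast
  then have "finite A" by (rule finite_independent_span_on[OF _ _ A(2), rotated]) simp
  then have "A = {}" using A(4) r by (simp add: rk_def)
  then show "\<forall>w\<in>cspace M. coact_at M p w = 0" using A(3) by auto
next
  assume "\<forall>w\<in>cspace M. coact_at M p w = 0"
  then have "coact_at M p ` cspace M \<subseteq> pm.span {}" by auto
  then have "pm.dim (coact_at M p ` cspace M) \<le> card ({} :: (nat \<Rightarrow>\<^sub>0 'k) set)"
    by (rule pm.dim_le_card) simp
  then show "rk M p = 0" by (simp add: rk_def)
qed

text \<open>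
  The comodule has exactly one summand of the largest length \<open>L + 1\<close>, and the top of this summand
  has degree \<open>t\<close>.
\<close>

definition peak :: "'k::field comodule \<Rightarrow> nat \<Rightarrow> nat \<Rightarrow> bool" where
  "peak M t L \<longleftrightarrow> (\<forall>w\<in>cspace M. \<forall>i l. l > L \<longrightarrow> coact_at M (i, l) w = 0) \<and>
     (\<exists>e. e \<noteq> 0 \<and> e \<in> coact_at M (t, L) ` cspace M \<and>
       (\<forall>w\<in>cspace M. coact_at M (t, L) w \<in> pm.span {e} \<and> (\<forall>i. i \<noteq> t \<longrightarrow> coact_at M (i, L) w = 0)))"

lemma (in comodule) rk_peak:
  assumes "peak M t L"
  shows "rk M (t, L) = 1" "i \<noteq> t \<Longrightarrow> rk M (i, L) = 0" "l > L \<Longrightarrow> rk M (i, l) = 0"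
proof -
  obtain e where e: "e \<noteq> 0" "e \<in> coact_at M (t, L) ` cspace M"
     "\<And>w. w \<in> cspace M \<Longrightarrow> coact_at M (t, L) w \<in> pm.span {e}"
    using assms unfolding peak_def by blast
  have "pm.dim (coact_at M (t, L) ` cspace M) = card {e}"
    by (rule pm.dim_unique[OF _ _ _ refl]) (use e in \<open>auto simp: pm.dependent_single\<close>)
  then show "rk M (t, L) = 1" by (simp add: rk_def)
  show "rk M (i, L) = 0" if "i \<noteq> t"
    using assms that unfolding rk_eq_0_iff peak_def by blast
  show "rk M (i, l) = 0" if "l > L"
    using assms that unfolding rk_eq_0_iff peak_def by blast
qed

text \<open>Above l + m every term of the q-binomial expansion contains a vanishing power, and at l
  + m only X^l u \<otimes> X^m v is left. Its coefficient is a power of q times the Gaussian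
  binomial, so the longest strings multiply to one reaching X^(l + m) once that binomial is
  nonzero.\<close>

lemma (in tensor_pair) peak_ctensor:
  assumes M: "peak M a l" and N: "peak N b m" and nz: "gauss_binom l m q \<noteq> 0" and n: "n > 0"
    and ab: "a < n" "b < n"
  shows "peak T ((a + b) mod n) (l + m)"
proof -
  let ?S = "{t u v |u v. (\<exists>i<n. hmg M i u) \<and> (\<exists>j<n. hmg N j v)}"
  have lin: "is_linear (coact_at T p)" for p by (rule is_linear_coact_at[OF linear_coact_ctensor])
  have X0: "(xop n M ^^ k) u = 0" if "hmg M i u" "k > l" for i k u
    using M that M.coact_at_hmg[OF that(1), of k] hmg_cspace[OF that(1)] unfolding peak_def by metis
  have Y0: "(xop n N ^^ k) v = 0" if "hmg N i v" "k > m" for i k v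
    using N that N.coact_at_hmg[OF that(1), of k] hmg_cspace[OF that(1)] unfolding peak_def by metis
  have Xa: "(xop n M ^^ l) u = 0" if "hmg M i u" "i \<noteq> a" for i u
    using M that M.coact_at_hmg[OF that(1), of l] hmg_cspace[OF that(1)] unfolding peak_def by metis
  have Yb: "(xop n N ^^ m) v = 0" if "hmg N i v" "i \<noteq> b" for i v
    using N that N.coact_at_hmg[OF that(1), of m] hmg_cspace[OF that(1)] unfolding peak_def by metis
  obtain e where e: "e \<noteq> 0" "e \<in> coact_at M (a, l) ` cspace M"
     "\<And>w. w \<in> cspace M \<Longrightarrow> coact_at M (a, l) w \<in> pm.span {e}"
    using M unfolding peak_def by blast
  obtain f where f: "f \<noteq> 0" "f \<in> coact_at N (b, m) ` cspace N"
     "\<And>w. w \<in> cspace N \<Longrightarrow> coact_at N (b, m) w \<in> pm.span {f}"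
    using N unfolding peak_def by blast
  have high: "tpow i k u v = 0" if "hmg M i u" "hmg N j v" "k > l + m" for i j k u v
    unfolding tpow_def
  proof (rule sum.neutral, rule ballI)
    fix s assume "s \<in> {..k}"
    then have "s > l \<or> k - s > m" using that(3) by auto
    then have "(xop n M ^^ s) u = 0 \<or> (xop n N ^^ (k - s)) v = 0"
      using X0[OF that(1), of s] Y0[OF that(2), of "k - s"] by blast
    then show "pscale (q ^ (i * (k - s)) * gauss_binom s (k - s) q)
        (t ((xop n M ^^ s) u) ((xop n N ^^ (k - s)) v)) = 0" by auto
  qed
  have top: "tpow i (l + m) u v = pscale (q ^ (i * m) * gauss_binom l m q) (t ((xop n M ^^ l) u) ((xop n N ^^ m) v))"
    if "hmg M i u" "hmg N j v" for i j u v
  proof -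
    let ?F = "\<lambda>s. pscale (q ^ (i * (l + m - s)) * gauss_binom s (l + m - s) q)
        (t ((xop n M ^^ s) u) ((xop n N ^^ (l + m - s)) v))"
    have "tpow i (l + m) u v = (\<Sum>s\<le>l + m. if s = l then ?F l else 0)"
      unfolding tpow_def
    proof (rule sum.cong[OF refl])
      fix s assume "s \<in> {..l + m}"
      then have "s = l \<or> s > l \<or> l + m - s > m" by auto
      then have "s = l \<or> (xop n M ^^ s) u = 0 \<or> (xop n N ^^ (l + m - s)) v = 0"
        using X0[OF that(1), of s] Y0[OF that(2), of "l + m - s"] by blast
      then show "?F s = (if s = l then ?F l else 0)" by auto
    qed
    also have "\<dots> = ?F l" by (subst sum.delta) auto
    finally show ?thesis by simp
  qed
  have sp: "w \<in> pm.span ?S" if "w \<in> cspace T" for w using that ctensor_span_hmg by blast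
  have 1: "coact_at T (i, k) w = 0" if "w \<in> cspace T" "k > l + m" for w i k
    by (rule linear_eq_span[OF lin is_linear_const_zero sp[OF that(1)]])
      (use that(2) high in \<open>auto simp: coact_at_ft\<close>)
  have 2: "coact_at T (i, l + m) w = 0" if "w \<in> cspace T" "i \<noteq> (a + b) mod n" for w i
  proof (rule linear_eq_span[OF lin is_linear_const_zero sp[OF that(1)]])
    fix x assume "x \<in> ?S"
    then obtain u v j k where x: "x = t u v" "hmg M j u" "hmg N k v" by blast
    show "coact_at T (i, l + m) x = 0"
    proof (cases "i = (j + k) mod n")
      case True
      then have "j \<noteq> a \<or> k \<noteq> b" using that(2) by blast
      then have "(xop n M ^^ l) u = 0 \<or> (xop n N ^^ m) v = 0"
        using Xa[OF x(2)] Yb[OF x(3)] by blast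
      then show ?thesis using x by (auto simp: coact_at_ft top)
    qed (use x in \<open>simp add: coact_at_ft\<close>)
  qed
  have 3: "coact_at T ((a + b) mod n, l + m) w \<in> pm.span {t e f}" if "w \<in> cspace T" for w
  proof -
    have "?S \<subseteq> {w. coact_at T ((a + b) mod n, l + m) w \<in> pm.span {t e f}}"
    proof
      fix x assume "x \<in> ?S"
      then obtain u v j k where x: "x = t u v" "hmg M j u" "hmg N k v" by blast
      have "t ((xop n M ^^ l) u) ((xop n N ^^ m) v) \<in> pm.span {t e f}"
      proof (cases "j = a \<and> k = b")
        case True
        have "(xop n M ^^ l) u \<in> pm.span {e}" "(xop n N ^^ m) v \<in> pm.span {f}"
          using True e(3)[OF hmg_cspace[OF x(2)]] f(3)[OF hmg_cspace[OF x(3)]]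
            M.coact_at_hmg[OF x(2), of l] N.coact_at_hmg[OF x(3), of m] by auto
        then have "t ((xop n M ^^ l) u) ((xop n N ^^ m) v) \<in> pm.span {t x y |x y. x \<in> {e} \<and> y \<in> {f}}"
          by (rule span_ft)
        then show ?thesis by simp
      next
        case False
        then have "(xop n M ^^ l) u = 0 \<or> (xop n N ^^ m) v = 0"
          using Xa[OF x(2)] Yb[OF x(3)] by blast
        then show ?thesis by (auto simp: pm.span_zero)
      qed
      then show "x \<in> {w. coact_at T ((a + b) mod n, l + m) w \<in> pm.span {t e f}}"
        using x by (auto simp: coact_at_ft top pm.span_scale pm.span_zero)
    qed
    then have "pm.span ?S \<subseteq> {w. coact_at T ((a + b) mod n, l + m) w \<in> pm.span {t e f}}"
      by (rule pm.span_minimal[OF _ subspace_vimage[OF lin pm.subspace_span]])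
    then show ?thesis using sp[OF that] by blast
  qed
  \<comment> \<open>Contracting the second factor with a coordinate that does not vanish on
    \<open>f\<close> gives a nonzero multiple of \<open>e\<close>.\<close>
  have nz': "t e f \<noteq> 0"
  proof -
    obtain i where i: "Poly_Mapping.lookup e i \<noteq> 0" using e(1) by (metis lookup_zero poly_mapping_eqI)
    obtain j where j: "Poly_Mapping.lookup f j \<noteq> 0" using f(1) by (metis lookup_zero poly_mapping_eqI)
    have fN: "f \<in> cspace N" using f(2) N.coact_at_in by blast
    then have jN: "j < cdim N" using j by (auto simp: cspace_def span_on_def in_keys_iff)
    let ?P = "\<lambda>u v. pscale (Poly_Mapping.lookup v j) u"
    have "ft_map (cdim N) ?P (t e f) = ?P e f"
    proof (rule ft_map_ft[OF _ _ fN])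
      show "is_linear (\<lambda>u. ?P u v)" for v by (rule is_linear_scale) simp
      show "is_linear (?P u)" for u
        by (rule is_linearI; rule poly_mapping_eqI) (simp_all add: lookup_pscale lookup_add algebra_simps)
    qed
    moreover have "?P e f \<noteq> 0"
    proof
      assume "?P e f = 0"
      then have "Poly_Mapping.lookup (?P e f) i = 0" by (simp only: lookup_zero)
      then show False using i j by (simp add: lookup_pscale)
    qed
    ultimately show ?thesis using is_linear_zeroD[OF is_linear_ft_map] by metis
  qed
  have 4: "t e f \<in> coact_at T ((a + b) mod n, l + m) ` cspace T"
  proof -
    obtain u0 where u0: "u0 \<in> cspace M" "e = coact_at M (a, l) u0" using e(2) by blast
    obtain v0 where v0: "v0 \<in> cspace N" "f = coact_at N (b, m) v0" using f(2) by blast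
    define u where "u = coact_at M (a, 0) u0"
    define v where "v = coact_at N (b, 0) v0"
    have u: "hmg M a u" "(xop n M ^^ l) u = e"
      using M.hmg_coact_at[OF u0(1) ab(1), of 0] M.coact_at_eq[OF u0(1), of a l] ab by (simp_all add: u_def u0)
    have v: "hmg N b v" "(xop n N ^^ m) v = f"
      using N.hmg_coact_at[OF v0(1) ab(2), of 0] N.coact_at_eq[OF v0(1), of b m] ab by (simp_all add: v_def v0)
    let ?c = "q ^ (a * m) * gauss_binom l m q"
    have "q \<noteq> 0" using q_n n by (auto simp: power_0_left)
    then have c: "?c \<noteq> 0" using nz by simp
    have "coact_at T ((a + b) mod n, l + m) (pscale (1 / ?c) (t u v)) = t e f"
    proof -
      have "1 / x * x = 1" if "x \<noteq> 0" for x :: 'k using that by simp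
      from this[OF c] show ?thesis
        by (simp only: is_linear_scaleD[OF lin] coact_at_ft[OF u(1) v(1)] top[OF u(1) v(1)] u(2) v(2)
          if_True simp_thms pscale_pscale pscale_1)
    qed
    moreover have "pscale (1 / ?c) (t u v) \<in> cspace T"
      by (intro pm.subspace_scale[OF subspace_cspace] ft_in_ctensor hmg_cspace[OF u(1)] hmg_cspace[OF v(1)])
    ultimately show ?thesis by (metis image_eqI)
  qed
  show ?thesis
    unfolding peak_def using 1 2 3 4 nz' by blast
qed

context root_of_unity
begin

lemma q_nonzero: "q \<noteq> 0"
  using q_n n_pos by (auto simp: power_0_left)

lemma peak_uni: "peak (uni n t l :: 'k comodule) (t mod n) l"
  unfolding peak_def
proof (intro conjI ballI allI impI exI[of _ "bvec l"])
  interpret U: comodule n "uni n t l :: 'k comodule" by standard (rule is_comodule_uni)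
  fix w :: "nat \<Rightarrow>\<^sub>0 'k" and i k :: nat assume w: "w \<in> cspace (uni n t l)"
  show "coact_at (uni n t l) (i, k) w = 0" if "k > l"
    by (rule poly_mapping_eqI) (use that in \<open>auto simp: lookup_coact_at_uni[OF w]\<close>)
  show "coact_at (uni n t l) (i, l) w = 0" if "i \<noteq> t mod n"
    by (rule poly_mapping_eqI) (use that in \<open>auto simp: lookup_coact_at_uni[OF w]\<close>)
  have "coact_at (uni n t l) (t mod n, l) w = pscale (Poly_Mapping.lookup w 0) (bvec l)"
    by (rule poly_mapping_eqI) (auto simp: lookup_coact_at_uni[OF w] lookup_single when_def)
  then show "coact_at (uni n t l) (t mod n, l) w \<in> pm.span {bvec l}"
    by (simp only: pm.span_scale pm.span_base insertI1)
next
  show "bvec l \<noteq> (0 :: nat \<Rightarrow>\<^sub>0 'k)" by (metis lookup_single_eq lookup_zero zero_neq_one)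
  show "bvec l \<in> coact_at (uni n t l) (t mod n, l) ` cspace (uni n t l :: 'k comodule)"
    by (rule image_eqI[of _ _ "bvec 0"]) (simp_all add: coact_at_uni cspace_def)
qed

text \<open>Once the string is split off, additivity leaves rank 0 in every degree for all lengths
  at least L, so the complement is strictly shorter.\<close>

lemma split_peak:
  fixes M :: "'k comodule"
  assumes M: "is_comodule n M" and p: "peak M t L"
  shows "\<exists>M'. is_comodule n M' \<and> comodule_iso (uni n t L \<oplus>c M') M \<and>
    (\<forall>w\<in>cspace M'. \<forall>i l. l \<ge> L \<longrightarrow> coact_at M' (i, l) w = 0)"
proof -
  interpret M: comodule n M by standard (rule M)
  obtain e where e: "e \<noteq> 0" "e \<in> coact_at M (t, L) ` cspace M"
    using p unfolding peak_def by blast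
  then obtain v0 where v0: "v0 \<in> cspace M" "e = coact_at M (t, L) v0" by blast
  have t: "t < n" using M.coact_at_outside[OF v0(1), of "(t, L)"] e(1) v0(2) by (auto simp: paths_def)
  define v where "v = coact_at M (t, 0) v0"
  have v: "hmg M t v" "(xop n M ^^ L) v = e"
    using M.hmg_coact_at[OF v0(1) t, of 0] M.coact_at_eq[OF v0(1), of t L] t by (simp_all add: v_def v0)
  have "(xop n M ^^ Suc L) w = 0" if "w \<in> cspace M" for w
    unfolding M.xop_pow_eq[OF that] by (rule sum.neutral) (use p that in \<open>auto simp: peak_def\<close>)
  with v e(1) obtain M' where M': "is_comodule n M'" "comodule_iso (uni n t L \<oplus>c M') M"
    using split_uni[OF M v(1)] by blast
  interpret S: comodule_pair n "uni n t L :: 'k comodule" M'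
    by (rule comodule_pairI[OF is_comodule_uni M'(1)])
  have rk: "rk M p = rk (uni n t L :: 'k comodule) p + rk M' p" for p
    using rk_iso[OF S.is_comodule_csum M'(2)] S.rk_csum by simp
  have pu: "peak (uni n t L :: 'k comodule) t L" using peak_uni[of t L] t by simp
  have "rk M' (i, l) = 0" if "l \<ge> L" for i l
  proof (cases "l = L")
    case True
    then show ?thesis
      using rk[of "(i, l)"] M.rk_peak(1)[OF p] M.rk_peak(2)[OF p, of i] S.M.rk_peak(1)[OF pu]
        S.M.rk_peak(2)[OF pu, of i] by (cases "i = t") auto
  next
    case False
    with that show ?thesis using rk[of "(i, l)"] M.rk_peak(3)[OF p, of l i] by auto
  qed
  then show ?thesis using M' S.N.rk_eq_0_iff by blast
qed

end

section \<open>Clebsch-Gordan rules for the two-dimensional comodule\<close>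

section \<open>Tensoring with the two-dimensional uniserial comodule\<close>

text \<open>
  Both \<open>uni 0 1 \<otimes> uni 0 l\<close> and \<open>uni 0 l \<otimes> uni 0 1\<close> have a basis \<open>A\<^sub>0, \<dots>, A\<^sub>l, B\<^sub>0, \<dots>, B\<^sub>l\<close> on which
  the shift operator acts by the same formulas, with \<open>b = q\<close> and \<open>b = 1 / q\<close> respectively.
\<close>

locale ladder = root_of_unity n q for n and q :: "'k::field" +
  fixes M :: "'k comodule" and A B :: "nat \<Rightarrow> (nat \<Rightarrow>\<^sub>0 'k)" and b :: 'k and l :: nat
  assumes is_com: "is_comodule n M"
    and xop_A: "\<And>j. j \<le> l \<Longrightarrow> xop n M (A j) = A (Suc j) + B j"
    and xop_B: "\<And>j. j \<le> l \<Longrightarrow> xop n M (B j) = pscale b (B (Suc j))"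
    and A_last: "A (Suc l) = 0" and B_last: "B (Suc l) = 0"
    and hmg_A0: "hmg M 0 (A 0)" and hmg_A1: "hmg M (1 mod n) (A 1)" and hmg_B0: "hmg M (1 mod n) (B 0)"
    and b: "b \<noteq> 0"
    and spanned: "cspace M \<subseteq> pm.span (A ` {..l} \<union> B ` {..l})"
    and dim: "cdim M = Suc l + Suc l"
begin

sublocale M: comodule n M by standard (rule is_com)

text \<open>The b-integer (j)_b, which accumulates as the coefficient of \<open>B\<close> in the
  powers of X on \<open>A 0\<close>.\<close>

definition s :: "nat \<Rightarrow> 'k" where "s j = (\<Sum>i<j. b ^ i)"

lemma s_Suc: "s (Suc j) = 1 + b * s j"
  unfolding s_def sum.lessThan_Suc_shift by (simp add: sum_distrib_left)

lemma s_Suc': "s (Suc j) = s j + b ^ j"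
  by (simp add: s_def)

lemma s_0 [simp]: "s 0 = 0"
  by (simp add: s_def)

lemma xop_pow_A: "j \<le> l \<Longrightarrow> (xop n M ^^ Suc j) (A 0) = A (Suc j) + pscale (s (Suc j)) (B j)"
proof (induction j)
  case 0
  then show ?case by (simp add: xop_A s_Suc)
next
  case (Suc j)
  have "(xop n M ^^ Suc (Suc j)) (A 0) = xop n M (A (Suc j) + pscale (s (Suc j)) (B j))"
    using Suc by simp
  also have "\<dots> = A (Suc (Suc j)) + pscale (1 + b * s (Suc j)) (B (Suc j))"
    using Suc.prems by (simp add: is_linear_addD[OF M.linear_xop] is_linear_scaleD[OF M.linear_xop] xop_A xop_B
        pm.scale_left_distrib mult.commute add.assoc)
  finally show ?case by (simp only: s_Suc[of "Suc j"])
qed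

lemma xop_pow_B: "j \<le> Suc l \<Longrightarrow> (xop n M ^^ j) (B 0) = pscale (b ^ j) (B j)"
proof (induction j)
  case (Suc j)
  then show ?case
    by (simp add: is_linear_scaleD[OF M.linear_xop] xop_B mult.commute)
qed simp

lemma xop_pow_A1: "j < Suc l \<Longrightarrow> (xop n M ^^ j) (A 1) = A (Suc j) + pscale (s j) (B j)"
proof (induction j)
  case (Suc j)
  have "(xop n M ^^ Suc j) (A 1) = xop n M (A (Suc j) + pscale (s j) (B j))"
    using Suc by simp
  also have "\<dots> = A (Suc (Suc j)) + pscale (1 + b * s j) (B (Suc j))"
    using Suc.prems by (simp add: is_linear_addD[OF M.linear_xop] is_linear_scaleD[OF M.linear_xop] xop_A xop_B
        pm.scale_left_distrib mult.commute add.assoc)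
  finally show ?case by (simp only: s_Suc[of j])
qed simp

text \<open>A_{k+1} differs from X^(k + 1) A_0 by a multiple of B_k, so the vectors A_j need no
  separate treatment.\<close>

lemma cspace_spanI:
  assumes A0: "\<And>j. j \<le> l \<Longrightarrow> (xop n M ^^ j) (A 0) \<in> pm.span S"
    and Bj: "\<And>j. j \<le> l \<Longrightarrow> B j \<in> pm.span S"
  shows "cspace M \<subseteq> pm.span S"
proof -
  have Aj: "A j \<in> pm.span S" if "j \<le> l" for j
  proof (cases j)
    case 0
    then show ?thesis using A0[of 0] by simp
  next
    case (Suc k)
    have "(xop n M ^^ Suc k) (A 0) - pscale (s (Suc k)) (B k) \<in> pm.span S"
      using that Suc by (intro pm.span_diff pm.span_scale A0 Bj) auto
    then show ?thesis using xop_pow_A[of k] that Suc by (simp del: funpow.simps)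
  qed
  then have "pm.span (A ` {..l} \<union> B ` {..l}) \<subseteq> pm.span S"
    using Bj by (intro pm.span_minimal pm.subspace_span) auto
  then show ?thesis using spanned by blast
qed

text \<open>X^(l + 1) A_0 = (l + 1)_b B_l is nonzero, so the string of A_0 has l + 2 vectors. The
  complement must be a string of l vectors starting in degree 1, where A_1 and B_0 are
  available.\<close>

lemma iso_generic:
  assumes nz: "s (Suc l) \<noteq> 0" and l: "l > 0"
  shows "comodule_iso (uni n 0 (Suc l) \<oplus>c uni n 1 (l - 1)) M"
proof -
  \<comment> \<open>Chosen so that X^l w = A_{l+1} + ((l)_b + a b^l) B_l is zero, given that A_{l+1}
    = 0.\<close>
  define a where "a = - s l / b ^ l"
  define w where "w = A 1 + pscale a (B 0)"
  have w_pow: "(xop n M ^^ j) w = A (Suc j) + pscale (s j + a * b ^ j) (B j)" if "j \<le> l" for j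
    using that xop_pow_A1[of j] xop_pow_B[of j]
    by (simp add: w_def is_linear_addD[OF M.linear_xop_pow] is_linear_scaleD[OF M.linear_xop_pow]
        pm.scale_left_distrib add.assoc)
  \<comment> \<open>For a = 1 the vector w would be X A_0 and generate nothing new. This is excluded
    because (l)_b + b^l = (l + 1)_b is nonzero.\<close>
  have a1: "a \<noteq> 1"
  proof
    assume "a = 1"
    moreover have "a * b ^ l = - s l" using b by (simp add: a_def)
    ultimately show False using nz by (simp add: s_Suc')
  qed
  let ?S = "(\<lambda>j. (xop n M ^^ j) (A 0)) ` {..Suc l} \<union> (\<lambda>j. (xop n M ^^ j) w) ` {..l - 1}"
  have A0: "(xop n M ^^ j) (A 0) \<in> pm.span ?S" if "j \<le> Suc l" for j
    using that by (intro pm.span_base UnI1) auto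
  have W: "(xop n M ^^ j) w \<in> pm.span ?S" if "j < l" for j
    using that by (intro pm.span_base UnI2) auto
  have Bj: "B j \<in> pm.span ?S" if "j \<le> l" for j
  \<comment> \<open>B_l comes from the top power X^(l + 1) A_0. Each lower B_j is the difference of
    corresponding members of the two strings, divided by (1 - a) b^j.\<close>
  proof (cases "j = l")
    case True
    have "pscale (1 / s (Suc l)) ((xop n M ^^ Suc l) (A 0)) \<in> pm.span ?S"
      by (intro pm.span_scale A0) simp
    then show ?thesis
      using nz xop_pow_A[of l] by (simp add: A_last True del: funpow.simps)
  next
    case False
    have c: "s (Suc j) - (s j + a * b ^ j) = (1 - a) * b ^ j"
      by (simp add: s_Suc' algebra_simps)
    have "(xop n M ^^ Suc j) (A 0) - (xop n M ^^ j) w = pscale ((1 - a) * b ^ j) (B j)"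
      unfolding xop_pow_A[OF that] w_pow[OF that] c[symmetric] pm.scale_left_diff_distrib by simp
    moreover have "(xop n M ^^ Suc j) (A 0) - (xop n M ^^ j) w \<in> pm.span ?S"
      using False that by (intro pm.span_diff A0 W) auto
    ultimately have "pscale (1 / ((1 - a) * b ^ j)) (pscale ((1 - a) * b ^ j) (B j)) \<in> pm.span ?S"
      using pm.span_scale by metis
    then show ?thesis using a1 b by simp
  qed
  have span: "cspace M \<subseteq> pm.span ?S" by (rule cspace_spanI[OF A0[OF le_SucI] Bj])
  show ?thesis
  proof (rule iso_csum_uniI[OF is_com _ _ _ _ _ span])
    show "hmg M (0 mod n) (A 0)" using hmg_A0 by simp
    have "(xop n M ^^ Suc (Suc l)) (A 0) = xop n M (pscale (s (Suc l)) (B l))"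
      using xop_pow_A[of l] by (simp add: A_last)
    then show "(xop n M ^^ Suc (Suc l)) (A 0) = 0"
      by (simp add: is_linear_scaleD[OF M.linear_xop] xop_B B_last)
    show "hmg M (1 mod n) w"
      using hmg_A1 hmg_B0 unfolding w_def hmg_def
      by (simp add: pm.subspace_add[OF subspace_cspace] pm.subspace_scale[OF subspace_cspace]
          is_linear_addD[OF M.linear_coact_at] is_linear_scaleD[OF M.linear_coact_at])
    have "s l + a * b ^ l = 0" using b by (simp add: a_def)
    then show "(xop n M ^^ Suc (l - 1)) w = 0"
      using w_pow[of l] l by (simp add: A_last del: funpow.simps)
    show "cdim M = Suc (Suc l) + Suc (l - 1)" using dim l by simp
  qed
qed

text \<open>If (l + 1)_b = 0, the string of A_0 stops one step early and is complemented by the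
  string of B_0, which has the same length.\<close>

lemma iso_root:
  assumes z: "s (Suc l) = 0"
  shows "comodule_iso (uni n 0 l \<oplus>c uni n 1 l) M"
proof -
  let ?S = "(\<lambda>j. (xop n M ^^ j) (A 0)) ` {..l} \<union> (\<lambda>j. (xop n M ^^ j) (B 0)) ` {..l}"
  have A0: "(xop n M ^^ j) (A 0) \<in> pm.span ?S" if "j \<le> l" for j
    using that by (intro pm.span_base UnI1) auto
  have Bj: "B j \<in> pm.span ?S" if "j \<le> l" for j
  proof -
    have "(xop n M ^^ j) (B 0) \<in> pm.span ?S"
      using that by (intro pm.span_base UnI2) auto
    then have "pscale (1 / b ^ j) ((xop n M ^^ j) (B 0)) \<in> pm.span ?S" by (rule pm.span_scale)
    then show ?thesis using that b by (simp add: xop_pow_B)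
  qed
  have span: "cspace M \<subseteq> pm.span ?S" by (rule cspace_spanI[OF A0 Bj])
  show ?thesis
  proof (rule iso_csum_uniI[OF is_com _ _ _ _ dim span])
    show "hmg M (0 mod n) (A 0)" using hmg_A0 by simp
    show "hmg M (1 mod n) (B 0)" by (rule hmg_B0)
    show "(xop n M ^^ Suc l) (A 0) = 0"
      using xop_pow_A[of l] z by (simp add: A_last del: funpow.simps)
    show "(xop n M ^^ Suc l) (B 0) = 0"
      using xop_pow_B[of "Suc l"] by (simp add: B_last del: funpow.simps)
  qed
qed

end

context root_of_unity
begin

text \<open>Moving X past f_1, of degree 1, costs a factor q, hence b = q. The index of f_0
  \<otimes> f_j is j and that of f_1 \<otimes> f_j is l + 1 + j; the value 0 beyond l supplies
  A_{l+1} = B_{l+1} = 0.\<close>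

lemma ladder_left:
  "ladder n q (uni n 0 1 \<otimes>c uni n 0 l) (\<lambda>j. if j \<le> l then bvec j else 0)
    (\<lambda>j. if j \<le> l then bvec (Suc l + j) else 0) q l"
proof -
  let ?U = "uni n 0 1 :: 'k comodule" and ?V = "uni n 0 l :: 'k comodule"
  interpret T: tensor_pair n ?U ?V q by (rule tensor_pairI[OF is_comodule_uni is_comodule_uni])
  have a: "bvec j = ft (cdim ?V) (bvec 0) (bvec j)" and b: "bvec (Suc l + j) = ft (cdim ?V) (bvec 1) (bvec j)" for j
    by simp_all
  have h: "hmg ?U 0 (bvec 0)" "hmg ?U (1 mod n) (bvec 1)" "j \<le> l \<Longrightarrow> hmg ?V (j mod n) (bvec j)" for j
    using hmg_uni[of 0 1 0] hmg_uni[of 1 1 0] hmg_uni[of j l 0] by simp_all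
  have lin: "is_linear (xop n (?U \<otimes>c ?V))" by (rule is_linear_xop[OF linear_coact_ctensor])
  show ?thesis
  proof
    show "is_comodule n (?U \<otimes>c ?V)" by (rule T.is_comodule_ctensor)
    fix j assume j: "j \<le> l"
    show "xop n (?U \<otimes>c ?V) (if j \<le> l then bvec j else 0)
      = (if Suc j \<le> l then bvec (Suc j) else 0) + (if j \<le> l then bvec (Suc l + j) else 0)"
      using j T.xop_ft[OF h(1) h(3)[OF j]] by (simp add: xop_uni add.commute split: if_splits)
    have "q ^ (1 mod n) = q" using T.q_mod[of 1] by simp
    then show "xop n (?U \<otimes>c ?V) (if j \<le> l then bvec (Suc l + j) else 0)
      = pscale q (if Suc j \<le> l then bvec (Suc l + Suc j) else 0)"
      using j T.xop_ft[OF h(2) h(3)[OF j]] by (simp add: xop_uni split: if_splits)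
  next
    show "hmg (?U \<otimes>c ?V) 0 (if 0 \<le> l then bvec 0 else 0)"
      using T.hmg_ft[OF h(1) h(3)[of 0]] by simp
    show "hmg (?U \<otimes>c ?V) (1 mod n) (if 1 \<le> l then bvec 1 else 0)"
      using T.hmg_ft[OF h(1) h(3)[of 1]] comodule.hmg_zero[OF T.comodule_ctensor, of "1 mod n"]
      by (cases "1 \<le> l") (simp_all only: add_0 mod_mod_trivial ft_bvec mult_zero_left if_True if_False simp_thms)
    show "hmg (?U \<otimes>c ?V) (1 mod n) (if 0 \<le> l then bvec (Suc l + 0) else 0)"
      using T.hmg_ft[OF h(2) h(3)[OF le0]]
      by (simp only: mod_0 add_0_right mod_mod_trivial ft_bvec mult_1 cdim_uni le0 if_True)
    show "q \<noteq> 0" by (rule q_nonzero)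
    show "cspace (?U \<otimes>c ?V) \<subseteq> pm.span ((\<lambda>j. if j \<le> l then bvec j else 0) ` {..l} \<union>
        (\<lambda>j. if j \<le> l then bvec (Suc l + j) else 0) ` {..l})" (is "_ \<subseteq> pm.span ?S")
    proof -
      have "bvec a \<in> ?S" if "a < Suc l + Suc l" for a
      proof (cases "a \<le> l")
        case False
        then have "bvec a = (\<lambda>j. if j \<le> l then bvec (Suc l + j) else 0) (a - Suc l)" "a - Suc l \<in> {..l}"
          using that by auto
        then show ?thesis by blast
      qed auto
      then show ?thesis
        unfolding cspace_def span_on_eq_span by (intro pm.span_mono) auto
    qed
  qed simp_all
qed

text \<open>Here X (f_j \<otimes> f_0) = f_{j+1} \<otimes> f_0 + q^j f_j \<otimes> f_1, and the
  second term is taken as B_j. This rescaling turns X (f_j \<otimes> f_1) = f_{j+1} \<otimes> f_1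
  into X B_j = (1 / q) B_{j+1}.\<close>

lemma ladder_right:
  "ladder n q (uni n 0 l \<otimes>c uni n 0 1) (\<lambda>j. if j \<le> l then bvec (2 * j) else 0)
    (\<lambda>j. if j \<le> l then pscale (q ^ j) (bvec (2 * j + 1)) else 0) (1 / q) l"
proof -
  let ?U = "uni n 0 1 :: 'k comodule" and ?V = "uni n 0 l :: 'k comodule"
  interpret T: tensor_pair n ?V ?U q by (rule tensor_pairI[OF is_comodule_uni is_comodule_uni])
  have h: "hmg ?U 0 (bvec 0)" "hmg ?U (1 mod n) (bvec 1)" "j \<le> l \<Longrightarrow> hmg ?V (j mod n) (bvec j)" for j
    using hmg_uni[of 0 1 0] hmg_uni[of 1 1 0] hmg_uni[of j l 0] by simp_all
  have lin: "is_linear (xop n (?V \<otimes>c ?U))" by (rule is_linear_xop[OF linear_coact_ctensor])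
  show ?thesis
  proof
    show "is_comodule n (?V \<otimes>c ?U)" by (rule T.is_comodule_ctensor)
    fix j assume j: "j \<le> l"
    show "xop n (?V \<otimes>c ?U) (if j \<le> l then bvec (2 * j) else 0)
      = (if Suc j \<le> l then bvec (2 * Suc j) else 0) + (if j \<le> l then pscale (q ^ j) (bvec (2 * j + 1)) else 0)"
      using j T.xop_ft[OF h(3)[OF j] h(1)] by (simp add: xop_uni T.q_mod mult_2 split: if_splits)
    show "xop n (?V \<otimes>c ?U) (if j \<le> l then pscale (q ^ j) (bvec (2 * j + 1)) else 0)
      = pscale (1 / q) (if Suc j \<le> l then pscale (q ^ Suc j) (bvec (2 * Suc j + 1)) else 0)"
      using j T.xop_ft[OF h(3)[OF j] h(2)] q_nonzero
      by (simp add: xop_uni mult_2 is_linear_scaleD[OF is_linear_xop[OF linear_coact_ctensor]] del: pscale_single split: if_splits)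
  next
    show "hmg (?V \<otimes>c ?U) 0 (if 0 \<le> l then bvec (2 * 0) else 0)"
      using T.hmg_ft[OF h(3)[of 0] h(1)] by simp
    show "hmg (?V \<otimes>c ?U) (1 mod n) (if 1 \<le> l then bvec (2 * 1) else 0)"
    proof -
      have "ft (cdim ?U) (bvec 1) (bvec 0) = (bvec (2 * 1) :: nat \<Rightarrow>\<^sub>0 'k)"
        by (simp add: numeral_2_eq_2)
      then show ?thesis
        using T.hmg_ft[OF h(3)[of 1] h(1)] comodule.hmg_zero[OF T.comodule_ctensor, of "1 mod n"]
        by (cases "1 \<le> l") (simp_all only: add_0_right mod_mod_trivial if_True if_False simp_thms)
    qed
    show "hmg (?V \<otimes>c ?U) (1 mod n) (if 0 \<le> l then pscale (q ^ 0) (bvec (2 * 0 + 1)) else 0)"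
    proof -
      have "ft (cdim ?U) (bvec 0) (bvec 1) = (bvec (2 * 0 + 1) :: nat \<Rightarrow>\<^sub>0 'k)" by simp
      then show ?thesis
        using T.hmg_ft[OF h(3)[OF le0] h(2)]
        by (simp only: mod_0 add_0 mod_mod_trivial power_0 pscale_1 le0 if_True)
    qed
    show "1 / q \<noteq> 0" using q_nonzero by simp
    show "cspace (?V \<otimes>c ?U) \<subseteq> pm.span ((\<lambda>j. if j \<le> l then bvec (2 * j) else 0) ` {..l} \<union>
        (\<lambda>j. if j \<le> l then pscale (q ^ j) (bvec (2 * j + 1)) else 0) ` {..l})" (is "_ \<subseteq> pm.span ?S")
    proof -
      have "bvec a \<in> pm.span ?S" if a: "a < Suc l + Suc l" for a
      proof (cases "even a")
        case True
        then obtain j where j: "a = 2 * j" by blast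
        then have "bvec a = (\<lambda>j. if j \<le> l then bvec (2 * j) else 0) j" "j \<in> {..l}"
          using a by auto
        then show ?thesis by (intro pm.span_base) blast
      next
        case False
        then obtain j where j: "a = 2 * j + 1" by (elim oddE)
        then have "pscale (q ^ j) (bvec a) = (\<lambda>j. if j \<le> l then pscale (q ^ j) (bvec (2 * j + 1)) else 0) j" "j \<in> {..l}"
          using a by auto
        then have "pscale (q ^ j) (bvec a) \<in> pm.span ?S" by (intro pm.span_base) blast
        then have "pscale (1 / q ^ j) (pscale (q ^ j) (bvec a)) \<in> pm.span ?S" by (rule pm.span_scale)
        then show ?thesis using q_nonzero by simp
      qed
      then show ?thesis
        unfolding cspace_def span_on_eq_span by (intro pm.span_minimal pm.subspace_span) auto
    qed
  qed simp_all
qed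

text \<open>Reversing the summation shows that the q-integers for q and 1 / q vanish together, so
  both orders of the product are generic for the same l.\<close>

lemma sum_powers_inverse: "(\<Sum>i<Suc l. (1 / q) ^ i) = (\<Sum>i<Suc l. q ^ i) / q ^ l"
proof -
  have "(\<Sum>i<Suc l. q ^ i) / q ^ l = (\<Sum>i<Suc l. q ^ (l - i) / q ^ l)"
    by (subst sum.nat_diff_reindex[symmetric]) (simp only: sum_divide_distrib diff_Suc_Suc)
  also have "\<dots> = (\<Sum>i<Suc l. (1 / q) ^ i)"
    by (intro sum.cong refl) (use q_nonzero in \<open>simp add: power_diff field_simps\<close>)
  finally show ?thesis ..
qed

lemma iso_y_uni:
  assumes "(\<Sum>i<Suc l. q ^ i) \<noteq> 0" "l > 0"
  shows "comodule_iso (uni n 0 (Suc l) \<oplus>c uni n 1 (l - 1)) (uni n 0 1 \<otimes>c uni n 0 l)"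
    and "comodule_iso (uni n 0 (Suc l) \<oplus>c uni n 1 (l - 1)) (uni n 0 l \<otimes>c uni n 0 1)"
proof -
  interpret L: ladder n q "uni n 0 1 \<otimes>c uni n 0 l" "\<lambda>j. if j \<le> l then bvec j else 0"
    "\<lambda>j. if j \<le> l then bvec (Suc l + j) else 0" q l by (rule ladder_left)
  show "comodule_iso (uni n 0 (Suc l) \<oplus>c uni n 1 (l - 1)) (uni n 0 1 \<otimes>c uni n 0 l)"
    by (rule L.iso_generic) (use assms in \<open>simp_all only: L.s_def not_False_eq_True\<close>)
  interpret R: ladder n q "uni n 0 l \<otimes>c uni n 0 1" "\<lambda>j. if j \<le> l then bvec (2 * j) else 0"
    "\<lambda>j. if j \<le> l then pscale (q ^ j) (bvec (2 * j + 1)) else 0" "1 / q" l by (rule ladder_right)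
  have "R.s (Suc l) \<noteq> 0"
    unfolding R.s_def sum_powers_inverse using assms(1) q_nonzero by (simp only: divide_eq_0_iff power_eq_0_iff simp_thms)
  then show "comodule_iso (uni n 0 (Suc l) \<oplus>c uni n 1 (l - 1)) (uni n 0 l \<otimes>c uni n 0 1)"
    by (rule R.iso_generic) (rule assms(2))
qed

lemma iso_y_uni_root:
  assumes "(\<Sum>i<Suc l. q ^ i) = 0"
  shows "comodule_iso (uni n 0 l \<oplus>c uni n 1 l) (uni n 0 1 \<otimes>c uni n 0 l)"
proof -
  interpret L: ladder n q "uni n 0 1 \<otimes>c uni n 0 l" "\<lambda>j. if j \<le> l then bvec j else 0"
    "\<lambda>j. if j \<le> l then bvec (Suc l + j) else 0" q l by (rule ladder_left)
  show ?thesis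
    by (rule L.iso_root) (use assms in \<open>simp only: L.s_def\<close>)
qed

text \<open>Tensoring with a one-dimensional comodule shifts degrees. On the left it also rescales X
  by q^r, which the basis absorbs because q is nonzero.\<close>

lemma iso_x_uni:
  "comodule_iso (uni n (r + t) l) (uni n r 0 \<otimes>c uni n t l)"
  "comodule_iso (uni n (r + t) l) (uni n t l \<otimes>c uni n r 0)"
proof -
  let ?U = "uni n r 0 :: 'k comodule" and ?V = "uni n t l :: 'k comodule"
  have h: "hmg ?U (r mod n) (bvec 0)" "j \<le> l \<Longrightarrow> hmg ?V ((t + j) mod n) (bvec j)" for j
    using hmg_uni[of 0 0 r] hmg_uni[of j l t] by simp_all
  interpret L: tensor_pair n ?U ?V q by (rule tensor_pairI[OF is_comodule_uni is_comodule_uni])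
  have Lp: "(xop n (?U \<otimes>c ?V) ^^ j) (bvec 0) = (if j \<le> l then pscale (q ^ (r * j)) (bvec j) else 0)" for j
  proof (induction j)
    case (Suc j)
    have lin: "is_linear (xop n (?U \<otimes>c ?V))" by (rule is_linear_xop[OF linear_coact_ctensor])
    show ?case
    proof (cases "j \<le> l")
      case True
      have "xop n (?U \<otimes>c ?V) (bvec j) = (if j < l then pscale (q ^ r) (bvec (Suc j)) else 0)"
        using L.xop_ft[OF h(1) h(2)[OF True]] by (simp add: xop_uni L.q_mod split: if_splits)
      then show ?thesis using Suc True
        by (simp add: is_linear_scaleD[OF lin] power_add mult.commute del: pscale_single)
    qed (use Suc in \<open>simp add: is_linear_zeroD[OF lin]\<close>)
  qed simp
  show "comodule_iso (uni n (r + t) l) (?U \<otimes>c ?V)"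
  proof (rule iso_uniI[OF L.is_comodule_ctensor])
    show "hmg (?U \<otimes>c ?V) ((r + t) mod n) (bvec 0)"
      using L.hmg_ft[OF h(1) h(2)[of 0]] by (simp add: mod_simps)
    show "(xop n (?U \<otimes>c ?V) ^^ Suc l) (bvec 0) = 0" unfolding Lp by simp
    have "bvec j \<in> pm.span ((\<lambda>j. (xop n (?U \<otimes>c ?V) ^^ j) (bvec 0)) ` {..l})" if "j \<le> l" for j
    proof -
      have "pscale (1 / q ^ (r * j)) ((xop n (?U \<otimes>c ?V) ^^ j) (bvec 0))
          \<in> pm.span ((\<lambda>j. (xop n (?U \<otimes>c ?V) ^^ j) (bvec 0)) ` {..l})"
        using that by (intro pm.span_scale pm.span_base) auto
      then show ?thesis using that q_nonzero by (simp add: Lp)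
    qed
    then show "cspace (?U \<otimes>c ?V) \<subseteq> pm.span ((\<lambda>j. (xop n (?U \<otimes>c ?V) ^^ j) (bvec 0)) ` {..l})"
      unfolding cspace_def span_on_eq_span
      by (intro pm.span_minimal pm.subspace_span) (auto simp: less_Suc_eq_le)
  qed simp
  interpret R: tensor_pair n ?V ?U q by (rule tensor_pairI[OF is_comodule_uni is_comodule_uni])
  have Rp: "(xop n (?V \<otimes>c ?U) ^^ j) (bvec 0) = (if j \<le> l then bvec j else 0)" for j
  proof (induction j)
    case (Suc j)
    have lin: "is_linear (xop n (?V \<otimes>c ?U))" by (rule is_linear_xop[OF linear_coact_ctensor])
    show ?case
    proof (cases "j \<le> l")
      case True
      have "xop n (?V \<otimes>c ?U) (bvec j) = (if j < l then bvec (Suc j) else 0)"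
        using R.xop_ft[OF h(2)[OF True] h(1)] by (simp add: xop_uni split: if_splits)
      then show ?thesis using Suc True by simp
    qed (use Suc in \<open>simp add: is_linear_zeroD[OF lin]\<close>)
  qed simp
  show "comodule_iso (uni n (r + t) l) (?V \<otimes>c ?U)"
  proof (rule iso_uniI[OF R.is_comodule_ctensor])
    show "hmg (?V \<otimes>c ?U) ((r + t) mod n) (bvec 0)"
      using R.hmg_ft[OF h(2)[of 0] h(1)] by (simp add: mod_simps add.commute)
    show "(xop n (?V \<otimes>c ?U) ^^ Suc l) (bvec 0) = 0" unfolding Rp by simp
    have "bvec j \<in> pm.span ((\<lambda>j. (xop n (?V \<otimes>c ?U) ^^ j) (bvec 0)) ` {..l})" if "j \<le> l" for j
      using that by (intro pm.span_base image_eqI[of _ _ j]) (simp_all add: Rp)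
    then show "cspace (?V \<otimes>c ?U) \<subseteq> pm.span ((\<lambda>j. (xop n (?V \<otimes>c ?U) ^^ j) (bvec 0)) ` {..l})"
      unfolding cspace_def span_on_eq_span
      by (intro pm.span_minimal pm.subspace_span) (auto simp: less_Suc_eq_le)
  qed simp
qed

lemma iso_uni_cunit: "comodule_iso (uni n 0 0) (cunit :: 'k comodule)"
  by (rule iso_uniI[OF is_comodule_cunit, of _ "bvec 0"])
    (use n_pos hmg_cunit in \<open>simp_all add: xop_cunit cspace_cunit\<close>)

end

section \<open>Biadditive products on free abelian groups\<close>

section \<open>Free abelian groups and monoid rings\<close>

lemma sum_single_keys: "(\<Sum>a\<in>Poly_Mapping.keys f. Poly_Mapping.single a (Poly_Mapping.lookup f a)) = f"
  by (rule poly_mapping_eqI) (simp add: lookup_sum lookup_single when_def sum.delta' in_keys_iff)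

lemma keys_sum_subset:
  "(\<And>i. i \<in> A \<Longrightarrow> Poly_Mapping.keys (f i) \<subseteq> C) \<Longrightarrow> Poly_Mapping.keys (\<Sum>i\<in>A. f i) \<subseteq> C"
proof (induction A rule: infinite_finite_induct)
  case (insert x F)
  then have "Poly_Mapping.keys (f x) \<subseteq> C" "Poly_Mapping.keys (sum f F) \<subseteq> C" by auto
  then show ?case
    using insert(1,2) Poly_Mapping.keys_add[of "f x" "sum f F"] by auto
qed auto

lemma keys_uminus [simp]: "Poly_Mapping.keys (- f) = Poly_Mapping.keys (f :: 'a \<Rightarrow>\<^sub>0 'b::ab_group_add)"
  by (auto simp: in_keys_iff)

lemma keys_add_subset: "Poly_Mapping.keys f \<subseteq> C \<Longrightarrow> Poly_Mapping.keys g \<subseteq> C \<Longrightarrow> Poly_Mapping.keys (f + g) \<subseteq> C"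
  using Poly_Mapping.keys_add[of f g] by blast

lemma keys_diff_subset:
  "Poly_Mapping.keys f \<subseteq> C \<Longrightarrow> Poly_Mapping.keys g \<subseteq> C \<Longrightarrow> Poly_Mapping.keys (f - g :: 'a \<Rightarrow>\<^sub>0 'b::ab_group_add) \<subseteq> C"
  using keys_add_subset[of f C "- g"] by simp

lemma keys_subset_induct [consumes 1, case_names zero single add]:
  fixes f :: "'a \<Rightarrow>\<^sub>0 'b::comm_monoid_add"
  assumes f: "Poly_Mapping.keys f \<subseteq> C" and "P 0" and single: "\<And>A c. A \<in> C \<Longrightarrow> P (Poly_Mapping.single A c)"
    and add: "\<And>f g. Poly_Mapping.keys f \<subseteq> C \<Longrightarrow> Poly_Mapping.keys g \<subseteq> C \<Longrightarrow> P f \<Longrightarrow> P g \<Longrightarrow> P (f + g)"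
  shows "P f"
proof -
  let ?s = "\<lambda>a. Poly_Mapping.single a (Poly_Mapping.lookup f a)"
  have "finite F \<Longrightarrow> F \<subseteq> Poly_Mapping.keys f \<Longrightarrow> P (\<Sum>a\<in>F. ?s a)" for F
  proof (induction F rule: finite_induct)
    case (insert x F)
    have "Poly_Mapping.keys (\<Sum>a\<in>F. ?s a) \<subseteq> C"
      by (rule keys_sum_subset) (use insert.prems f in auto)
    then have "P (?s x + (\<Sum>a\<in>F. ?s a))"
      using insert f by (intro add single) auto
    then show ?case using insert by simp
  qed (simp add: assms(2))
  from this[of "Poly_Mapping.keys f"] show ?thesis by (simp add: sum_single_keys)
qed

text \<open>The biadditive extension of an operation on basis elements; for
  \<open>class_tensor\<close> it is the multiplication of \<open>free_green\<close>.\<close>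

definition bil :: "('a \<Rightarrow> 'a \<Rightarrow> 'a) \<Rightarrow> ('a \<Rightarrow>\<^sub>0 int) \<Rightarrow> ('a \<Rightarrow>\<^sub>0 int) \<Rightarrow> ('a \<Rightarrow>\<^sub>0 int)" where
  "bil h f g = (\<Sum>A\<in>Poly_Mapping.keys f. \<Sum>B\<in>Poly_Mapping.keys g.
     Poly_Mapping.single (h A B) (Poly_Mapping.lookup f A * Poly_Mapping.lookup g B))"

lemma bil_add_left: "bil h (f + f') g = bil h f g + bil h f' g"
  unfolding bil_def
  by (rule setsum_keys_plus_distrib[where f = "\<lambda>A c. \<Sum>B\<in>Poly_Mapping.keys g.
        Poly_Mapping.single (h A B) (c * Poly_Mapping.lookup g B)"])
    (simp_all add: distrib_right single_add sum.distrib)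

lemma bil_add_right: "bil h f (g + g') = bil h f g + bil h f g'"
proof -
  have swap: "bil h f g = (\<Sum>B\<in>Poly_Mapping.keys g. \<Sum>A\<in>Poly_Mapping.keys f.
      Poly_Mapping.single (h A B) (Poly_Mapping.lookup f A * Poly_Mapping.lookup g B))" for g
    unfolding bil_def by (rule sum.swap)
  show ?thesis
    unfolding swap
    by (rule setsum_keys_plus_distrib[where f = "\<lambda>B c. \<Sum>A\<in>Poly_Mapping.keys f.
          Poly_Mapping.single (h A B) (Poly_Mapping.lookup f A * c)"])
      (simp_all add: distrib_left single_add sum.distrib)
qed

lemma bil_zero [simp]: "bil h 0 g = 0" "bil h f 0 = 0"
  by (simp_all add: bil_def)

lemma bil_uminus: "bil h (- f) g = - bil h f g" "bil h f (- g) = - bil h f g"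
  using bil_add_left[of h f "- f" g] bil_add_right[of h f g "- g"]
  by (simp_all add: eq_neg_iff_add_eq_0 add.commute)

lemma bil_diff: "bil h (f - f') g = bil h f g - bil h f' g" "bil h f (g - g') = bil h f g - bil h f g'"
  using bil_add_left[of h f "- f'" g] bil_add_right[of h f g "- g'"] by (simp_all add: bil_uminus)

lemma bil_single [simp]:
  "bil h (Poly_Mapping.single A a) (Poly_Mapping.single B b) = Poly_Mapping.single (h A B) (a * b)"
  by (simp add: bil_def)

lemma keys_bil:
  assumes "Poly_Mapping.keys f \<subseteq> C" "Poly_Mapping.keys g \<subseteq> C" "\<And>A B. A \<in> C \<Longrightarrow> B \<in> C \<Longrightarrow> h A B \<in> C"
  shows "Poly_Mapping.keys (bil h f g) \<subseteq> C"
  unfolding bil_def using assms by (intro keys_sum_subset) (auto split: if_splits)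

text \<open>Associativity is asked for on \<open>C\<close> only, because for
  \<open>class_tensor\<close> it is available on isomorphism classes.\<close>

lemma bil_assoc:
  assumes C: "\<And>A B D. A \<in> C \<Longrightarrow> B \<in> C \<Longrightarrow> D \<in> C \<Longrightarrow> h (h A B) D = h A (h B D)"
    and f: "Poly_Mapping.keys f \<subseteq> C" and g: "Poly_Mapping.keys g \<subseteq> C" and k: "Poly_Mapping.keys k \<subseteq> C"
  shows "bil h (bil h f g) k = bil h f (bil h g k)"
  using f
proof (induction f rule: keys_subset_induct)
  case (single A a)
  note A = single
  show ?case using g
  proof (induction g rule: keys_subset_induct)
    case (single B b)
    note B = single
    show ?case using k
      by (induction k rule: keys_subset_induct) (simp_all add: C A B bil_add_right mult.assoc)
  qed (simp_all add: bil_add_left bil_add_right)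
qed (simp_all add: bil_add_left)

lemma bil_one_left:
  assumes "\<And>A. A \<in> C \<Longrightarrow> h e A = A" "Poly_Mapping.keys f \<subseteq> C"
  shows "bil h (Poly_Mapping.single e 1) f = f"
  using assms(2) by (induction f rule: keys_subset_induct) (simp_all add: assms(1) bil_add_right)

lemma bil_one_right:
  assumes "\<And>A. A \<in> C \<Longrightarrow> h A e = A" "Poly_Mapping.keys f \<subseteq> C"
  shows "bil h f (Poly_Mapping.single e 1) = f"
  using assms(2) by (induction f rule: keys_subset_induct) (simp_all add: assms(1) bil_add_left)

text \<open>An additive map on the integers takes only multiples of its value at 1. This passes from
  coefficient 1 to arbitrary coefficients.\<close>

lemma additive_int_mem:
  fixes r :: "int \<Rightarrow> 'b::ab_group_add"
  assumes add: "\<And>a b. r (a + b) = r a + r b" and H: "0 \<in> H" "\<And>x y. x \<in> H \<Longrightarrow> y \<in> H \<Longrightarrow> x + y \<in> H"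
      "\<And>x. x \<in> H \<Longrightarrow> - x \<in> H" and r1: "r 1 \<in> H"
  shows "r c \<in> H"
proof -
  have r0: "r 0 = 0" using add[of 0 0] by simp
  have neg: "r (- a) = - r a" for a using add[of a "- a"] r0 by (simp add: eq_neg_iff_add_eq_0 add.commute)
  have nat: "r (int k) \<in> H" for k
    by (induction k) (simp_all add: r0 H add r1)
  show ?thesis by (cases c rule: int_cases2) (simp_all only: nat neg H)
qed

section \<open>The Green ring as a quotient by a two-sided ideal\<close>

section \<open>The Green ring\<close>

lemma additive_extension:
  fixes h :: "'a \<Rightarrow> 'b::comm_monoid_add \<Rightarrow> 'c::comm_monoid_add"
  assumes "\<And>A. h A 0 = 0" "\<And>A b c. h A (b + c) = h A b + h A c"
  shows "(\<Sum>A\<in>Poly_Mapping.keys (f + g). h A (Poly_Mapping.lookup (f + g) A))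
    = (\<Sum>A\<in>Poly_Mapping.keys f. h A (Poly_Mapping.lookup f A)) + (\<Sum>A\<in>Poly_Mapping.keys g. h A (Poly_Mapping.lookup g A))"
  by (rule setsum_keys_plus_distrib) (simp_all add: assms)

context root_of_unity
begin

definition isoclasses :: "'k comodule set set" where
  "isoclasses = iso_class n ` {M. is_comodule n M}"

lemma iso_class_in [simp]: "is_comodule n M \<Longrightarrow> iso_class n M \<in> isoclasses"
  by (simp add: isoclasses_def)

lemma iso_class_eqI:
  fixes M N :: "'k comodule"
  assumes M: "is_comodule n M" and MN: "comodule_iso M N"
  shows "iso_class n M = iso_class n N"
  unfolding iso_class_def
  using comodule_iso_trans[OF MN] comodule_iso_trans[OF comodule_iso_sym[OF M MN]] by blast

text \<open>The union over all representatives is a union of equal classes, since the tensor product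
  respects isomorphism.\<close>

lemma class_tensor_iso_class:
  assumes M: "is_comodule n M" and N: "is_comodule n N"
  shows "class_tensor n q (iso_class n M) (iso_class n N) = iso_class n (M \<otimes>c N)"
proof -
  have "iso_class n (M' \<otimes>c N') = iso_class n (M \<otimes>c N)" if "M' \<in> iso_class n M" "N' \<in> iso_class n N" for M' N'
  proof -
    have "is_comodule n M'" "is_comodule n N'" "comodule_iso M M'" "comodule_iso N N'"
      using that by (auto simp: iso_class_def)
    then show ?thesis
      using iso_class_eqI[OF is_comodule_ct[OF M N] iso_ctensor_cong[OF M N]] by simp
  qed
  moreover have "M \<in> iso_class n M" "N \<in> iso_class n N"
    using M N comodule_iso_refl by (auto simp: iso_class_def)
  ultimately show ?thesis unfolding class_tensor_def by blast
qed

abbreviation mul (infixl "\<star>" 70) where "f \<star> g \<equiv> bil (class_tensor n q) f g"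

abbreviation cls :: "'k comodule \<Rightarrow> ('k comodule set \<Rightarrow>\<^sub>0 int)" where
  "cls M \<equiv> Poly_Mapping.single (iso_class n M) 1"

abbreviation G :: "('k comodule set \<Rightarrow>\<^sub>0 int) ring" where "G \<equiv> free_green n q"

lemma carrier_G: "carrier G = {f. Poly_Mapping.keys f \<subseteq> isoclasses}"
  and mult_G: "f \<otimes>\<^bsub>G\<^esub> g = f \<star> g"
  and one_G: "\<one>\<^bsub>G\<^esub> = cls cunit"
  and zero_G: "\<zero>\<^bsub>G\<^esub> = 0"
  and add_G: "f \<oplus>\<^bsub>G\<^esub> g = f + g"
  by (simp_all add: free_green_def isoclasses_def bil_def)

lemma cls_eqI: "is_comodule n M \<Longrightarrow> comodule_iso M N \<Longrightarrow> cls M = cls N"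
  by (simp only: iso_class_eqI)

lemma cls_mul:
  "is_comodule n M \<Longrightarrow> is_comodule n N \<Longrightarrow> cls M \<star> cls N = cls (M \<otimes>c N)"
  by (simp add: class_tensor_iso_class)

lemma cls_in: "is_comodule n M \<Longrightarrow> Poly_Mapping.keys (cls M) \<subseteq> isoclasses"
  by simp

lemma class_tensor_in: "A \<in> isoclasses \<Longrightarrow> B \<in> isoclasses \<Longrightarrow> class_tensor n q A B \<in> isoclasses"
  by (auto simp: isoclasses_def class_tensor_iso_class is_comodule_ct)

lemma class_tensor_assoc:
  assumes "A \<in> isoclasses" "B \<in> isoclasses" "D \<in> isoclasses"
  shows "class_tensor n q (class_tensor n q A B) D = class_tensor n q A (class_tensor n q B D)"
proof -
  obtain M N P where "A = iso_class n M" "B = iso_class n N" "D = iso_class n P"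
    "is_comodule n M" "is_comodule n N" "is_comodule n P"
    using assms by (auto simp: isoclasses_def)
  then show ?thesis
    using iso_class_eqI[OF is_comodule_ct[OF is_comodule_ct] iso_assoc, of M N P]
    by (simp add: class_tensor_iso_class is_comodule_ct)
qed

lemma class_tensor_unit:
  assumes "A \<in> isoclasses"
  shows "class_tensor n q (iso_class n cunit) A = A" "class_tensor n q A (iso_class n cunit) = A"
proof -
  obtain M where M: "A = iso_class n M" "is_comodule n M" using assms by (auto simp: isoclasses_def)
  then show "class_tensor n q (iso_class n cunit) A = A"
    using iso_class_eqI[OF is_comodule_ct[OF is_comodule_cunit] iso_unit_left, of M]
    by (simp add: class_tensor_iso_class is_comodule_cunit)
  show "class_tensor n q A (iso_class n cunit) = A"
    using M iso_class_eqI[OF is_comodule_ct[OF _ is_comodule_cunit] iso_unit_right, of M]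
    by (simp add: class_tensor_iso_class is_comodule_cunit)
qed

lemma mul_assoc:
  "Poly_Mapping.keys f \<subseteq> isoclasses \<Longrightarrow> Poly_Mapping.keys g \<subseteq> isoclasses \<Longrightarrow> Poly_Mapping.keys k \<subseteq> isoclasses \<Longrightarrow>
    f \<star> g \<star> k = f \<star> (g \<star> k)"
  by (rule bil_assoc[where C = isoclasses]) (rule class_tensor_assoc)

lemma ring_G: "ring G"
proof (rule ringI)
  show "abelian_group G"
  proof (rule abelian_groupI)
    fix x assume "x \<in> carrier G"
    then show "\<exists>y\<in>carrier G. y \<oplus>\<^bsub>G\<^esub> x = \<zero>\<^bsub>G\<^esub>"
      by (intro bexI[of _ "- x"]) (simp_all add: carrier_G add_G zero_G)
  qed (simp_all add: carrier_G add_G zero_G add_ac keys_add_subset)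
  show "Group.monoid G"
  proof (rule monoidI)
    show "x \<otimes>\<^bsub>G\<^esub> y \<in> carrier G" if "x \<in> carrier G" "y \<in> carrier G" for x y
      using that by (simp add: carrier_G mult_G keys_bil class_tensor_in)
    show "\<one>\<^bsub>G\<^esub> \<in> carrier G"
      by (simp add: carrier_G one_G is_comodule_cunit)
    show "x \<otimes>\<^bsub>G\<^esub> y \<otimes>\<^bsub>G\<^esub> z = x \<otimes>\<^bsub>G\<^esub> (y \<otimes>\<^bsub>G\<^esub> z)"
      if "x \<in> carrier G" "y \<in> carrier G" "z \<in> carrier G" for x y z
      using that by (simp add: carrier_G mult_G mul_assoc)
    show "\<one>\<^bsub>G\<^esub> \<otimes>\<^bsub>G\<^esub> x = x" "x \<otimes>\<^bsub>G\<^esub> \<one>\<^bsub>G\<^esub> = x" if "x \<in> carrier G" for x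
      using that bil_one_left[of isoclasses "class_tensor n q" "iso_class n cunit" x]
        bil_one_right[of isoclasses "class_tensor n q" "iso_class n cunit" x]
      by (simp_all add: carrier_G mult_G one_G class_tensor_unit)
  qed
qed (simp_all add: mult_G add_G bil_add_left bil_add_right)

sublocale G: ring G by (rule ring_G)

definition I :: "('k comodule set \<Rightarrow>\<^sub>0 int) set" where
  "I = generate (add_monoid G) (split_relations n)"

lemma split_relations_carrier: "split_relations n \<subseteq> carrier (add_monoid G)"
proof
  fix f :: "'k comodule set \<Rightarrow>\<^sub>0 int" assume "f \<in> split_relations n"
  then obtain M N where f: "f = cls (M \<oplus>c N) - cls M - cls N" and MN: "is_comodule n M" "is_comodule n N"
    unfolding split_relations_def by blast
  show "f \<in> carrier (add_monoid G)"
    unfolding f using is_comodule_cs[OF MN] MN by (simp add: carrier_G keys_diff_subset del: keys_single, intro keys_diff_subset cls_in)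
qed

lemma subgroup_I: "subgroup I (add_monoid G)"
  unfolding I_def by (rule group.generate_is_subgroup[OF G.add.is_group split_relations_carrier])

lemma I_carrier: "f \<in> I \<Longrightarrow> Poly_Mapping.keys f \<subseteq> isoclasses"
  using subgroup.subset[OF subgroup_I] by (auto simp: carrier_G)

lemma a_inv_G: "Poly_Mapping.keys f \<subseteq> isoclasses \<Longrightarrow> \<ominus>\<^bsub>G\<^esub> f = - f"
  by (rule G.minus_equality) (simp_all add: carrier_G add_G zero_G)

lemma inv_add_G: "Poly_Mapping.keys f \<subseteq> isoclasses \<Longrightarrow> inv\<^bsub>add_monoid G\<^esub> f = - f"
  using a_inv_G by (simp add: a_inv_def)

lemma I_zero: "0 \<in> I"
  using subgroup.one_closed[OF subgroup_I] by (simp add: zero_G)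

lemma I_add: "f \<in> I \<Longrightarrow> g \<in> I \<Longrightarrow> f + g \<in> I"
  using subgroup.m_closed[OF subgroup_I] by (simp add: add_G)

lemma I_uminus: "f \<in> I \<Longrightarrow> - f \<in> I"
  using subgroup.m_inv_closed[OF subgroup_I, of f] inv_add_G[OF I_carrier, of f] by metis

lemma I_diff: "f \<in> I \<Longrightarrow> g \<in> I \<Longrightarrow> f - g \<in> I"
  using I_add[of f "- g"] I_uminus by simp

lemma I_split: "is_comodule n M \<Longrightarrow> is_comodule n N \<Longrightarrow> cls (M \<oplus>c N) - cls M - cls N \<in> I"
  unfolding I_def by (rule generate.incl) (auto simp: split_relations_def)

lemma I_split_scaled:
  assumes "is_comodule n M" "is_comodule n N"
  shows "Poly_Mapping.single (iso_class n (M \<oplus>c N)) c - Poly_Mapping.single (iso_class n M) c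
    - Poly_Mapping.single (iso_class n N) c \<in> I"
  by (rule additive_int_mem[where H = I]) (simp_all add: single_add I_zero I_add I_uminus I_split assms)

lemma I_induct [consumes 1, case_names zero split uminus add]:
  assumes "f \<in> I" "P 0" "\<And>M N. is_comodule n M \<Longrightarrow> is_comodule n N \<Longrightarrow> P (cls (M \<oplus>c N) - cls M - cls N)"
    "\<And>f. P f \<Longrightarrow> P (- f)" "\<And>f g. P f \<Longrightarrow> P g \<Longrightarrow> P (f + g)"
  shows "P f"
  using assms(1) unfolding I_def
proof (induction f rule: generate.induct)
  case one
  then show ?case using assms(2) by (simp add: zero_G)
next
  case (incl h)
  then show ?case using assms(3) by (auto simp: split_relations_def)
next
  case (inv h)
  then have "Poly_Mapping.keys h \<subseteq> isoclasses" using split_relations_carrier by (auto simp: carrier_G)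
  moreover have "P h" using inv assms(3) by (auto simp: split_relations_def)
  ultimately show ?case using assms(4) by (metis inv_add_G)
next
  case (eng h1 h2)
  then show ?case using assms(5) by (simp add: add_G)
qed

text \<open>By distributivity, multiplying a split relation by a class gives a split relation again,
  scaled by the coefficient of that class.\<close>

lemma I_mul_left:
  assumes f: "f \<in> I" and g: "Poly_Mapping.keys g \<subseteq> isoclasses"
  shows "g \<star> f \<in> I"
  using g
proof (induction g rule: keys_subset_induct)
  case (single A c)
  then obtain P where P: "A = iso_class n P" "is_comodule n P" by (auto simp: isoclasses_def)
  from f show ?case
  proof (induction f rule: I_induct)
    case (split M N)
    have "iso_class n (P \<otimes>c (M \<oplus>c N)) = iso_class n (P \<otimes>c M \<oplus>c P \<otimes>c N)"
      using iso_class_eqI[OF is_comodule_cs iso_distrib_left] P split by (simp add: is_comodule_ct)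
    then have "Poly_Mapping.single A c \<star> (cls (M \<oplus>c N) - cls M - cls N) =
      Poly_Mapping.single (iso_class n (P \<otimes>c M \<oplus>c P \<otimes>c N)) c
      - Poly_Mapping.single (iso_class n (P \<otimes>c M)) c - Poly_Mapping.single (iso_class n (P \<otimes>c N)) c"
      using P split by (simp add: bil_diff class_tensor_iso_class is_comodule_cs)
    then show ?case using I_split_scaled[of "P \<otimes>c M" "P \<otimes>c N" c] P split by (simp add: is_comodule_ct)
  qed (simp_all add: I_zero bil_uminus I_uminus bil_add_right I_add)
qed (simp_all add: I_zero bil_add_left I_add)

lemma I_mul_right:
  assumes f: "f \<in> I" and g: "Poly_Mapping.keys g \<subseteq> isoclasses"
  shows "f \<star> g \<in> I"
  using g
proof (induction g rule: keys_subset_induct)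
  case (single A c)
  then obtain P where P: "A = iso_class n P" "is_comodule n P" by (auto simp: isoclasses_def)
  from f show ?case
  proof (induction f rule: I_induct)
    case (split M N)
    have "iso_class n ((M \<oplus>c N) \<otimes>c P) = iso_class n (M \<otimes>c P \<oplus>c N \<otimes>c P)"
      using iso_class_eqI[OF is_comodule_ct iso_distrib_right] P split by (simp add: is_comodule_cs)
    then have "(cls (M \<oplus>c N) - cls M - cls N) \<star> Poly_Mapping.single A c =
      Poly_Mapping.single (iso_class n (M \<otimes>c P \<oplus>c N \<otimes>c P)) c
      - Poly_Mapping.single (iso_class n (M \<otimes>c P)) c - Poly_Mapping.single (iso_class n (N \<otimes>c P)) c"
      using P split by (simp add: bil_diff class_tensor_iso_class is_comodule_cs)
    then show ?case using I_split_scaled[of "M \<otimes>c P" "N \<otimes>c P" c] P split by (simp add: is_comodule_ct)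
  qed (simp_all add: I_zero bil_uminus I_uminus bil_add_left I_add)
qed (simp_all add: I_zero bil_add_right I_add)

text \<open>The quotient in \<open>green_ring\<close> is formed by the additive subgroup of the
  relations; distributivity on both sides makes it an ideal, so that the quotient is a ring.\<close>

lemma ideal_I: "ideal I G"
  by (rule idealI[OF ring_G subgroup_I]) (simp_all add: mult_G carrier_G I_mul_left I_mul_right)

sublocale I: ideal I G by (rule ideal_I)

lemma green_ring_eq: "green_ring n q = G Quot I"
  by (simp add: green_ring_def I_def)

lemma ring_green: "ring (green_ring n q)"
  unfolding green_ring_eq by (rule I.quotient_is_ring)

subsection \<open>Congruence modulo the split relations\<close>

text \<open>Calculations in the Green ring are carried out with representatives in the free group,
  and cosets appear only at the end.\<close>

definition cong (infix "\<approx>" 50) where "f \<approx> g \<longleftrightarrow> f - g \<in> I"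

lemma cong_refl [simp]: "f \<approx> f"
  by (simp add: cong_def I_zero)

lemma cong_sym: "f \<approx> g \<Longrightarrow> g \<approx> f"
  using I_uminus[of "f - g"] by (simp add: cong_def)

lemma cong_trans [trans]: "f \<approx> g \<Longrightarrow> g \<approx> h \<Longrightarrow> f \<approx> h"
  using I_add[of "f - g" "g - h"] by (simp add: cong_def)

lemma cong_add: "f \<approx> f' \<Longrightarrow> g \<approx> g' \<Longrightarrow> f + g \<approx> f' + g'"
  using I_add[of "f - f'" "g - g'"] by (simp add: cong_def algebra_simps)

lemma cong_diff: "f \<approx> f' \<Longrightarrow> g \<approx> g' \<Longrightarrow> f - g \<approx> f' - g'"
  using I_diff[of "f - f'" "g - g'"] by (simp add: cong_def algebra_simps)

lemma cong_mul:
  assumes "f \<approx> f'" "g \<approx> g'" "Poly_Mapping.keys f' \<subseteq> isoclasses" "Poly_Mapping.keys g \<subseteq> isoclasses"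
  shows "f \<star> g \<approx> f' \<star> g'"
proof -
  have "(f - f') \<star> g + f' \<star> (g - g') \<in> I"
    using assms by (intro I_add I_mul_left I_mul_right) (auto simp: cong_def)
  then show ?thesis by (simp add: cong_def bil_diff)
qed

lemma cong_cls_csum: "is_comodule n M \<Longrightarrow> is_comodule n N \<Longrightarrow> cls (M \<oplus>c N) \<approx> cls M + cls N"
  using I_split[of M N] by (simp add: cong_def algebra_simps)

text \<open>The additive extension of \<open>rk\<close> to the free group. The choice of a
  representative is immaterial because \<open>rk\<close> is invariant under isomorphism.\<close>

definition rank :: "path \<Rightarrow> ('k comodule set \<Rightarrow>\<^sub>0 int) \<Rightarrow> int" where
  "rank p f = (\<Sum>A\<in>Poly_Mapping.keys f. Poly_Mapping.lookup f A * int (rk (SOME M. M \<in> A) p))"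

lemma rank_add: "rank p (f + g) = rank p f + rank p g"
  unfolding rank_def
  by (rule additive_extension[where h = "\<lambda>A c. c * int (rk (SOME M. M \<in> A) p)"]) (simp_all add: distrib_right)

lemma rank_zero [simp]: "rank p 0 = 0"
  by (simp add: rank_def)

lemma rank_uminus: "rank p (- f) = - rank p f"
  using rank_add[of p f "- f"] by simp

lemma rank_single:
  assumes "is_comodule n M"
  shows "rank p (Poly_Mapping.single (iso_class n M) c) = c * int (rk M p)"
proof -
  have "M \<in> iso_class n M" using assms comodule_iso_refl by (simp add: iso_class_def)
  then have "(SOME N. N \<in> iso_class n M) \<in> iso_class n M" by (rule someI)
  then have "rk (SOME N. N \<in> iso_class n M) p = rk M p"
    using rk_iso[OF assms, of "SOME N. N \<in> iso_class n M" p] by (simp add: iso_class_def)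
  then show ?thesis by (simp add: rank_def)
qed

text \<open>Additivity of \<open>rk\<close> over direct sums makes the rank a function on the Green
  ring.\<close>

lemma rank_I: "f \<in> I \<Longrightarrow> rank p f = 0"
proof (induction f rule: I_induct)
  case (split M N)
  have "rank p (cls (M \<oplus>c N) + (- cls M + - cls N)) = 0"
    unfolding rank_add rank_uminus
    using split comodule_pair.rk_csum[OF comodule_pairI[OF split], of p]
    by (simp add: rank_single is_comodule_cs)
  then show ?case by (simp add: algebra_simps)
qed (simp_all add: rank_uminus rank_add)

end

section \<open>Normal forms modulo the ideal of relations\<close>

section \<open>Reduction in the polynomial ring\<close>

text \<open>The homogenized Chebyshev polynomial of the second kind, formally x^(l/2) U_l(y / (2
  sqrt x)). For \<open>l = d - 1\<close> it is the sum in the second generator of the ideal.\<close>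

definition cheb :: "nat \<Rightarrow> 'a::comm_ring_1 \<Rightarrow> 'a \<Rightarrow> 'a" where
  "cheb l x y = (\<Sum>i=0..l div 2. (- 1) ^ i * of_nat ((l - i) choose i) * x ^ i * y ^ (l - 2 * i))"

text \<open>The added binomials vanish. A free upper limit lets the three sums of the recursion be
  compared term by term.\<close>

lemma cheb_eq:
  assumes "l div 2 \<le> N"
  shows "cheb l x y = (\<Sum>i\<le>N. (- 1) ^ i * of_nat ((l - i) choose i) * x ^ i * y ^ (l - 2 * i))"
  unfolding cheb_def atLeast0AtMost
proof (rule sum.mono_neutral_left)
  show "\<forall>i\<in>{..N} - {..l div 2}. (- 1) ^ i * of_nat ((l - i) choose i) * x ^ i * y ^ (l - 2 * i) = 0"
  proof
    fix i assume "i \<in> {..N} - {..l div 2}"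
    then have "l - i < i" by auto
    then show "(- 1) ^ i * of_nat ((l - i) choose i) * x ^ i * y ^ (l - 2 * i) = 0"
      by (simp add: binomial_eq_0)
  qed
qed (use assms in auto)

lemma cheb_0 [simp]: "cheb 0 x y = 1"
  and cheb_1 [simp]: "cheb (Suc 0) x y = y"
  by (simp_all add: cheb_def)

lemma cheb_rec: "cheb (Suc (Suc l)) x y = y * cheb (Suc l) x y - x * cheb l x y"
proof -
  let ?f = "\<lambda>l i. (- 1) ^ i * of_nat ((l - i) choose i) * x ^ i * y ^ (l - 2 * i)"
  have "x * cheb l x y = (\<Sum>i\<le>l. x * ?f l i)"
    by (simp add: cheb_eq[of l l] sum_distrib_left)
  moreover have "y * cheb (Suc l) x y = y * ?f (Suc l) 0 + (\<Sum>i\<le>l. y * ?f (Suc l) (Suc i))"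
  proof -
    have "cheb (Suc l) x y = (\<Sum>i\<le>Suc l. ?f (Suc l) i)" by (rule cheb_eq) simp
    then show ?thesis by (simp only: sum.atMost_Suc_shift distrib_left sum_distrib_left)
  qed
  moreover have "cheb (Suc (Suc l)) x y = ?f (Suc (Suc l)) 0 + (\<Sum>i\<le>l. ?f (Suc (Suc l)) (Suc i))"
  proof -
    have "cheb (Suc (Suc l)) x y = (\<Sum>i\<le>Suc l. ?f (Suc (Suc l)) i)" by (rule cheb_eq) simp
    then show ?thesis by (simp only: sum.atMost_Suc_shift)
  qed
  moreover have "?f (Suc (Suc l)) (Suc i) = y * ?f (Suc l) (Suc i) - x * ?f l i" if "i \<le> l" for i
  \<comment> \<open>Below l the exponents are honest differences and Pascal's rule applies. For l =
    2 i the term with \<open>Suc l\<close> vanishes and the other two match; beyond that all three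
    binomials are 0.\<close>
  proof (cases "2 * i < l")
    case True
    then obtain k where l: "l = 2 * i + Suc k" using less_imp_Suc_add[OF True] by auto
    have "Suc (Suc l) - Suc i = Suc (i + Suc k)" "Suc l - Suc i = i + Suc k" "l - i = i + Suc k"
      "Suc (Suc l) - 2 * Suc i = Suc k" "Suc l - 2 * Suc i = k" "l - 2 * i = Suc k"
      by (simp_all add: l)
    then show ?thesis by (simp only: binomial_Suc_Suc of_nat_add) (simp add: algebra_simps)
  next
    case False
    then consider "l = 2 * i" | "l < 2 * i" by linarith
    then show ?thesis
    proof cases
      case 1
      then show ?thesis by (simp add: binomial_eq_0)
    next
      case 2
      then have "Suc (Suc l) - Suc i < Suc i" "Suc l - Suc i < Suc i" "l - i < i" using that by auto
      then show ?thesis by (simp only: binomial_eq_0) simp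
    qed
  qed
  ultimately show ?thesis
    by (simp add: sum_subtractf)
qed

lemma pvar_power: "pvar v ^ k = Poly_Mapping.single (Poly_Mapping.single v k) 1"
  by (induction k) (simp_all add: pvar_def mult_single single_one flip: single_add)

text \<open>The filtration by degree in y, with x and z left unrestricted.\<close>

definition ydeg :: "nat \<Rightarrow> int_poly3 set" where
  "ydeg k = {p. \<forall>m\<in>Poly_Mapping.keys p. Poly_Mapping.lookup m VarY \<le> k}"

lemma ydeg_add: "p \<in> ydeg k \<Longrightarrow> p' \<in> ydeg k \<Longrightarrow> p + p' \<in> ydeg k"
  using Poly_Mapping.keys_add[of p p'] unfolding ydeg_def by blast

lemma ydeg_uminus: "p \<in> ydeg k \<Longrightarrow> - p \<in> ydeg k"
  by (simp add: ydeg_def)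

lemma ydeg_diff: "p \<in> ydeg k \<Longrightarrow> p' \<in> ydeg k \<Longrightarrow> p - p' \<in> ydeg k"
  using ydeg_add[of p k "- p'"] ydeg_uminus by simp

lemma ydeg_mult: "p \<in> ydeg k \<Longrightarrow> p' \<in> ydeg k' \<Longrightarrow> p * p' \<in> ydeg (k + k')"
  using Poly_Mapping.keys_mult[of p p'] unfolding ydeg_def
  by (fastforce simp: lookup_add intro: add_mono)

lemma ydeg_mono: "p \<in> ydeg k \<Longrightarrow> k \<le> k' \<Longrightarrow> p \<in> ydeg k'"
  unfolding ydeg_def by fastforce

lemma ydeg_zero: "0 \<in> ydeg k"
  by (simp add: ydeg_def)

lemma ydeg_sum: "(\<And>i. i \<in> A \<Longrightarrow> f i \<in> ydeg k) \<Longrightarrow> (\<Sum>i\<in>A. f i) \<in> ydeg k"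
  by (induction A rule: infinite_finite_induct) (simp_all add: ydeg_zero ydeg_add)

lemma ydeg_one: "1 \<in> ydeg 0"
  by (simp add: ydeg_def)

lemma ydeg_of_int: "of_int c \<in> ydeg 0"
proof -
  have "of_int c = Poly_Mapping.single (0 :: var3 \<Rightarrow>\<^sub>0 nat) c"
    by (metis of_int_eq_id id_apply single_of_int)
  then show ?thesis by (simp add: ydeg_def)
qed

lemma ydeg_x_power: "pvar VarX ^ k \<in> ydeg 0"
  and ydeg_y_power: "pvar VarY ^ k \<in> ydeg k"
  by (simp_all add: pvar_power ydeg_def lookup_single)

text \<open>Only the term i = 0 reaches y^l. Being monic in y, the polynomial can be used to lower
  the degree in y.\<close>

lemma cheb_ydeg:
  assumes "l > 0"
  shows "cheb l (pvar VarX) (pvar VarY) - pvar VarY ^ l \<in> ydeg (l - 1)"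
proof -
  let ?f = "\<lambda>i. (- 1) ^ i * of_nat ((l - i) choose i) * pvar VarX ^ i * pvar VarY ^ (l - 2 * i) :: int_poly3"
  have "cheb l (pvar VarX) (pvar VarY) = (\<Sum>i\<le>l. ?f i)"
    by (rule cheb_eq) simp
  also have "\<dots> = pvar VarY ^ l + (\<Sum>i<l. ?f (Suc i))"
    by (subst lessThan_Suc_atMost[symmetric], subst sum.lessThan_Suc_shift) simp
  finally have "cheb l (pvar VarX) (pvar VarY) - pvar VarY ^ l = (\<Sum>i<l. ?f (Suc i))" by simp
  also have "\<dots> \<in> ydeg (l - 1)"
  proof (rule ydeg_sum)
    fix i
    have c: "(- 1) ^ Suc i * of_nat ((l - Suc i) choose Suc i) = (of_int ((- 1) ^ Suc i * of_nat ((l - Suc i) choose Suc i)) :: int_poly3)"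
      by simp
    have "?f (Suc i) \<in> ydeg (0 + 0 + (l - 2 * Suc i))"
      unfolding c by (intro ydeg_mult ydeg_of_int ydeg_x_power ydeg_y_power)
    then show "?f (Suc i) \<in> ydeg (l - 1)" by (rule ydeg_mono) simp
  qed
  finally show ?thesis .
qed

lemma ideal_green_ideal: "ideal (green_ideal n d) int_poly3_ring"
  unfolding green_ideal_def Let_def
  by (rule ring.genideal_ideal[OF ring_from_type_algebra]) (simp add: ring_of_type_algebra_def)

lemma green_ideal_add: "p \<in> green_ideal n d \<Longrightarrow> p' \<in> green_ideal n d \<Longrightarrow> p + p' \<in> green_ideal n d"
  using additive_subgroup.a_closed[OF ideal.axioms(1)[OF ideal_green_ideal]]
  by (simp add: ring_of_type_algebra_def)

lemma green_ideal_mult: "p \<in> green_ideal n d \<Longrightarrow> p' * p \<in> green_ideal n d"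
  using ideal.I_l_closed[OF ideal_green_ideal, of p n d p']
  by (simp add: ring_of_type_algebra_def)

lemma green_ideal_zero: "0 \<in> green_ideal n d"
  using additive_subgroup.zero_closed[OF ideal.axioms(1)[OF ideal_green_ideal, of n d]]
  by (simp add: ring_of_type_algebra_def)

lemma green_ideal_gens:
  "pvar VarX ^ n - 1 \<in> green_ideal n d"
  "(pvar VarY - pvar VarX - 1) * cheb (d - 1) (pvar VarX) (pvar VarY) \<in> green_ideal n d"
  using ring.genideal_self[OF ring_from_type_algebra, where S = "{pvar VarX ^ n - 1,
      (pvar VarY - pvar VarX - 1) * cheb (d - 1) (pvar VarX) (pvar VarY)}"]
  by (simp_all add: green_ideal_def Let_def cheb_def ring_of_type_algebra_def)

lemma green_ideal_minimal:
  assumes "ideal K int_poly3_ring" "pvar VarX ^ n - 1 \<in> K"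
    "(pvar VarY - pvar VarX - 1) * cheb (d - 1) (pvar VarX) (pvar VarY) \<in> K"
  shows "green_ideal n d \<subseteq> K"
  unfolding green_ideal_def Let_def
  by (rule ring.genideal_minimal[OF ring_from_type_algebra assms(1)])
    (use assms(2,3) in \<open>simp add: cheb_def\<close>)

text \<open>Exponents of z are unrestricted because neither relation involves z.\<close>

definition reduced :: "nat \<Rightarrow> nat \<Rightarrow> (var3 \<Rightarrow>\<^sub>0 nat) set" where
  "reduced n d = {m. Poly_Mapping.lookup m VarX < n \<and> Poly_Mapping.lookup m VarY < d}"

definition mono3 :: "nat \<Rightarrow> nat \<Rightarrow> nat \<Rightarrow> (var3 \<Rightarrow>\<^sub>0 nat)" where
  "mono3 a b c = Poly_Mapping.single VarX a + Poly_Mapping.single VarY b + Poly_Mapping.single VarZ c"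

lemma lookup_mono3 [simp]:
  "Poly_Mapping.lookup (mono3 a b c) VarX = a"
  "Poly_Mapping.lookup (mono3 a b c) VarY = b"
  "Poly_Mapping.lookup (mono3 a b c) VarZ = c"
  by (simp_all add: mono3_def lookup_add lookup_single)

lemma mono3_eta: "mono3 (Poly_Mapping.lookup m VarX) (Poly_Mapping.lookup m VarY) (Poly_Mapping.lookup m VarZ) = m"
proof (rule poly_mapping_eqI)
  fix v
  show "Poly_Mapping.lookup (mono3 (Poly_Mapping.lookup m VarX) (Poly_Mapping.lookup m VarY) (Poly_Mapping.lookup m VarZ)) v
      = Poly_Mapping.lookup m v"
    by (cases v) simp_all
qed

lemma mono3_add: "mono3 a b c + mono3 a' b' c' = mono3 (a + a') (b + b') (c + c')"
  by (simp add: mono3_def single_add add_ac)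

lemma pvar_eq_mono3:
  "pvar VarX ^ k = Poly_Mapping.single (mono3 k 0 0) 1"
  "pvar VarY ^ k = Poly_Mapping.single (mono3 0 k 0) 1"
  "pvar VarZ ^ k = Poly_Mapping.single (mono3 0 0 k) 1"
  by (simp_all add: pvar_power mono3_def)

lemma pvar_mult_mono3:
  "pvar VarX ^ k * Poly_Mapping.single (mono3 a b c) e = Poly_Mapping.single (mono3 (k + a) b c) e"
  "pvar VarY ^ k * Poly_Mapping.single (mono3 a b c) e = Poly_Mapping.single (mono3 a (k + b) c) e"
  "pvar VarZ ^ k * Poly_Mapping.single (mono3 a b c) e = Poly_Mapping.single (mono3 a b (k + c)) e"
  by (simp_all add: pvar_eq_mono3 mult_single mono3_add)

text \<open>The generators are monic in x of degree n and in y of degree d, which permits division.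
  In place of a termination argument, the set \<open>U\<close> of polynomials having a normal form
  is shown to be closed under addition and under multiplication by x and y; it contains the powers
  of z.\<close>

lemma reduction:
  assumes n: "n > 0" and d: "d \<ge> 2"
  shows "\<exists>r. Poly_Mapping.keys r \<subseteq> reduced n d \<and> p - r \<in> green_ideal n d"
proof -
  define U where "U = {p. \<exists>r. Poly_Mapping.keys r \<subseteq> reduced n d \<and> p - r \<in> green_ideal n d}"
  have U_add: "p + p' \<in> U" if pp: "p \<in> U" "p' \<in> U" for p p'
  proof -
    from pp obtain r r' where r: "Poly_Mapping.keys r \<subseteq> reduced n d" "p - r \<in> green_ideal n d"
      "Poly_Mapping.keys r' \<subseteq> reduced n d" "p' - r' \<in> green_ideal n d" unfolding U_def by blast
    have "p + p' - (r + r') = (p - r) + (p' - r')" by simp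
    also have "\<dots> \<in> green_ideal n d" by (rule green_ideal_add[OF r(2,4)])
    finally show ?thesis unfolding U_def using keys_add_subset[OF r(1,3)] by blast
  qed
  have U_red: "p \<in> U" if "Poly_Mapping.keys p \<subseteq> reduced n d" for p
    unfolding U_def using that green_ideal_zero by (intro CollectI exI[of _ p]) simp
  have U_J: "p \<in> U" if "p \<in> green_ideal n d" for p
    unfolding U_def using that by (intro CollectI exI[of _ 0]) simp
  have U_zero: "0 \<in> U" by (rule U_J[OF green_ideal_zero])
  \<comment> \<open>Modulo the ideal, \<open>p\<close> may be replaced by its normal form, so
    multiplication by \<open>s\<close> has to be tested on reduced monomials only.\<close>
  have U_mult: "s * p \<in> U" if p: "p \<in> U" and s: "\<And>m c. m \<in> reduced n d \<Longrightarrow> s * Poly_Mapping.single m c \<in> U" for s p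
  proof -
    from p obtain r where r: "Poly_Mapping.keys r \<subseteq> reduced n d" "p - r \<in> green_ideal n d" unfolding U_def by blast
    have "s * r \<in> U"
      using r(1) by (induction r rule: keys_subset_induct) (simp_all add: U_zero s distrib_left U_add)
    moreover have "s * (p - r) \<in> U" by (rule U_J[OF green_ideal_mult[OF r(2)]])
    ultimately have "s * r + s * (p - r) \<in> U" by (rule U_add)
    then show ?thesis by (simp add: algebra_simps)
  qed
  have x: "pvar VarX * p \<in> U" if "p \<in> U" for p
  proof (rule U_mult[OF that])
    fix m c assume m: "m \<in> reduced n d"
    obtain a b e where mm: "m = mono3 a b e" using mono3_eta by metis
    have ab: "a < n" "b < d" using m by (auto simp: mm reduced_def)
    have xm: "pvar VarX * Poly_Mapping.single m c = Poly_Mapping.single (mono3 (Suc a) b e) c"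
      using pvar_mult_mono3(1)[of 1 a b e c] by (simp add: mm)
    show "pvar VarX * Poly_Mapping.single m c \<in> U"
    proof (cases "Suc a < n")
      case True
      then show ?thesis unfolding xm using ab by (intro U_red) (auto simp: reduced_def)
    next
      case False
      then have "Suc a = n" using ab by simp
      then have eq: "Poly_Mapping.single (mono3 (Suc a) b e) c
          = (Poly_Mapping.single (mono3 0 b e) c) * (pvar VarX ^ n - 1) + Poly_Mapping.single (mono3 0 b e) c"
        using pvar_mult_mono3(1)[of n 0 b e c] by (simp add: algebra_simps)
      have "Poly_Mapping.single (mono3 0 b e) c \<in> U"
        by (rule U_red) (use ab n in \<open>auto simp: reduced_def\<close>)
      then show ?thesis unfolding xm eq
        by (rule U_add[OF U_J[OF green_ideal_mult[OF green_ideal_gens(1)]]])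
    qed
  qed
  have xk: "pvar VarX ^ k * p \<in> U" if "p \<in> U" for k p
    using that by (induction k) (simp_all add: x mult.assoc)
  \<comment> \<open>The exponents of x are arbitrary here; closure under multiplication by x folds
    them back below n.\<close>
  have low: "p \<in> U" if "p \<in> ydeg (d - 1)" for p
  proof -
    have "Poly_Mapping.keys p \<subseteq> {m. Poly_Mapping.lookup m VarY \<le> d - 1}" using that by (auto simp: ydeg_def)
    then show ?thesis
    proof (induction p rule: keys_subset_induct)
      case (single m c)
      obtain a b e where m: "m = mono3 a b e" using mono3_eta by metis
      have "b < d" using single d by (simp add: m)
      then have "Poly_Mapping.single (mono3 0 b e) c \<in> U"
        using n by (intro U_red) (auto simp: reduced_def)
      then show ?case using xk[of _ a] pvar_mult_mono3(1)[of a 0 b e c] by (metis add_0_right m)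
    qed (auto simp: U_zero U_add)
  qed
  have y: "pvar VarY * p \<in> U" if "p \<in> U" for p
  proof (rule U_mult[OF that])
    fix m c assume m: "m \<in> reduced n d"
    obtain a b e where mm: "m = mono3 a b e" using mono3_eta by metis
    have ab: "a < n" "b < d" using m by (auto simp: mm reduced_def)
    have ym: "pvar VarY * Poly_Mapping.single m c = Poly_Mapping.single (mono3 a (Suc b) e) c"
      using pvar_mult_mono3(2)[of 1 a b e c] by (simp add: mm)
    show "pvar VarY * Poly_Mapping.single m c \<in> U"
    proof (cases "Suc b < d")
      case True
      then show ?thesis unfolding ym using ab by (intro U_red) (auto simp: reduced_def)
    next
      case False
      then have b: "Suc b = d" using ab by simp
      let ?S = "cheb (d - 1) (pvar VarX) (pvar VarY) :: int_poly3" and ?w = "Poly_Mapping.single (mono3 a 0 e) c"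
      let ?g = "(pvar VarY - pvar VarX - 1) * ?S"
      \<comment> \<open>The remainder of y^d. Since S - y^(d - 1) has degree at most d - 2 in y,
        every term of r has degree at most d - 1.\<close>
      define r where "r = (pvar VarX + 1) * ?S - pvar VarY * (?S - pvar VarY ^ (d - 1))"
      have "pvar VarY ^ d = pvar VarY * pvar VarY ^ (d - 1)" using d by (metis Suc_diff_le diff_Suc_1 numeral_2_eq_2 power_Suc b)
      then have yd: "pvar VarY ^ d = ?g + r" by (simp add: r_def algebra_simps)
      have S0: "?S - pvar VarY ^ (d - 1) \<in> ydeg (d - 1 - 1)" by (rule cheb_ydeg) (use d in simp)
      have "?S - pvar VarY ^ (d - 1) + pvar VarY ^ (d - 1) \<in> ydeg (d - 1)"
        by (rule ydeg_add[OF ydeg_mono[OF S0] ydeg_y_power]) simp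
      then have S: "?S \<in> ydeg (d - 1)" by simp
      have "(pvar VarX + 1) * ?S \<in> ydeg (0 + (d - 1))"
        using ydeg_x_power[of 1] by (intro ydeg_mult ydeg_add ydeg_one S) simp
      moreover have "pvar VarY * (?S - pvar VarY ^ (d - 1)) \<in> ydeg (1 + (d - 1 - 1))"
        using ydeg_y_power[of 1] by (intro ydeg_mult S0) simp
      moreover have "1 + (d - 1 - 1) = d - 1" using d by simp
      ultimately have "r \<in> ydeg (d - 1)" unfolding r_def by (intro ydeg_diff) (simp_all only: add_0)
      moreover have "?w \<in> ydeg 0" by (simp add: ydeg_def)
      ultimately have rw: "r * ?w \<in> U" using ydeg_mult[of r "d - 1" ?w 0] low by simp
      have "Poly_Mapping.single (mono3 a (Suc b) e) c = pvar VarY ^ d * ?w"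
        using pvar_mult_mono3(2)[of d a 0 e c] b by simp
      also have "\<dots> = ?w * ?g + r * ?w" unfolding yd by (simp add: algebra_simps)
      also have "\<dots> \<in> U" by (intro U_add U_J green_ideal_mult green_ideal_gens rw)
      finally show ?thesis unfolding ym .
    qed
  qed
  have yk: "pvar VarY ^ k * p \<in> U" if "p \<in> U" for k p
    using that by (induction k) (simp_all add: y mult.assoc)
  have "p \<in> U" for p
  proof -
    have "Poly_Mapping.keys p \<subseteq> UNIV" by simp
    then show ?thesis
    proof (induction p rule: keys_subset_induct)
      case (single m c)
      obtain a b e where m: "m = mono3 a b e" using mono3_eta by metis
      have "Poly_Mapping.single (mono3 0 0 e) c \<in> U"
        using n d by (intro U_red) (auto simp: reduced_def)
      then have "pvar VarX ^ a * (pvar VarY ^ b * Poly_Mapping.single (mono3 0 0 e) c) \<in> U"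
        by (intro xk yk)
      then show ?case by (simp add: pvar_mult_mono3 m)
    qed (auto simp: U_zero U_add)
  qed
  then show ?thesis unfolding U_def by blast
qed

section \<open>The evaluation homomorphism, its image and its kernel\<close>

section \<open>The presentation\<close>

declare bil_single [simp del]

locale green = root_of_unity n q for n and q :: "'k::field_char_0" +
  fixes d :: nat
  assumes d2: "d \<ge> 2" and q_d: "q ^ d = 1" and ord: "\<And>e. 0 < e \<Longrightarrow> e < d \<Longrightarrow> q ^ e \<noteq> 1"
begin

lemma q_neq_1: "q \<noteq> 1"
  using ord[of 1] d2 by simp

lemma q_sum: "(q - 1) * (\<Sum>i<k. q ^ i) = q ^ k - 1"
  using power_diff_1_eq[of q k] by simp

lemma q_sum_eq_0: "(\<Sum>i<d. q ^ i) = 0"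
  using q_sum[of d] q_neq_1 q_d by simp

lemma q_sum_nonzero: "0 < k \<Longrightarrow> k < d \<Longrightarrow> (\<Sum>i<k + c * d. q ^ i) \<noteq> 0"
proof
  assume k: "0 < k" "k < d" and "(\<Sum>i<k + c * d. q ^ i) = 0"
  then have "q ^ (k + c * d) = 1" using q_sum[of "k + c * d"] by simp
  then have "q ^ k = 1" by (simp add: power_add power_mult q_d mult.commute[of c d])
  then show False using ord k by blast
qed

abbreviation Xc :: "'k comodule" where "Xc \<equiv> uni n 1 0"
abbreviation Yc :: "'k comodule" where "Yc \<equiv> uni n 0 1"
abbreviation Zc :: "'k comodule" where "Zc \<equiv> uni n 0 d"

text \<open>The product x^a y^b z^c with brackets nested to the right, so that each step is a
  multiplication from the left by one generator.\<close>

definition W :: "nat \<Rightarrow> nat \<Rightarrow> nat \<Rightarrow> 'k comodule" where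
  "W a b c = (ctensor n q Xc ^^ a) ((ctensor n q Yc ^^ b) ((ctensor n q Zc ^^ c) cunit))"

lemma W_simps:
  "W 0 0 0 = cunit" "W (Suc a) b c = Xc \<otimes>c W a b c" "W 0 (Suc b) c = Yc \<otimes>c W 0 b c"
  "W 0 0 (Suc c) = Zc \<otimes>c W 0 0 c"
  by (simp_all add: W_def)

lemma is_comodule_W: "is_comodule n (W a b c)"
proof -
  have "is_comodule n (W 0 0 c)"
    by (induction c) (simp_all add: W_simps is_comodule_cunit is_comodule_ct is_comodule_uni)
  then have "is_comodule n (W 0 b c)"
    by (induction b) (simp_all add: W_simps is_comodule_ct is_comodule_uni)
  then show ?thesis
    by (induction a) (simp_all add: W_simps is_comodule_ct is_comodule_uni)
qed

lemma peak_ct: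
  assumes "is_comodule n M" "is_comodule n N" "peak M a l" "peak N b m" "gauss_binom l m q \<noteq> 0" "a < n" "b < n"
  shows "peak (M \<otimes>c N) ((a + b) mod n) (l + m)"
  using tensor_pair.peak_ctensor[OF tensor_pairI[OF assms(1,2)] assms(3,4,5) n_pos assms(6,7)] .

lemma peak_cunit: "peak (cunit :: 'k comodule) 0 0"
  unfolding peak_def
proof (intro conjI exI[of _ "bvec 0"] ballI allI impI)
  show "bvec 0 \<noteq> (0 :: nat \<Rightarrow>\<^sub>0 'k)" by (metis lookup_single_eq lookup_zero zero_neq_one)
  show "bvec 0 \<in> coact_at cunit (0, 0) ` cspace (cunit :: 'k comodule)"
    by (rule image_eqI[of _ _ "bvec 0"]) (simp_all add: coact_at_cunit cspace_def)
qed (simp_all add: coact_at_cunit cspace_cunit)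

lemma peak_W:
  assumes "b < d"
  shows "peak (W a b c) (a mod n) (b + c * d)"
proof -
  have z: "peak (W 0 0 c) 0 (c * d)"
  proof (induction c)
    case (Suc c)
    have "gauss_binom d (c * d) q = of_nat (Suc c)"
      by (rule gauss_binom_root) (use d2 q_d q_neq_1 q_sum_nonzero[of _ 0] in \<open>auto simp: poly_q_int\<close>)
    then have "gauss_binom d (c * d) q \<noteq> 0" by (metis of_nat_neq_0)
    moreover have "peak Zc 0 d" using peak_uni[of 0 d] by simp
    ultimately have "peak (Zc \<otimes>c W 0 0 c) ((0 + 0) mod n) (d + c * d)"
      using n_pos Suc by (intro peak_ct is_comodule_uni is_comodule_W)
    then show ?case by (simp add: W_simps)
  qed (simp add: W_simps peak_cunit)
  have y: "peak (W 0 b c) 0 (b + c * d)" if "b < d" for b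
    using that
  proof (induction b)
    case (Suc b)
    \<comment> \<open>This binomial is the q-integer (b + 1 + c d)_q, nonzero as b + 1 < d. It would
      vanish for b + 1 = d, whence the bound on b.\<close>
    have "gauss_binom 1 (b + c * d) q \<noteq> 0"
      unfolding gauss_binom_1_left poly_q_int using q_sum_nonzero[of "Suc b" c] Suc.prems by simp
    moreover have "peak (W 0 b c) 0 (b + c * d)" using Suc by simp
    moreover have "peak Yc 0 1" using peak_uni[of 0 1] by simp
    ultimately have "peak (Yc \<otimes>c W 0 b c) ((0 + 0) mod n) (1 + (b + c * d))"
      using n_pos by (intro peak_ct is_comodule_uni is_comodule_W)
    then show ?case by (simp add: W_simps)
  qed (simp add: z)
  show ?thesis
  proof (induction a)
    case (Suc a)
    have "peak (Xc \<otimes>c W a b c) ((1 mod n + a mod n) mod n) (0 + (b + c * d))"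
      using n_pos by (intro peak_ct is_comodule_uni is_comodule_W peak_uni Suc) simp_all
    moreover have "(1 mod n + a mod n) mod n = Suc a mod n" by (simp only: mod_add_eq plus_1_eq_Suc)
    ultimately show ?case by (simp only: W_simps add_0)
  qed (simp add: y assms)
qed

lemma mul_cls_cunit: "Poly_Mapping.keys f \<subseteq> isoclasses \<Longrightarrow> cls cunit \<star> f = f"
  using G.l_one[of f] by (simp add: carrier_G mult_G one_G)

lemma cls_X_comm: "cls Xc \<star> cls (uni n t l) = cls (uni n t l) \<star> cls Xc"
  and cls_X_mul: "cls Xc \<star> cls (uni n t l) = cls (uni n (Suc t) l)"
  using cls_eqI[OF is_comodule_uni iso_x_uni(1), of 1 t l] cls_eqI[OF is_comodule_uni iso_x_uni(2), of 1 t l]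
  by (simp_all add: cls_mul is_comodule_uni)

text \<open>The condition on l guarantees (l + 1)_q \<noteq> 0. The value l = d is included for the
  sake of the second statement, which then says that y and z commute.\<close>

lemma cls_Y_mul:
  assumes "0 < l" "l < d \<or> l = d" "Suc l \<noteq> d"
  shows "cls Yc \<star> cls (uni n 0 l) \<approx> cls (uni n 0 (Suc l)) + cls (uni n 1 (l - 1))"
    "cls Yc \<star> cls (uni n 0 l) = cls (uni n 0 l) \<star> cls Yc"
proof -
  have nz: "(\<Sum>i<Suc l. q ^ i) \<noteq> 0"
    using assms q_sum_nonzero[of "Suc l" 0] q_sum_nonzero[of 1 1] d2 by (cases "l = d") auto
  note iso = iso_y_uni[OF nz assms(1)]
  have c: "is_comodule n (uni n 0 (Suc l) \<oplus>c uni n 1 (l - 1) :: 'k comodule)"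
    by (rule is_comodule_cs[OF is_comodule_uni is_comodule_uni])
  have "cls (uni n 0 (Suc l) \<oplus>c uni n 1 (l - 1)) \<approx> cls (uni n 0 (Suc l)) + cls (uni n 1 (l - 1))"
    by (rule cong_cls_csum[OF is_comodule_uni is_comodule_uni])
  then show "cls Yc \<star> cls (uni n 0 l) \<approx> cls (uni n 0 (Suc l)) + cls (uni n 1 (l - 1))"
    using cls_eqI[OF c iso(1)] by (simp add: cls_mul is_comodule_uni)
  show "cls Yc \<star> cls (uni n 0 l) = cls (uni n 0 l) \<star> cls Yc"
    using cls_eqI[OF c iso(1)] cls_eqI[OF c iso(2)] by (simp add: cls_mul is_comodule_uni)
qed

lemma cls_Y_mul_root: "cls Yc \<star> cls (uni n 0 (d - 1)) \<approx> cls (uni n 0 (d - 1)) + cls (uni n 1 (d - 1))"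
proof -
  have "(\<Sum>i<Suc (d - 1). q ^ i) = 0" using q_sum_eq_0 d2 by simp
  note iso = iso_y_uni_root[OF this]
  have c: "is_comodule n (uni n 0 (d - 1) \<oplus>c uni n 1 (d - 1) :: 'k comodule)"
    by (rule is_comodule_cs[OF is_comodule_uni is_comodule_uni])
  show ?thesis
    using cong_cls_csum[OF is_comodule_uni is_comodule_uni, of 0 "d - 1" 1 "d - 1"] cls_eqI[OF c iso]
    by (simp add: cls_mul is_comodule_uni)
qed

lemma keys_cls_W: "Poly_Mapping.keys (cls (W a b c)) \<subseteq> isoclasses"
  by (rule cls_in[OF is_comodule_W])

lemma keys_cls_uni: "Poly_Mapping.keys (cls (uni n t l)) \<subseteq> isoclasses"
  by (rule cls_in[OF is_comodule_uni])

lemma X_mul_W: "cls Xc \<star> cls (W a b c) = cls (W (Suc a) b c)"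
  by (simp add: cls_mul is_comodule_uni is_comodule_W W_simps)

lemma Y_mul_W0: "cls Yc \<star> cls (W 0 b c) = cls (W 0 (Suc b) c)"
  by (simp add: cls_mul is_comodule_uni is_comodule_W W_simps)

lemma Z_mul_W00: "cls Zc \<star> cls (W 0 0 c) = cls (W 0 0 (Suc c))"
  by (simp add: cls_mul is_comodule_uni is_comodule_W W_simps)

text \<open>The factor y is moved past each x by commutation, until it meets the powers of
  y.\<close>

lemma Y_mul_W: "cls Yc \<star> cls (W a b c) = cls (W a (Suc b) c)"
proof (induction a)
  case 0
  show ?case by (rule Y_mul_W0)
next
  case (Suc a)
  have "cls Yc \<star> cls (W (Suc a) b c) = (cls Yc \<star> cls Xc) \<star> cls (W a b c)"
    unfolding X_mul_W[symmetric] by (rule mul_assoc[symmetric, OF keys_cls_uni keys_cls_uni keys_cls_W])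
  also have "\<dots> = cls Xc \<star> (cls Yc \<star> cls (W a b c))"
    unfolding cls_X_comm[symmetric] by (rule mul_assoc[OF keys_cls_uni keys_cls_uni keys_cls_W])
  also have "\<dots> = cls (W (Suc a) (Suc b) c)" unfolding Suc X_mul_W ..
  finally show ?case .
qed

lemma Z_mul_W: "cls Zc \<star> cls (W a b c) = cls (W a b (Suc c))"
proof -
  have base: "cls Zc \<star> cls (W 0 b c) = cls (W 0 b (Suc c))"
  proof (induction b)
    case 0
    show ?case by (rule Z_mul_W00)
  next
    case (Suc b)
    have "cls Zc \<star> cls (W 0 (Suc b) c) = (cls Zc \<star> cls Yc) \<star> cls (W 0 b c)"
      unfolding Y_mul_W0[symmetric] by (rule mul_assoc[symmetric, OF keys_cls_uni keys_cls_uni keys_cls_W])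
    also have "cls Zc \<star> cls Yc = cls Yc \<star> cls Zc"
      using cls_Y_mul(2)[of d] d2 by simp
    also have "cls Yc \<star> cls Zc \<star> cls (W 0 b c) = cls Yc \<star> (cls Zc \<star> cls (W 0 b c))"
      by (rule mul_assoc[OF keys_cls_uni keys_cls_uni keys_cls_W])
    also have "\<dots> = cls (W 0 (Suc b) (Suc c))" unfolding Suc Y_mul_W0 ..
    finally show ?case .
  qed
  show ?thesis
  proof (induction a)
    case 0
    show ?case by (rule base)
  next
    case (Suc a)
    have "cls Zc \<star> cls (W (Suc a) b c) = (cls Zc \<star> cls Xc) \<star> cls (W a b c)"
      unfolding X_mul_W[symmetric] by (rule mul_assoc[symmetric, OF keys_cls_uni keys_cls_uni keys_cls_W])
    also have "\<dots> = cls Xc \<star> (cls Zc \<star> cls (W a b c))"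
      unfolding cls_X_comm[symmetric] by (rule mul_assoc[OF keys_cls_uni keys_cls_uni keys_cls_W])
    also have "\<dots> = cls (W (Suc a) b (Suc c))" unfolding Suc X_mul_W ..
    finally show ?case .
  qed
qed

text \<open>Commutation of the three generators suffices to multiply monomials by adding exponents.
  The equality holds already in the free group, before passing to the quotient.\<close>

lemma W_mul_W: "cls (W a b c) \<star> cls (W a' b' c') = cls (W (a + a') (b + b') (c + c'))"
proof -
  have z: "cls (W 0 0 c) \<star> cls (W a' b' c') = cls (W a' b' (c + c'))"
  proof (induction c)
    case 0
    show ?case using mul_cls_cunit[OF keys_cls_W] by (simp only: W_simps add_0)
  next
    case (Suc c)
    have "cls (W 0 0 (Suc c)) \<star> cls (W a' b' c') = cls Zc \<star> cls (W 0 0 c) \<star> cls (W a' b' c')"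
      by (simp only: Z_mul_W00)
    also have "\<dots> = cls Zc \<star> (cls (W 0 0 c) \<star> cls (W a' b' c'))"
      by (rule mul_assoc[OF keys_cls_uni keys_cls_W keys_cls_W])
    also have "\<dots> = cls (W a' b' (Suc c + c'))"
      by (simp only: Suc Z_mul_W add_Suc)
    finally show ?case .
  qed
  have y: "cls (W 0 b c) \<star> cls (W a' b' c') = cls (W a' (b + b') (c + c'))"
  proof (induction b)
    case 0
    show ?case using z by simp
  next
    case (Suc b)
    have "cls (W 0 (Suc b) c) \<star> cls (W a' b' c') = cls Yc \<star> cls (W 0 b c) \<star> cls (W a' b' c')"
      by (simp only: Y_mul_W0)
    also have "\<dots> = cls Yc \<star> (cls (W 0 b c) \<star> cls (W a' b' c'))"
      by (rule mul_assoc[OF keys_cls_uni keys_cls_W keys_cls_W])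
    also have "\<dots> = cls (W a' (Suc b + b') (c + c'))"
      by (simp only: Suc Y_mul_W add_Suc)
    finally show ?case .
  qed
  show ?thesis
  proof (induction a)
    case 0
    show ?case using y by simp
  next
    case (Suc a)
    have "cls (W (Suc a) b c) \<star> cls (W a' b' c') = cls Xc \<star> cls (W a b c) \<star> cls (W a' b' c')"
      by (simp only: X_mul_W)
    also have "\<dots> = cls Xc \<star> (cls (W a b c) \<star> cls (W a' b' c'))"
      by (rule mul_assoc[OF keys_cls_uni keys_cls_W keys_cls_W])
    also have "\<dots> = cls (W (Suc a + a') (b + b') (c + c'))"
      by (simp only: Suc X_mul_W add_Suc)
    finally show ?case .
  qed
qed

definition Wm :: "(var3 \<Rightarrow>\<^sub>0 nat) \<Rightarrow> 'k comodule" where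
  "Wm m = W (Poly_Mapping.lookup m VarX) (Poly_Mapping.lookup m VarY) (Poly_Mapping.lookup m VarZ)"

lemma is_comodule_Wm: "is_comodule n (Wm m)"
  by (simp add: Wm_def is_comodule_W)

text \<open>Equality of two basis elements of the free group is converted into equality of the
  classes by comparing supports.\<close>

lemma Wm_mul: "class_tensor n q (iso_class n (Wm m)) (iso_class n (Wm m')) = iso_class n (Wm (m + m'))"
  using arg_cong[OF W_mul_W[of "Poly_Mapping.lookup m VarX" "Poly_Mapping.lookup m VarY" "Poly_Mapping.lookup m VarZ"
        "Poly_Mapping.lookup m' VarX" "Poly_Mapping.lookup m' VarY" "Poly_Mapping.lookup m' VarZ"], of Poly_Mapping.keys]
  by (simp add: Wm_def lookup_add bil_single)

text \<open>Evaluation of a polynomial at the classes of the three generating comodules, with values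
  in the free group rather than in its quotient.\<close>

definition F :: "int_poly3 \<Rightarrow> ('k comodule set \<Rightarrow>\<^sub>0 int)" where
  "F p = (\<Sum>m\<in>Poly_Mapping.keys p. Poly_Mapping.single (iso_class n (Wm m)) (Poly_Mapping.lookup p m))"

lemma F_add: "F (p + p') = F p + F p'"
  unfolding F_def by (rule additive_extension) (simp_all add: single_add)

lemma F_zero [simp]: "F 0 = 0"
  by (simp add: F_def)

lemma F_uminus: "F (- p) = - F p"
  using F_add[of p "- p"] by (simp add: eq_neg_iff_add_eq_0 add.commute)

lemma F_diff: "F (p - p') = F p - F p'"
  using F_add[of p "- p'"] by (simp add: F_uminus)

lemma F_single: "F (Poly_Mapping.single m c) = Poly_Mapping.single (iso_class n (Wm m)) c"
  by (simp add: F_def)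

lemma keys_F: "Poly_Mapping.keys (F p) \<subseteq> isoclasses"
  unfolding F_def by (intro keys_sum_subset) (auto simp: is_comodule_Wm)

lemma F_one: "F 1 = cls cunit"
  using F_single[of 0 1] by (simp add: single_one Wm_def W_simps)

lemma F_mult: "F (p * p') = F p \<star> F p'"
proof -
  have "Poly_Mapping.keys p \<subseteq> UNIV" by simp
  then show ?thesis
  proof (induction p rule: keys_subset_induct)
    case (single m c)
    have "Poly_Mapping.keys p' \<subseteq> UNIV" by simp
    then show ?case
      by (induction p' rule: keys_subset_induct)
        (simp_all add: mult_single F_single bil_single Wm_mul distrib_left F_add bil_add_right)
  qed (simp_all add: distrib_right F_add bil_add_left)
qed

lemma F_pvar: "F (pvar VarX) = cls Xc" "F (pvar VarY) = cls Yc" "F (pvar VarZ) = cls Zc"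
proof -
  have "cls (M \<otimes>c cunit) = cls M" if "is_comodule n M" for M
    using cls_eqI[OF is_comodule_ct[OF that is_comodule_cunit] iso_unit_right[OF that]] .
  then show "F (pvar VarX) = cls Xc" "F (pvar VarY) = cls Yc" "F (pvar VarZ) = cls Zc"
    unfolding pvar_def F_single
    by (simp_all add: Wm_def lookup_single W_simps is_comodule_uni One_nat_def)
qed

lemma F_X_power: "F (pvar VarX ^ k) = cls (uni n k 0)"
proof (induction k)
  case 0
  show ?case using cls_eqI[OF is_comodule_uni iso_uni_cunit] by (simp add: F_one)
next
  case (Suc k)
  show ?case unfolding power_Suc F_mult F_pvar Suc cls_X_mul ..
qed

text \<open>The recursion of \<open>cheb\<close> is the rule for y V(0, k + 1), which needs (k +
  2)_q \<noteq> 0 and so carries the induction up to l = d - 1.\<close>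

lemma F_cheb: "l < d \<Longrightarrow> F (cheb l (pvar VarX) (pvar VarY)) \<approx> cls (uni n 0 l)"
proof (induction l rule: less_induct)
  case (less l)
  consider "l = 0" | "l = Suc 0" | k where "l = Suc (Suc k)" by (metis not0_implies_Suc)
  then show ?case
  proof cases
    case 1
    then show ?thesis using cls_eqI[OF is_comodule_uni iso_uni_cunit] by (simp add: F_one)
  next
    case 2
    then show ?thesis by (simp add: F_pvar)
  next
    case 3
    let ?S = "\<lambda>l. cheb l (pvar VarX) (pvar VarY) :: int_poly3"
    have "F (?S l) = cls Yc \<star> F (?S (Suc k)) - cls Xc \<star> F (?S k)"
      unfolding 3 cheb_rec F_diff F_mult F_pvar ..
    also have "\<dots> \<approx> cls Yc \<star> cls (uni n 0 (Suc k)) - cls Xc \<star> cls (uni n 0 k)"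
      using less 3 by (intro cong_diff cong_mul cong_refl keys_cls_uni keys_F) auto
    also have "\<dots> \<approx> cls (uni n 0 l) + cls (uni n 1 k) - cls (uni n 1 k)"
      using cls_Y_mul(1)[of "Suc k"] less.prems 3 cls_X_mul[of 0 k]
      by (intro cong_diff) (simp_all add: One_nat_def)
    finally show ?thesis by simp
  qed
qed

lemma F_relation: "F ((pvar VarY - pvar VarX - 1) * cheb (d - 1) (pvar VarX) (pvar VarY)) \<approx> 0"
proof -
  let ?S = "F (cheb (d - 1) (pvar VarX) (pvar VarY))" and ?V = "cls (uni n 0 (d - 1))"
  have S: "?S \<approx> ?V" by (rule F_cheb) (use d2 in simp)
  have 1: "F ((pvar VarY - pvar VarX - 1) * cheb (d - 1) (pvar VarX) (pvar VarY))
      = cls Yc \<star> ?S - cls Xc \<star> ?S - cls cunit \<star> ?S"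
    unfolding F_mult F_diff F_pvar F_one bil_diff ..
  have 2: "cls Yc \<star> ?S - cls Xc \<star> ?S - cls cunit \<star> ?S \<approx> cls Yc \<star> ?V - cls Xc \<star> ?V - cls cunit \<star> ?V"
    by (intro cong_diff cong_mul cong_refl S keys_cls_uni keys_F cls_in is_comodule_cunit)
  have X: "cls Xc \<star> ?V = cls (uni n 1 (d - 1))" using cls_X_mul[of 0 "d - 1"] by simp
  have "cls Yc \<star> ?V - cls Xc \<star> ?V - cls cunit \<star> ?V \<approx> (?V + cls (uni n 1 (d - 1))) - cls (uni n 1 (d - 1)) - ?V"
    unfolding X mul_cls_cunit[OF keys_cls_uni]
    by (rule cong_diff[OF cong_diff[OF cls_Y_mul_root cong_refl] cong_refl])
  also have "(?V + cls (uni n 1 (d - 1))) - cls (uni n 1 (d - 1)) - ?V = 0" by (simp only: add_diff_cancel_right' diff_self)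
  finally show ?thesis unfolding 1 by (rule cong_trans[OF 2])
qed

text \<open>The n-th power of x has degree n, which is degree 0, so it is the unit.\<close>

lemma F_X_power_n: "F (pvar VarX ^ n - 1) \<approx> 0"
proof -
  have "uni n n 0 = (uni n (n mod n) 0 :: 'k comodule)" by (rule uni_mod[symmetric])
  then have "uni n n 0 = (uni n 0 0 :: 'k comodule)" by simp
  then have "F (pvar VarX ^ n - 1) = 0"
    using F_X_power[of 0] by (simp add: F_diff F_X_power)
  then show ?thesis by simp
qed

text \<open>Let m be a monomial of \<open>r\<close> whose leading string is longest. The rank at the
  top degree and length of that string is 1 on m and 0 on every other monomial of \<open>r\<close>,
  so it reads off the coefficient of m, which must then vanish.\<close>

lemma F_reduced_injective:
  assumes r: "Poly_Mapping.keys r \<subseteq> reduced n d" and I: "F r \<in> I"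
  shows "r = 0"
proof (rule ccontr)
  assume "r \<noteq> 0"
  then have ne: "Poly_Mapping.keys r \<noteq> {}" using sum_single_keys[of r] by auto
  define lev where "lev m = Poly_Mapping.lookup m VarY + Poly_Mapping.lookup m VarZ * d" for m :: "var3 \<Rightarrow>\<^sub>0 nat"
  obtain m where m: "m \<in> Poly_Mapping.keys r" "\<And>m'. m' \<in> Poly_Mapping.keys r \<Longrightarrow> lev m' \<le> lev m"
  proof -
    have "finite (lev ` Poly_Mapping.keys r)" "lev ` Poly_Mapping.keys r \<noteq> {}" using ne by auto
    then obtain m where "m \<in> Poly_Mapping.keys r" "lev m = Max (lev ` Poly_Mapping.keys r)"
      using Max_in by (metis (no_types, lifting) imageE)
    then show ?thesis using that by (metis Max_ge finite_imageI finite_keys imageI)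
  qed
  let ?p = "(Poly_Mapping.lookup m VarX, lev m)"
  have rk: "rk (Wm m') ?p = (if m' = m then 1 else 0)" if m': "m' \<in> Poly_Mapping.keys r" for m'
  proof -
    interpret M: comodule n "Wm m'" by standard (rule is_comodule_Wm)
    have red: "Poly_Mapping.lookup m' VarX < n" "Poly_Mapping.lookup m' VarY < d"
        "Poly_Mapping.lookup m VarX < n" "Poly_Mapping.lookup m VarY < d"
      using r m' m(1) by (auto simp: reduced_def)
    have pk: "peak (Wm m') (Poly_Mapping.lookup m' VarX) (lev m')"
      using peak_W[OF red(2), of "Poly_Mapping.lookup m' VarX" "Poly_Mapping.lookup m' VarZ"] red(1)
      by (simp add: Wm_def lev_def)
    show ?thesis
    proof (cases "lev m' = lev m")
      \<comment> \<open>Since exponents of y are below d, division with remainder recovers the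
        exponents of y and z from the length; monomials of equal length can differ only in x, that
        is, in the degree of the top.\<close>
      case True
      have "lev m' mod d = Poly_Mapping.lookup m' VarY" "lev m mod d = Poly_Mapping.lookup m VarY"
        "lev m' div d = Poly_Mapping.lookup m' VarZ" "lev m div d = Poly_Mapping.lookup m VarZ"
        using red by (simp_all add: lev_def)
      then have yz: "Poly_Mapping.lookup m' VarY = Poly_Mapping.lookup m VarY"
        "Poly_Mapping.lookup m' VarZ = Poly_Mapping.lookup m VarZ" using True by simp_all
      show ?thesis
      proof (cases "Poly_Mapping.lookup m' VarX = Poly_Mapping.lookup m VarX")
        case x: True
        then have "m' = m" using yz mono3_eta[of m] mono3_eta[of m'] by simp
        then show ?thesis using M.rk_peak(1)[OF pk] by simp
      next
        case False
        then show ?thesis using M.rk_peak(2)[OF pk, of "Poly_Mapping.lookup m VarX"] True by auto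
      qed
    next
      case False
      then have "lev m' < lev m" using m(2)[OF m'] by simp
      then show ?thesis using M.rk_peak(3)[OF pk, of "lev m" "Poly_Mapping.lookup m VarX"] False by auto
    qed
  qed
  have rank_F: "rank ?p (F r) = (\<Sum>m'\<in>Poly_Mapping.keys r. Poly_Mapping.lookup r m' * int (rk (Wm m') ?p))"
  proof -
    have "rank ?p (sum f A) = (\<Sum>x\<in>A. rank ?p (f x))" for f and A :: "(var3 \<Rightarrow>\<^sub>0 nat) set"
      by (induction A rule: infinite_finite_induct) (simp_all add: rank_add)
    then show ?thesis unfolding F_def by (simp add: rank_single is_comodule_Wm)
  qed
  also have "\<dots> = (\<Sum>m'\<in>Poly_Mapping.keys r. if m' = m then Poly_Mapping.lookup r m else 0)"
    by (intro sum.cong refl) (simp add: rk)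
  also have "\<dots> = Poly_Mapping.lookup r m" using m(1) by simp
  finally show False using rank_I[OF I, of ?p] m(1) by (simp add: in_keys_iff)
qed

text \<open>The zero comodule has a nonzero class in the free group; it becomes 0 in the quotient
  because M is isomorphic to its direct sum with itself.\<close>

lemma cls_zero:
  assumes M: "is_comodule n M" and "cdim M = 0"
  shows "cls M \<approx> 0"
proof -
  have c: "cspace (M \<oplus>c M) = {0}" "cspace M = {0}"
    using assms(2) by (simp_all add: cspace_def span_on_def)
  interpret M: comodule n M by standard (rule M)
  have "comodule_iso (M \<oplus>c M) M"
    unfolding comodule_iso_iff c
    by (intro exI[of _ "\<lambda>v. v"])
      (simp add: bij_betw_def is_linear_zeroD[OF M.linear_coact_at] is_linear_zeroD[OF is_linear_coact_at[OF linear_coact_csum]])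
  then have "cls M = cls (M \<oplus>c M)"
    using cls_eqI[OF is_comodule_cs[OF M M]] by simp
  also have "\<dots> \<approx> cls M + cls M" by (rule cong_cls_csum[OF M M])
  finally have "cls M - (cls M + cls M) \<in> I" by (simp add: cong_def)
  then have "- (cls M - (cls M + cls M)) \<in> I" by (rule I_uminus)
  then show ?thesis by (simp add: cong_def)
qed

lemma cls_iso_csum:
  assumes "is_comodule n N" "is_comodule n P" "comodule_iso (N \<oplus>c P) M"
  shows "cls M \<approx> cls N + cls P"
  using cls_eqI[OF is_comodule_cs[OF assms(1,2)] assms(3)] cong_cls_csum[OF assms(1,2)] by simp

text \<open>The outer induction is on the bound for the lengths. It first expresses a single longest
  string through a monomial and shorter comodules; the inner induction, on dimension, then splits
  off such strings one at a time.\<close>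

lemma cls_in_range_bounded:
  assumes "is_comodule n M" "\<forall>w\<in>cspace M. \<forall>i l. l \<ge> L \<longrightarrow> coact_at M (i, l) w = 0"
  shows "\<exists>p. cls M \<approx> F p"
  using assms
proof (induction L arbitrary: M)
  case 0
  interpret M: comodule n M by standard (rule 0(1))
  have "w = 0" if "w \<in> cspace M" for w
    using M.sum_coact_at[OF that] 0(2) that by simp
  then have "cspace M = {0}" by (auto simp: cspace_def)
  then have "pm.dim (cspace M) \<le> card ({} :: (nat \<Rightarrow>\<^sub>0 'k) set)"
    by (intro pm.dim_le_card) simp_all
  then have "cdim M = 0" by (simp add: dim_cspace)
  then have "cls M \<approx> F 0" using cls_zero[OF 0(1)] by simp
  then show ?case by blast
next
  case (Suc L)
  have uni: "\<exists>p. cls (uni n t L) \<approx> F p" if t: "t < n" for t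
  proof -
    \<comment> \<open>The exponents of y and z are remainder and quotient of L by d, so that the
      leading string of this monomial has exactly the required length.\<close>
    let ?M = "W t (L mod d) (L div d)"
    have "peak ?M t L"
      using peak_W[of "L mod d" t "L div d"] t d2 by simp
    then obtain M' where M': "is_comodule n M'" "comodule_iso (uni n t L \<oplus>c M') ?M"
       "\<forall>w\<in>cspace M'. \<forall>i l. l \<ge> L \<longrightarrow> coact_at M' (i, l) w = 0"
      using split_peak[OF is_comodule_W] by blast
    obtain p where p: "cls M' \<approx> F p" using Suc.IH[OF M'(1,3)] by blast
    have "cls ?M = F (Poly_Mapping.single (mono3 t (L mod d) (L div d)) 1)"
      by (simp add: F_single Wm_def)
    moreover have "cls ?M \<approx> cls (uni n t L) + cls M'"
      by (rule cls_iso_csum[OF is_comodule_uni M'(1,2)])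
    ultimately have "F (Poly_Mapping.single (mono3 t (L mod d) (L div d)) 1) - F p \<approx> cls (uni n t L) + cls M' - cls M'"
      by (intro cong_diff) (simp_all only: cong_sym[OF p])
    then have "cls (uni n t L) \<approx> F (Poly_Mapping.single (mono3 t (L mod d) (L div d)) 1 - p)"
      by (simp add: F_diff cong_sym)
    then show ?thesis by blast
  qed
  from Suc.prems show ?case
  proof (induction "cdim M" arbitrary: M rule: less_induct)
    case (less M)
    interpret M: comodule n M by standard (rule less.prems(1))
    show ?case
    proof (cases "\<forall>w\<in>cspace M. \<forall>i. coact_at M (i, L) w = 0")
      case True
      have "\<forall>w\<in>cspace M. \<forall>i l. l \<ge> L \<longrightarrow> coact_at M (i, l) w = 0"
      proof (intro ballI allI impI)
        fix w i l assume "w \<in> cspace M" "l \<ge> L"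
        then show "coact_at M (i, l) w = 0"
          using True less.prems(2) by (cases "l = L") auto
      qed
      then show ?thesis by (rule Suc.IH[OF less.prems(1)])
    next
      case False
      then obtain w t where w: "w \<in> cspace M" "coact_at M (t, L) w \<noteq> 0" by blast
      have t: "t < n" using M.coact_at_outside[OF w(1), of "(t, L)"] w(2) by (auto simp: paths_def)
      have v: "hmg M t (coact_at M (t, 0) w)" using M.hmg_coact_at[OF w(1) t, of 0] t by simp
      have "(xop n M ^^ L) (coact_at M (t, 0) w) \<noteq> 0" using w M.coact_at_eq[OF w(1), of t L] by simp
      moreover have "(xop n M ^^ Suc L) u = 0" if "u \<in> cspace M" for u
        unfolding M.xop_pow_eq[OF that] by (rule sum.neutral) (use less.prems(2) that in auto)
      ultimately obtain M' where M': "is_comodule n M'" "comodule_iso (uni n t L \<oplus>c M') M"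
        using split_uni[OF less.prems(1) v] by blast
      interpret S: comodule_pair n "uni n t L :: 'k comodule" M'
        by (rule comodule_pairI[OF is_comodule_uni M'(1)])
      have "cdim M' < cdim M" using comodule_iso_cdim[OF M'(2)] by simp
      moreover have "\<forall>w\<in>cspace M'. \<forall>i l. l \<ge> Suc L \<longrightarrow> coact_at M' (i, l) w = 0"
      proof -
        have "rk M' (i, l) = 0" if "l \<ge> Suc L" for i l
        proof -
          have "rk M (i, l) = 0" unfolding M.rk_eq_0_iff using less.prems(2) that by blast
          then show ?thesis
            using rk_iso[OF S.is_comodule_csum M'(2), of "(i, l)"] S.rk_csum[of "(i, l)"] by simp
        qed
        then show ?thesis using S.N.rk_eq_0_iff by blast
      qed
      ultimately obtain p' where p': "cls M' \<approx> F p'" using less.hyps M'(1) by blast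
      obtain p where p: "cls (uni n t L) \<approx> F p" using uni[OF t] by blast
      have "cls M \<approx> cls (uni n t L) + cls M'"
        by (rule cls_iso_csum[OF is_comodule_uni M'(1,2)])
      also have "\<dots> \<approx> F p + F p'" by (rule cong_add[OF p p'])
      finally show ?thesis unfolding F_add[symmetric] by blast
    qed
  qed
qed

lemma bounded_length:
  assumes "is_comodule n M"
  shows "\<exists>L. \<forall>w\<in>cspace M. \<forall>i l. l \<ge> L \<longrightarrow> coact_at M (i, l) w = 0"
proof -
  interpret M: comodule n M by standard (rule assms)
  have "\<exists>L. \<forall>l\<ge>L. (xop n M ^^ l) (bvec a) = 0" if "a < cdim M" for a
    by (rule M.nilpotent_at) (use that in \<open>simp add: cspace_def\<close>)
  then obtain K where K: "\<And>a l. a < cdim M \<Longrightarrow> l \<ge> K a \<Longrightarrow> (xop n M ^^ l) (bvec a) = 0" by metis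
  \<comment> \<open>Any common upper bound of the nilpotency orders on the basis will do; the sum is
    one.\<close>
  define L where "L = (\<Sum>a<cdim M. K a)"
  have zero: "(xop n M ^^ l) w = 0" if "w \<in> cspace M" "l \<ge> L" for w l
  proof (rule linear_eq_span_on[OF M.linear_xop_pow is_linear_const_zero that(1)[unfolded cspace_def]])
    fix a assume a: "a \<in> {..<cdim M}"
    have "K a \<le> L" unfolding L_def by (rule member_le_sum[OF a]) auto
    then show "(xop n M ^^ l) (bvec a) = 0" using K a that(2) by auto
  qed
  show ?thesis
  proof (intro exI[of _ L] ballI allI impI)
    fix w i l assume w: "w \<in> cspace M" "L \<le> l"
    show "coact_at M (i, l) w = 0"
      unfolding M.coact_at_eq[OF w(1), of i l] by (rule zero[OF M.coact_at_in[OF w(1)] w(2)])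
  qed
qed

lemma F_surj:
  assumes "Poly_Mapping.keys f \<subseteq> isoclasses"
  shows "\<exists>p. f \<approx> F p"
  using assms
proof (induction f rule: keys_subset_induct)
  case zero
  then show ?case by (intro exI[of _ 0]) simp
next
  case (single A c)
  then obtain M where M: "A = iso_class n M" "is_comodule n M" by (auto simp: isoclasses_def)
  obtain p where p: "cls M \<approx> F p"
    using bounded_length[OF M(2)] cls_in_range_bounded[OF M(2)] by blast
  \<comment> \<open>Integer coefficients on the Green ring side correspond to constants in the
    polynomial ring, so coefficient 1 suffices by additivity.\<close>
  have "Poly_Mapping.single A c - F (of_int c * p) \<in> I"
  proof (rule additive_int_mem[where H = I and r = "\<lambda>c. Poly_Mapping.single A c - F (of_int c * p)"])
    show "Poly_Mapping.single A (a + b) - F (of_int (a + b) * p)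
      = Poly_Mapping.single A a - F (of_int a * p) + (Poly_Mapping.single A b - F (of_int b * p))" for a b
      by (simp add: single_add distrib_right F_add)
    show "Poly_Mapping.single A 1 - F (of_int 1 * p) \<in> I" using p by (simp add: cong_def M)
  qed (simp_all add: I_zero I_add I_uminus)
  then show ?case unfolding cong_def by blast
next
  case (add f g)
  then obtain p p' where "f \<approx> F p" "g \<approx> F p'" by blast
  then have "f + g \<approx> F (p + p')" unfolding F_add by (rule cong_add)
  then show ?case by blast
qed

lemma coset_eq_iff:
  assumes "Poly_Mapping.keys f \<subseteq> isoclasses" "Poly_Mapping.keys g \<subseteq> isoclasses"
  shows "I +>\<^bsub>G\<^esub> f = I +>\<^bsub>G\<^esub> g \<longleftrightarrow> f \<approx> g"
proof -
  have "f \<in> carrier G" "g \<in> carrier G" using assms by (simp_all add: carrier_G)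
  then have "I +>\<^bsub>G\<^esub> f = I +>\<^bsub>G\<^esub> g \<longleftrightarrow> f \<ominus>\<^bsub>G\<^esub> g \<in> I"
    using G.quotient_eq_iff_same_a_r_cos[OF ideal_I] by simp
  then show ?thesis
    using assms by (simp add: a_minus_def a_inv_G add_G cong_def)
qed

definition \<phi> :: "int_poly3 \<Rightarrow> ('k comodule set \<Rightarrow>\<^sub>0 int) set" where
  "\<phi> p = I +>\<^bsub>G\<^esub> F p"

lemma ring_hom_\<phi>: "ring_hom_ring int_poly3_ring (G Quot I) \<phi>"
proof (rule ring_hom_ringI2[OF ring_from_type_algebra I.quotient_is_ring], rule ring_hom_memI)
  note h = ring_hom_memE[OF I.rcos_ring_hom]
  have F: "F p \<in> carrier G" for p using keys_F by (simp add: carrier_G)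
  fix p p' :: int_poly3
  show "\<phi> p \<in> carrier (G Quot I)" unfolding \<phi>_def by (rule h(1)[OF F])
  show "\<phi> (p \<otimes>\<^bsub>int_poly3_ring\<^esub> p') = \<phi> p \<otimes>\<^bsub>G Quot I\<^esub> \<phi> p'"
    using h(2)[OF F F] by (simp add: \<phi>_def ring_of_type_algebra_def F_mult mult_G)
  show "\<phi> (p \<oplus>\<^bsub>int_poly3_ring\<^esub> p') = \<phi> p \<oplus>\<^bsub>G Quot I\<^esub> \<phi> p'"
    using h(3)[OF F F] by (simp add: \<phi>_def ring_of_type_algebra_def F_add add_G)
  show "\<phi> \<one>\<^bsub>int_poly3_ring\<^esub> = \<one>\<^bsub>G Quot I\<^esub>"
    using h(4) by (simp add: \<phi>_def ring_of_type_algebra_def F_one one_G)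
qed

lemma surj_\<phi>: "\<phi> ` carrier int_poly3_ring = carrier (G Quot I)"
proof
  show "\<phi> ` carrier int_poly3_ring \<subseteq> carrier (G Quot I)"
    using ring_hom_memE(1)[OF ring_hom_ring.homh[OF ring_hom_\<phi>]] by blast
  show "carrier (G Quot I) \<subseteq> \<phi> ` carrier int_poly3_ring"
  proof
    fix c assume "c \<in> carrier (G Quot I)"
    then obtain f where f: "Poly_Mapping.keys f \<subseteq> isoclasses" "c = I +>\<^bsub>G\<^esub> f"
      by (auto simp: FactRing_def A_RCOSETS_def' carrier_G)
    obtain p where "f \<approx> F p" using F_surj[OF f(1)] by blast
    then have "c = \<phi> p" using f coset_eq_iff[OF f(1) keys_F] by (simp add: \<phi>_def)
    then show "c \<in> \<phi> ` carrier int_poly3_ring" by (simp add: ring_of_type_algebra_def)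
  qed
qed

lemma kernel_iff: "p \<in> a_kernel int_poly3_ring (G Quot I) \<phi> \<longleftrightarrow> F p \<in> I"
proof -
  have "\<zero>\<^bsub>G Quot I\<^esub> = I +>\<^bsub>G\<^esub> 0"
    using G.a_coset_join2[of 0 I] subgroup_I I_zero by (simp add: FactRing_def carrier_G)
  then have "\<phi> p = \<zero>\<^bsub>G Quot I\<^esub> \<longleftrightarrow> F p \<approx> 0"
    using coset_eq_iff[OF keys_F, of 0 p] by (simp add: \<phi>_def)
  then show ?thesis by (simp add: a_kernel_def' ring_of_type_algebra_def cong_def)
qed

text \<open>An element of the kernel agrees modulo the ideal with a reduced polynomial, which is
  again in the kernel and hence zero by injectivity on reduced polynomials.\<close>

lemma kernel_eq: "a_kernel int_poly3_ring (G Quot I) \<phi> = green_ideal n d"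
proof
  show sub: "green_ideal n d \<subseteq> a_kernel int_poly3_ring (G Quot I) \<phi>"
    by (rule green_ideal_minimal[OF ring_hom_ring.kernel_is_ideal[OF ring_hom_\<phi>]])
      (use F_X_power_n F_relation in \<open>simp_all add: kernel_iff cong_def\<close>)
  show "a_kernel int_poly3_ring (G Quot I) \<phi> \<subseteq> green_ideal n d"
  proof
    fix p assume p: "p \<in> a_kernel int_poly3_ring (G Quot I) \<phi>"
    obtain r where r: "Poly_Mapping.keys r \<subseteq> reduced n d" "p - r \<in> green_ideal n d"
      using reduction[OF n_pos d2] by blast
    have "F (p - r) \<in> I" using r(2) sub kernel_iff by blast
    then have "F p - F (p - r) \<in> I" using p kernel_iff I_diff by blast
    then have "F r \<in> I" by (simp add: F_diff)
    then have "r = 0" by (rule F_reduced_injective[OF r(1)])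
    then show "p \<in> green_ideal n d" using r(2) by simp
  qed
qed

lemma green_iso: "green_ring n q \<simeq> int_poly3_ring Quot green_ideal n d"
proof -
  have "int_poly3_ring Quot green_ideal n d \<simeq> G Quot I"
    using ring_hom_ring.FactRing_iso[OF ring_hom_\<phi> surj_\<phi>] by (simp only: kernel_eq)
  then show ?thesis
    unfolding green_ring_eq by (rule ring_iso_sym[OF ideal.quotient_is_ring[OF ideal_green_ideal]])
qed

end

theorem theorem3p25:
  fixes q :: "'k::{alg_closed_field, field_char_0}" and n d :: nat
  assumes "n > 1"
    and "q ^ n = 1"
    and "d = (LEAST e. e > 0 \<and> q ^ e = 1)"
    and "d \<ge> 2"
  shows "ring (green_ring n q) \<and>
         green_ring n q \<simeq> int_poly3_ring Quot green_ideal n d"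
proof -
  \<comment> \<open>The number n witnesses that the set defining d is nonempty, so the least element
    has the defining property.\<close>
  have "n > 0 \<and> q ^ n = 1" using assms by simp
  then have "d > 0 \<and> q ^ d = 1" unfolding assms(3) by (rule LeastI)
  moreover have "q ^ e \<noteq> 1" if "0 < e" "e < d" for e
    using not_less_Least[of e "\<lambda>e. e > 0 \<and> q ^ e = 1"] that unfolding assms(3) by simp
  ultimately interpret green n q d
    by unfold_locales (use assms in auto)
  show ?thesis using ring_green green_iso by blast
qed

end
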